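(* Let $f$ be a Floyd function. For $n\ge 2$, let $G=A_1\ast\dots\ast A_n$ be a free product of finitely generated elementary groups such that at least one free factor is infinite. Then the Floyd boundary $\partial_f(G)$ is homeomorphic to the Cantor set.
   Context: All groups are assumed finitely generated. A Floyd function is a map $f:\mathbb N\to\mathbb R_{>0}$ with $\sum_{n\ge 1} f(n)<\infty$ and for which there is $\lambda>0$ with $f(n)\ge f(n+1)\ge \lambda f(n)$ for all $n\in\mathbb N$; one sets $f(0):=f(1)$. Let $G$ be a group with finite generating set $S$, Cayley graph $\Gamma_{G}$, word metric $d$ (edges of length 1) and identity $e_G$. An edge joining vertices $g,h$ is given the new length $f(d(e_G,\{g,h\}))$, where $d(e_G,\{g,h\})=\min\{d(e_G,g),d(e_G,h)\}$; the Floyd length of an edge path is the sum of the new lengths of its edges, and the Floyd metric $d_f$ on $\Gamma_G$ is the infimum of Floyd lengths of paths joining two points. The Floyd completion $\overline\Gamma_G$ is the Cauchy completion of $(\Gamma_G,d_f)$, and the Floyd boundary is $\partial_f(G):=\overline\Gamma_G\setminus\Gamma_G$ with the subspace topology; up to homeomorphism it does not depend on $S$. A group is elementary if it is virtually cyclic (finite groups included), and non-elementary otherwise.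
   Formalization: The formal theorem additionally assumes that at least two of the free factors are nontrivial; without this the claim fails, e.g. for the free product of the integers with the trivial group, whose Floyd boundary has two points. *)

theory Defs
  imports "HOL-Analysis.Analysis" "HOL-Algebra.Elementary_Groups"
begin

subsection \<open>Elementary groups\<close>

definition finitely_generated :: "('g, 'm) monoid_scheme \<Rightarrow> bool" where
  "finitely_generated G \<longleftrightarrow>
     (\<exists>S. finite S \<and> S \<subseteq> carrier G \<and> generate G S = carrier G)"

text \<open>Elementary means virtually cyclic. Finite groups are included (take the trivial subgroup).\<close>

definition elementary_group :: "('g, 'm) monoid_scheme \<Rightarrow> bool" where
  "elementary_group G \<longleftrightarrow>
     (\<exists>H. subgroup H G \<and> cyclic_group (G\<lparr>carrier := H\<rparr>) \<and> finite (rcosets\<^bsub>G\<^esub> H))"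


subsection \<open>Free products of groups\<close>

text \<open>
  An element of the free product of the groups \<open>A i\<close>, \<open>i \<in> I\<close>, is a reduced word: a list of
  letters \<open>(i, a)\<close> with \<open>a\<close> a non-identity element of \<open>A i\<close>, neighbouring letters coming from
  different factors. A product is formed by multiplying the letters of the left-hand word one
  after the other onto the right-hand word, cancelling or merging letters where necessary.
\<close>

definition reduced_words :: "'i set \<Rightarrow> ('i \<Rightarrow> 'a monoid) \<Rightarrow> ('i \<times> 'a) list set" where
  "reduced_words I A =
     {w. (\<forall>(i, a) \<in> set w. i \<in> I \<and> a \<in> carrier (A i) \<and> a \<noteq> \<one>\<^bsub>A i\<^esub>) \<and> distinct_adj (map fst w)}"

fun letter_mult :: "('i \<Rightarrow> 'a monoid) \<Rightarrow> 'i \<times> 'a \<Rightarrow> ('i \<times> 'a) list \<Rightarrow> ('i \<times> 'a) list" where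
  "letter_mult A (i, a) [] = (if a = \<one>\<^bsub>A i\<^esub> then [] else [(i, a)])"
| "letter_mult A (i, a) ((j, b) # w) =
     (if a = \<one>\<^bsub>A i\<^esub> then (j, b) # w
      else if i = j then (if a \<otimes>\<^bsub>A i\<^esub> b = \<one>\<^bsub>A i\<^esub> then w else (i, a \<otimes>\<^bsub>A i\<^esub> b) # w)
      else (i, a) # (j, b) # w)"

definition free_product :: "'i set \<Rightarrow> ('i \<Rightarrow> 'a monoid) \<Rightarrow> ('i \<times> 'a) list monoid" where
  "free_product I A =
     \<lparr>carrier = reduced_words I A, mult = (\<lambda>u v. foldr (letter_mult A) u v), one = []\<rparr>"


subsection \<open>The Cayley graph and the word metric\<close>

text \<open>
  The Cayley graph is treated as a simple graph: loops and multiple edges are omitted, as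
  neither affects any distance below.
\<close>

definition cayley_edges :: "('g, 'm) monoid_scheme \<Rightarrow> 'g set \<Rightarrow> ('g \<times> 'g) set" where
  "cayley_edges G S =
     {(g, h). g \<in> carrier G \<and> h \<in> carrier G \<and> g \<noteq> h \<and>
        (\<exists>s\<in>S. h = g \<otimes>\<^bsub>G\<^esub> s \<or> g = h \<otimes>\<^bsub>G\<^esub> s)}"

definition word_dist :: "('g, 'm) monoid_scheme \<Rightarrow> 'g set \<Rightarrow> 'g \<Rightarrow> 'g \<Rightarrow> nat" where
  "word_dist G S g h = (LEAST k. (g, h) \<in> cayley_edges G S ^^ k)"

text \<open>
  Points of the geometric realization are given by barycentric coordinates, i.e. as functions
  from vertices to reals: \<open>edge_point g h t\<close> is the point of the edge \<open>{g, h}\<close> at parameter \<open>t\<close>,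
  so that \<open>edge_point g g t\<close> is the vertex \<open>g\<close>.
\<close>

definition edge_point :: "'g \<Rightarrow> 'g \<Rightarrow> real \<Rightarrow> 'g \<Rightarrow> real" where
  "edge_point g h t = (\<lambda>x. (1 - t) * of_bool (x = g) + t * of_bool (x = h))"

definition closed_edge :: "'g \<Rightarrow> 'g \<Rightarrow> ('g \<Rightarrow> real) set" where
  "closed_edge g h = edge_point g h ` {0..1}"

definition cayley_space :: "('g, 'm) monoid_scheme \<Rightarrow> 'g set \<Rightarrow> ('g \<Rightarrow> real) set" where
  "cayley_space G S =
     (\<Union>g\<in>carrier G. closed_edge g g) \<union> (\<Union>(g, h)\<in>cayley_edges G S. closed_edge g h)"


subsection \<open>The Floyd metric\<close>

text \<open>Only the values of \<open>f\<close> at positive arguments are data; \<open>f 0\<close> is set by convention.\<close>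

definition floyd_function :: "(nat \<Rightarrow> real) \<Rightarrow> bool" where
  "floyd_function f \<longleftrightarrow>
     (\<forall>n. f n > 0) \<and> summable f \<and> f 0 = f 1 \<and>
     (\<exists>c>0. \<forall>n. f n \<ge> f (Suc n) \<and> f (Suc n) \<ge> c * f n)"

definition floyd_edge_length ::
  "(nat \<Rightarrow> real) \<Rightarrow> ('g, 'm) monoid_scheme \<Rightarrow> 'g set \<Rightarrow> 'g \<Rightarrow> 'g \<Rightarrow> real" where
  "floyd_edge_length f G S g h = f (min (word_dist G S \<one>\<^bsub>G\<^esub> g) (word_dist G S \<one>\<^bsub>G\<^esub> h))"

text \<open>
  \<open>floyd_path f G S p q L\<close>: there is a path from \<open>p\<close> to \<open>q\<close> of Floyd length \<open>L\<close>, consisting of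
  finitely many segments, each inside a closed edge. The coordinate at \<open>h\<close> is the parameter
  along the edge \<open>{g, h}\<close>, so a segment has length equal to the Floyd length of the edge times
  the difference of these coordinates.
\<close>

inductive floyd_path ::
  "(nat \<Rightarrow> real) \<Rightarrow> ('g, 'm) monoid_scheme \<Rightarrow> 'g set \<Rightarrow> ('g \<Rightarrow> real) \<Rightarrow> ('g \<Rightarrow> real) \<Rightarrow> real \<Rightarrow> bool"
  for f G S where
  refl: "p \<in> cayley_space G S \<Longrightarrow> floyd_path f G S p p 0"
| step: "(g, h) \<in> cayley_edges G S \<Longrightarrow> p \<in> closed_edge g h \<Longrightarrow> q \<in> closed_edge g h \<Longrightarrow>
         floyd_path f G S q r L \<Longrightarrow>
         floyd_path f G S p r (floyd_edge_length f G S g h * \<bar>p h - q h\<bar> + L)"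

text \<open>The value 0 outside the Cayley graph is a dummy; the same applies to \<open>completion_dist\<close>.\<close>

definition floyd_dist ::
  "(nat \<Rightarrow> real) \<Rightarrow> ('g, 'm) monoid_scheme \<Rightarrow> 'g set \<Rightarrow> ('g \<Rightarrow> real) \<Rightarrow> ('g \<Rightarrow> real) \<Rightarrow> real" where
  "floyd_dist f G S p q =
     (if p \<in> cayley_space G S \<and> q \<in> cayley_space G S then Inf {L. floyd_path f G S p q L} else 0)"


subsection \<open>Cauchy completion\<close>

definition cauchy_equiv :: "'x set \<Rightarrow> ('x \<Rightarrow> 'x \<Rightarrow> real) \<Rightarrow> ((nat \<Rightarrow> 'x) \<times> (nat \<Rightarrow> 'x)) set" where
  "cauchy_equiv M d =
     {(\<sigma>, \<tau>). Metric_space.MCauchy M d \<sigma> \<and> Metric_space.MCauchy M d \<tau> \<and>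
              (\<lambda>k. d (\<sigma> k) (\<tau> k)) \<longlonglongrightarrow> 0}"

definition cauchy_completion :: "'x set \<Rightarrow> ('x \<Rightarrow> 'x \<Rightarrow> real) \<Rightarrow> (nat \<Rightarrow> 'x) set set" where
  "cauchy_completion M d = {\<sigma>. Metric_space.MCauchy M d \<sigma>} // cauchy_equiv M d"

definition completion_dist ::
  "'x set \<Rightarrow> ('x \<Rightarrow> 'x \<Rightarrow> real) \<Rightarrow> (nat \<Rightarrow> 'x) set \<Rightarrow> (nat \<Rightarrow> 'x) set \<Rightarrow> real" where
  "completion_dist M d P Q =
     (if P \<in> cauchy_completion M d \<and> Q \<in> cauchy_completion M d
      then THE r. \<forall>\<sigma>\<in>P. \<forall>\<tau>\<in>Q. (\<lambda>k. d (\<sigma> k) (\<tau> k)) \<longlonglongrightarrow> r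
      else 0)"

definition completion_topology :: "'x set \<Rightarrow> ('x \<Rightarrow> 'x \<Rightarrow> real) \<Rightarrow> (nat \<Rightarrow> 'x) set topology" where
  "completion_topology M d =
     Metric_space.mtopology (cauchy_completion M d) (completion_dist M d)"

definition completion_embed :: "'x set \<Rightarrow> ('x \<Rightarrow> 'x \<Rightarrow> real) \<Rightarrow> 'x \<Rightarrow> (nat \<Rightarrow> 'x) set" where
  "completion_embed M d x = cauchy_equiv M d `` {\<lambda>_. x}"


subsection \<open>The Floyd boundary\<close>

definition floyd_boundary ::
  "(nat \<Rightarrow> real) \<Rightarrow> ('g, 'm) monoid_scheme \<Rightarrow> 'g set \<Rightarrow> (nat \<Rightarrow> 'g \<Rightarrow> real) set topology" where
  "floyd_boundary f G S =
     (let X = cayley_space G S; d = floyd_dist f G S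
      in subtopology (completion_topology X d)
           (cauchy_completion X d - completion_embed X d ` X))"


subsection \<open>The Cantor set\<close>

fun cantor_stage :: "nat \<Rightarrow> real set" where
  "cantor_stage 0 = {0..1}"
| "cantor_stage (Suc k) = (\<lambda>x. x / 3) ` cantor_stage k \<union> (\<lambda>x. (x + 2) / 3) ` cantor_stage k"

definition cantor_set :: "real set" where
  "cantor_set = (\<Inter>k. cantor_stage k)"


subsection \<open>Well-definedness\<close>

text \<open>
  The free product is a group, the Floyd metric is a metric on the Cayley graph of a group with
  respect to any generating set, and the Cauchy completion of a metric space is a metric space.
\<close>

lemma letter_mult_one: "letter_mult A (i, \<one>\<^bsub>A i\<^esub>) w = w"
  by (cases w) auto

lemma letter_mult_closed:
  assumes "\<And>i. i \<in> I \<Longrightarrow> group (A i)" "i \<in> I" "a \<in> carrier (A i)" "w \<in> reduced_words I A"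
  shows "letter_mult A (i, a) w \<in> reduced_words I A"
proof (cases w)
  case Nil
  then show ?thesis using assms by (auto simp: reduced_words_def)
next
  case (Cons x w')
  obtain j b where x: "x = (j, b)" by force
  interpret group "A i" using assms by blast
  have "a \<otimes>\<^bsub>A i\<^esub> b \<in> carrier (A i)" if "i = j"
  proof (rule m_closed)
    show "b \<in> carrier (A i)" using that assms unfolding Cons x by (auto simp: reduced_words_def)
  qed fact
  then show ?thesis
    using assms unfolding Cons x
    by (cases w') (auto simp: reduced_words_def)
qed

lemma letter_mult_comp:
  assumes "\<And>i. i \<in> I \<Longrightarrow> group (A i)" "i \<in> I" "a \<in> carrier (A i)" "b \<in> carrier (A i)"
    "w \<in> reduced_words I A"
  shows "letter_mult A (i, a) (letter_mult A (i, b) w) = letter_mult A (i, a \<otimes>\<^bsub>A i\<^esub> b) w"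
proof -
  interpret group "A i" using assms by blast
  consider "a = \<one>\<^bsub>A i\<^esub>" | "b = \<one>\<^bsub>A i\<^esub>" | "a \<noteq> \<one>\<^bsub>A i\<^esub>" "b \<noteq> \<one>\<^bsub>A i\<^esub>" by blast
  then show ?thesis
  proof cases
    case 3
    show ?thesis
    proof (cases w)
      case Nil
      then show ?thesis using 3 by auto
    next
      case (Cons x w')
      obtain j c where x: "x = (j, c)" by force
      show ?thesis
      proof (cases "i = j")
        case False
        then show ?thesis using 3 Cons x by auto
      next
        case True
        then have c: "c \<in> carrier (A i)" "c \<noteq> \<one>\<^bsub>A i\<^esub>" and
          w': "letter_mult A (i, y) w' = (if y = \<one>\<^bsub>A i\<^esub> then w' else (i, y) # w')" for y
          using assms Cons x by (cases w'; auto simp: reduced_words_def)+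
        note carr = c(1) assms(3,4)
        have lm: "letter_mult A (i, y) w = (if y = \<one>\<^bsub>A i\<^esub> then w
            else if y \<otimes>\<^bsub>A i\<^esub> c = \<one>\<^bsub>A i\<^esub> then w' else (i, y \<otimes>\<^bsub>A i\<^esub> c) # w')" for y
          using True Cons x by simp
        have w: "w = (i, c) # w'" using True Cons x by simp
        show ?thesis
        proof (cases "b \<otimes>\<^bsub>A i\<^esub> c = \<one>\<^bsub>A i\<^esub>")
          case bc: True
          have abc: "a \<otimes>\<^bsub>A i\<^esub> b \<otimes>\<^bsub>A i\<^esub> c = a" using carr bc by (simp add: m_assoc)
          have "a = c" if "a \<otimes>\<^bsub>A i\<^esub> b = \<one>\<^bsub>A i\<^esub>" using that carr abc by simp
          then show ?thesis
            unfolding lm[of b] lm[of "a \<otimes>\<^bsub>A i\<^esub> b"] abc using bc 3 w' w by simp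
        next
          case bc: False
          have "letter_mult A (i, a) ((i, b \<otimes>\<^bsub>A i\<^esub> c) # w') =
              (if a \<otimes>\<^bsub>A i\<^esub> b \<otimes>\<^bsub>A i\<^esub> c = \<one>\<^bsub>A i\<^esub> then w' else (i, a \<otimes>\<^bsub>A i\<^esub> b \<otimes>\<^bsub>A i\<^esub> c) # w')"
            using 3 carr by (simp add: m_assoc)
          moreover have "a \<otimes>\<^bsub>A i\<^esub> b \<otimes>\<^bsub>A i\<^esub> c = c" if "a \<otimes>\<^bsub>A i\<^esub> b = \<one>\<^bsub>A i\<^esub>"
            using that carr by simp
          ultimately show ?thesis
            unfolding lm[of b] lm[of "a \<otimes>\<^bsub>A i\<^esub> b"] using bc 3 c w by simp
        qed
      qed
    qed
  qed (use assms in \<open>auto simp: letter_mult_one\<close>)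
qed

lemma group_free_product:
  assumes A: "\<And>i. i \<in> I \<Longrightarrow> group (A i)"
  shows "group (free_product I A)"
proof -
  let ?R = "reduced_words I A" and ?m = "\<lambda>u v. foldr (letter_mult A) u v"
  have tl: "i \<in> I \<and> a \<in> carrier (A i) \<and> a \<noteq> \<one>\<^bsub>A i\<^esub> \<and> u \<in> ?R" if "(i, a) # u \<in> ?R" for i a u
    using that by (cases u) (auto simp: reduced_words_def)
  have closed: "?m u v \<in> ?R" if "u \<in> ?R" "v \<in> ?R" for u v
    using that
    by (induction u) (auto dest!: tl intro!: letter_mult_closed A)
  have step: "?m (letter_mult A (i, a) u) v = letter_mult A (i, a) (?m u v)"
    if ia: "i \<in> I" "a \<in> carrier (A i)" and u: "u \<in> ?R" and v: "v \<in> ?R" for i a u v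
  proof (cases u)
    case Nil
    then show ?thesis by (simp add: letter_mult_one)
  next
    case (Cons x u')
    obtain j b where x: "x = (j, b)" by force
    have jb: "j \<in> I" "b \<in> carrier (A j)" "u' \<in> ?R" using u tl Cons x by auto
    have "letter_mult A (i, a) (letter_mult A (i, b) (?m u' v)) = letter_mult A (i, a \<otimes>\<^bsub>A i\<^esub> b) (?m u' v)"
      if "i = j" using that jb ia v closed by (intro letter_mult_comp A) auto
    then show ?thesis using Cons x by (auto simp: letter_mult_one)
  qed
  have assoc: "?m (?m u v) w = ?m u (?m v w)" if "u \<in> ?R" "v \<in> ?R" "w \<in> ?R" for u v w
    using that
  proof (induction u)
    case (Cons x u)
    obtain i a where x: "x = (i, a)" by force
    show ?case using Cons tl[of i a u] closed[of u v] step[of i a "?m u v" w] x by auto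
  qed auto
  have inv: "\<exists>v\<in>?R. ?m v u = []" if u: "u \<in> ?R" for u
  proof
    let ?i = "map (\<lambda>(i, a). (i, inv\<^bsub>A i\<^esub> a))"
    have fst: "map fst (?i u) = map fst u" by (induction u) auto
    have "distinct_adj (map fst u)" using u by (simp add: reduced_words_def)
    then have dist: "distinct_adj (map fst (rev (?i u)))"
      by (simp only: rev_map[symmetric] fst distinct_adj_rev)
    have "\<forall>(i, a) \<in> set u. inv\<^bsub>A i\<^esub> a \<in> carrier (A i) \<and> inv\<^bsub>A i\<^esub> a \<noteq> \<one>\<^bsub>A i\<^esub>"
    proof safe
      fix i a assume "(i, a) \<in> set u"
      then have *: "i \<in> I" "a \<in> carrier (A i)" "a \<noteq> \<one>\<^bsub>A i\<^esub>" using u by (auto simp: reduced_words_def)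
      interpret group "A i" using A * by blast
      show "inv\<^bsub>A i\<^esub> a \<in> carrier (A i)" using * by simp
      show False if "inv\<^bsub>A i\<^esub> a = \<one>\<^bsub>A i\<^esub>"
        using that * by (metis inv_inv inv_one)
    qed
    then have "\<forall>(i, a) \<in> set (rev (?i u)). i \<in> I \<and> a \<in> carrier (A i) \<and> a \<noteq> \<one>\<^bsub>A i\<^esub>"
      using u by (fastforce simp: reduced_words_def)
    then show "rev (?i u) \<in> ?R"
      using dist by (simp only: reduced_words_def mem_Collect_eq simp_thms)
    show "?m (rev (?i u)) u = []"
      using u
    proof (induction u)
      case (Cons x u)
      obtain i a where x: "x = (i, a)" by force
      have ia: "i \<in> I" "a \<in> carrier (A i)" "a \<noteq> \<one>\<^bsub>A i\<^esub>" "u \<in> ?R" using Cons.prems tl x by auto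
      interpret group "A i" using A ia by blast
      have "inv\<^bsub>A i\<^esub> a \<noteq> \<one>\<^bsub>A i\<^esub>" using ia by (metis inv_inv inv_one)
      then show ?case using Cons.IH ia x by simp
    qed auto
  qed
  have one: "[] \<in> ?R" by (simp add: reduced_words_def)
  have left_one: "?m [] u = u" for u by simp
  show ?thesis
    unfolding free_product_def
    by (rule groupI; simp only: monoid.simps partial_object.simps)
      (rule closed one assoc left_one inv; assumption?)+
qed

lemma floyd_path_in_space:
  assumes "floyd_path f G S p q L"
  shows "p \<in> cayley_space G S" "q \<in> cayley_space G S"
  using assms by induction (auto simp: cayley_space_def)

lemma floyd_path_trans:
  assumes "floyd_path f G S p q L" "floyd_path f G S q r L'"
  shows "floyd_path f G S p r (L + L')"
  using assms
  by (induction arbitrary: r L') (auto simp: add.assoc intro: floyd_path.step)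

lemma floyd_path_single:
  assumes "(g, h) \<in> cayley_edges G S" "p \<in> closed_edge g h" "q \<in> closed_edge g h"
  shows "floyd_path f G S p q (floyd_edge_length f G S g h * \<bar>p h - q h\<bar>)"
  using floyd_path.step[OF assms floyd_path.refl, of f] assms by (force simp: cayley_space_def)

lemma floyd_path_sym:
  assumes "floyd_path f G S p q L"
  shows "floyd_path f G S q p L"
  using assms
proof induction
  case (refl p)
  then show ?case by (rule floyd_path.refl)
next
  case (step g h p q r L)
  have "floyd_path f G S r p (L + floyd_edge_length f G S g h * \<bar>q h - p h\<bar>)"
    using step by (blast intro: floyd_path_trans floyd_path_single)
  then show ?case by (simp add: add.commute abs_minus_commute)
qed

lemma floyd_path_nonneg:
  assumes "floyd_path f G S p q L" "floyd_function f"
  shows "L \<ge> 0"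
  using assms
  by induction (auto simp: floyd_edge_length_def floyd_function_def less_imp_le)

lemma floyd_path_exists:
  fixes G (structure)
  assumes G: "group G" and S: "S \<subseteq> carrier G" "generate G S = carrier G"
    and pq: "p \<in> cayley_space G S" "q \<in> cayley_space G S"
  shows "\<exists>L. floyd_path f G S p q L"
proof -
  interpret group G by fact
  define C where "C p q \<longleftrightarrow> (\<exists>L. floyd_path f G S p q L)" for p q
  have tr: "C p q \<Longrightarrow> C q r \<Longrightarrow> C p r" and sy: "C p q \<Longrightarrow> C q p" for p q r
    unfolding C_def using floyd_path_trans floyd_path_sym by blast+
  define v where "v g = edge_point g g 0" for g :: 'a
  have v_edge: "v g \<in> closed_edge g h" "v h \<in> closed_edge g h" for g h
  proof -
    have "v g = edge_point g h 0" "v h = edge_point g h 1" by (auto simp: v_def edge_point_def)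
    then show "v g \<in> closed_edge g h" "v h \<in> closed_edge g h" by (auto simp: closed_edge_def)
  qed
  have edge: "C p q" if "(g, h) \<in> cayley_edges G S" "p \<in> closed_edge g h" "q \<in> closed_edge g h" for p q g h
    unfolding C_def by (rule exI, rule floyd_path_single[OF that])
  have refl: "C (v g) (v g)" if "g \<in> carrier G" for g
  proof -
    have X: "v g \<in> cayley_space G S" using that v_edge by (auto simp: cayley_space_def)
    show ?thesis unfolding C_def by (rule exI, rule floyd_path.refl[OF X])
  qed
  have adj: "C (v g) (v (g \<otimes> s))" if "g \<in> carrier G" "s \<in> S" for g s
  proof (cases "g = g \<otimes> s")
    case True
    then show ?thesis using refl that by metis
  next
    case False
    then have "(g, g \<otimes> s) \<in> cayley_edges G S" using that S by (auto simp: cayley_edges_def)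
    then show ?thesis using edge v_edge by blast
  qed
  have gen: "C (v g) (v (g \<otimes> x))" if "x \<in> generate G S" "g \<in> carrier G" for g x
    using that
  proof (induction arbitrary: g)
    case one
    then show ?case using refl by simp
  next
    case (incl h)
    then show ?case using adj by blast
  next
    case (inv h)
    then have "h \<in> carrier G" using S by blast
    then show ?case using inv adj[of "g \<otimes> inv h" h] sy by (simp add: m_assoc)
  next
    case (eng x y)
    have "x \<in> carrier G" "y \<in> carrier G" using eng S by auto
    then show ?case using eng.IH(1)[of g] eng.IH(2)[of "g \<otimes> x"] eng.prems tr by (simp add: m_assoc)
  qed
  have one: "C (v \<one>) (v g)" if "g \<in> carrier G" for g
    using gen[of g \<one>] that S by simp
  have all: "C (v \<one>) p" if p: "p \<in> cayley_space G S" for p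
  proof -
    consider (vertex) g where "g \<in> carrier G" "p \<in> closed_edge g g"
      | (edge) g h where "(g, h) \<in> cayley_edges G S" "p \<in> closed_edge g h"
      using p by (auto simp: cayley_space_def)
    then show ?thesis
    proof cases
      case vertex
      then have "p = v g" by (auto simp: closed_edge_def edge_point_def v_def)
      then show ?thesis using one vertex by simp
    next
      case e: edge
      then have "g \<in> carrier G" by (auto simp: cayley_edges_def)
      then show ?thesis using one edge[OF e(1) v_edge(1) e(2)] tr by blast
    qed
  qed
  have "C p q" using all[OF pq(1)] all[OF pq(2)] sy tr by blast
  then show ?thesis by (simp add: C_def)
qed

lemma floyd_path_lower_bound:
  assumes "floyd_path f G S p q L" "floyd_function f"
  shows "f (word_dist G S \<one>\<^bsub>G\<^esub> x) * \<bar>p x - q x\<bar> \<le> L"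
  using assms(1)
proof induction
  case (refl p)
  then show ?case by simp
next
  case (step g h p q r L)
  let ?l = "floyd_edge_length f G S g h" and ?w = "f (word_dist G S \<one>\<^bsub>G\<^esub> x)"
  have f: "decseq f" "f n > 0" for n
    using assms(2) by (auto simp: floyd_function_def decseq_Suc_iff)
  obtain t u where tu: "p = edge_point g h t" "q = edge_point g h u"
    using step by (auto simp: closed_edge_def)
  have "g \<noteq> h" using step by (auto simp: cayley_edges_def)
  have "?w * \<bar>p x - q x\<bar> \<le> ?l * \<bar>p h - q h\<bar>"
  proof (cases "x = g \<or> x = h")
    case True
    then have "\<bar>p x - q x\<bar> = \<bar>p h - q h\<bar>"
      using \<open>g \<noteq> h\<close> by (auto simp: tu edge_point_def)
    moreover have "?w \<le> ?l"
      using True f(1) by (auto simp: floyd_edge_length_def decseq_def)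
    ultimately show ?thesis by (simp add: mult_right_mono)
  next
    case False
    then show ?thesis
      using f(2) by (auto simp: tu edge_point_def floyd_edge_length_def less_imp_le)
  qed
  moreover have "?w * \<bar>p x - r x\<bar> \<le> ?w * \<bar>p x - q x\<bar> + ?w * \<bar>q x - r x\<bar>"
  proof -
    have "\<bar>p x - r x\<bar> \<le> \<bar>p x - q x\<bar> + \<bar>q x - r x\<bar>" by simp
    then show ?thesis
      using f(2) by (metis distrib_left less_imp_le mult_left_mono)
  qed
  ultimately show ?case using step.IH by simp
qed

lemma Metric_space_floyd_dist:
  assumes f: "floyd_function f" and G: "group G" "S \<subseteq> carrier G" "generate G S = carrier G"
  shows "Metric_space (cayley_space G S) (floyd_dist f G S)"
proof -
  define P where "P p q = {L. floyd_path f G S p q L}" for p q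
  define X where "X = cayley_space G S"
  have d: "floyd_dist f G S p q = (if p \<in> X \<and> q \<in> X then Inf (P p q) else 0)" for p q
    by (simp add: floyd_dist_def P_def X_def)
  have lower: "L \<ge> f (word_dist G S \<one>\<^bsub>G\<^esub> x) * \<bar>p x - q x\<bar>" if "L \<in> P p q" for L p q x
    using that floyd_path_lower_bound[OF _ f] by (simp add: P_def)
  have pos: "L \<ge> 0" if "L \<in> P p q" for L p q
    using that floyd_path_nonneg[OF _ f] by (auto simp: P_def)
  have bdd: "bdd_below (P p q)" for p q using pos by (meson bdd_belowI)
  have ne: "P p q \<noteq> {}" if "p \<in> X" "q \<in> X" for p q
    using floyd_path_exists[OF G, of p q f] that by (auto simp: P_def X_def)
  have symP: "P p q = P q p" for p q
    unfolding P_def by (intro Collect_cong iffI; erule floyd_path_sym)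
  show ?thesis
    unfolding X_def[symmetric]
  proof
    fix p q
    show "0 \<le> floyd_dist f G S p q"
      unfolding d using ne[of p q] pos[of _ p q] by (auto intro!: cInf_greatest)
    show "floyd_dist f G S p q = floyd_dist f G S q p"
      by (simp add: d symP)
  next
    fix p q assume X: "p \<in> X" "q \<in> X"
    have "floyd_dist f G S p p = 0"
    proof -
      have "0 \<in> P p p" using X floyd_path.refl by (simp add: P_def X_def)
      then have "Inf (P p p) = 0" using pos by (intro cInf_eq_minimum) auto
      then show ?thesis by (simp add: d)
    qed
    moreover have "floyd_dist f G S p q \<noteq> 0" if pq: "p \<noteq> q"
    proof -
      obtain x where "p x \<noteq> q x" using pq by (auto simp: fun_eq_iff)
      then have "0 < f (word_dist G S \<one>\<^bsub>G\<^esub> x) * \<bar>p x - q x\<bar>"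
        using f by (simp add: floyd_function_def)
      also have "\<dots> \<le> Inf (P p q)" using ne[OF X] lower by (intro cInf_greatest)
      finally show ?thesis using X by (simp add: d)
    qed
    ultimately show "floyd_dist f G S p q = 0 \<longleftrightarrow> p = q" by blast
  next
    fix p q r assume X: "p \<in> X" "q \<in> X" "r \<in> X"
    have "Inf (P p r) - L' \<le> L" if "L \<in> P p q" "L' \<in> P q r" for L L'
      using that floyd_path_trans cInf_lower[OF _ bdd, of "L + L'" p r] by (force simp: P_def)
    then have "Inf (P p r) - L' \<le> Inf (P p q)" if "L' \<in> P q r" for L'
      using that ne[OF X(1,2)] by (meson cInf_greatest)
    then have "Inf (P p r) - Inf (P p q) \<le> L'" if "L' \<in> P q r" for L'
      using that by (metis diff_le_eq add.commute)
    then have "Inf (P p r) - Inf (P p q) \<le> Inf (P q r)"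
      using ne[OF X(2,3)] by (meson cInf_greatest)
    then show "floyd_dist f G S p r \<le> floyd_dist f G S p q + floyd_dist f G S q r"
      using X by (simp add: d)
  qed
qed

lemma Metric_space_cauchy_completion:
  fixes d :: "'x \<Rightarrow> 'x \<Rightarrow> real"
  assumes "Metric_space M d"
  shows "Metric_space (cauchy_completion M d) (completion_dist M d)"
proof -
  define C where "C = {\<sigma>. Metric_space.MCauchy M d \<sigma>}"
  define E where "E = cauchy_equiv M d"
  interpret Metric_space M d by fact
  have quad: "\<bar>d x y - d x' y'\<bar> \<le> d x x' + d y y'"
    if "x \<in> M" "y \<in> M" "x' \<in> M" "y' \<in> M" for x y x' y'
  proof -
    have "d x y \<le> d x x' + d x' y" "d x' y \<le> d x' y' + d y' y"
      "d x' y' \<le> d x' x + d x y'" "d x y' \<le> d x y + d y y'"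
      using that by (blast intro: triangle)+
    moreover have "d y' y = d y y'" "d x' x = d x x'" by (rule commute)+
    ultimately show ?thesis by linarith
  qed
  have C: "\<sigma> \<in> C \<longleftrightarrow> range \<sigma> \<subseteq> M \<and>
      (\<forall>\<epsilon>>0. \<exists>N. \<forall>n n'. N \<le> n \<longrightarrow> N \<le> n' \<longrightarrow> d (\<sigma> n) (\<sigma> n') < \<epsilon>)" for \<sigma>
    by (simp add: C_def MCauchy_def)
  have inM: "\<sigma> k \<in> M" if "\<sigma> \<in> C" for \<sigma> k using that by (auto simp: C)
  have E: "(\<sigma>, \<tau>) \<in> E \<longleftrightarrow> \<sigma> \<in> C \<and> \<tau> \<in> C \<and> (\<lambda>k. d (\<sigma> k) (\<tau> k)) \<longlonglongrightarrow> 0" for \<sigma> \<tau>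
    by (simp add: E_def C_def cauchy_equiv_def)
  have conv: "convergent (\<lambda>k. d (\<sigma> k) (\<tau> k))" if \<sigma>: "\<sigma> \<in> C" and \<tau>: "\<tau> \<in> C" for \<sigma> \<tau>
  proof -
    have "\<exists>N. \<forall>m\<ge>N. \<forall>n\<ge>N. norm (d (\<sigma> m) (\<tau> m) - d (\<sigma> n) (\<tau> n)) < e" if "e > 0" for e
    proof -
      obtain N1 where N1: "\<And>n n'. N1 \<le> n \<Longrightarrow> N1 \<le> n' \<Longrightarrow> d (\<sigma> n) (\<sigma> n') < e / 2"
        using \<sigma> \<open>e > 0\<close> unfolding C by (meson half_gt_zero)
      obtain N2 where N2: "\<And>n n'. N2 \<le> n \<Longrightarrow> N2 \<le> n' \<Longrightarrow> d (\<tau> n) (\<tau> n') < e / 2"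
        using \<tau> \<open>e > 0\<close> unfolding C by (meson half_gt_zero)
      have "norm (d (\<sigma> m) (\<tau> m) - d (\<sigma> n) (\<tau> n)) < e" if "m \<ge> max N1 N2" "n \<ge> max N1 N2" for m n
      proof -
        have "m \<ge> N1" "n \<ge> N1" "m \<ge> N2" "n \<ge> N2" using that by auto
        then have "d (\<sigma> m) (\<sigma> n) < e / 2" "d (\<tau> m) (\<tau> n) < e / 2" using N1 N2 by blast+
        moreover have "\<bar>d (\<sigma> m) (\<tau> m) - d (\<sigma> n) (\<tau> n)\<bar> \<le> d (\<sigma> m) (\<sigma> n) + d (\<tau> m) (\<tau> n)"
          by (intro quad inM \<sigma> \<tau>)
        ultimately show ?thesis unfolding real_norm_def by linarith
      qed
      then show ?thesis by blast
    qed
    then show ?thesis unfolding Cauchy_convergent_iff[symmetric] by (intro CauchyI) blast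
  qed
  have swap: "(\<lambda>k. d (\<sigma>' k) (\<tau>' k)) \<longlonglongrightarrow> r"
    if "(\<sigma>, \<sigma>') \<in> E" "(\<tau>, \<tau>') \<in> E" and r: "(\<lambda>k. d (\<sigma> k) (\<tau> k)) \<longlonglongrightarrow> r" for \<sigma> \<sigma>' \<tau> \<tau>' r
  proof -
    have in': "\<sigma> \<in> C" "\<sigma>' \<in> C" "\<tau> \<in> C" "\<tau>' \<in> C" and
      l: "(\<lambda>k. d (\<sigma> k) (\<sigma>' k)) \<longlonglongrightarrow> 0" "(\<lambda>k. d (\<tau> k) (\<tau>' k)) \<longlonglongrightarrow> 0"
      using that by (auto simp: E)
    have "\<bar>d (\<sigma>' k) (\<tau>' k) - d (\<sigma> k) (\<tau> k)\<bar> \<le> d (\<sigma> k) (\<sigma>' k) + d (\<tau> k) (\<tau>' k)" for k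
      using quad[of "\<sigma> k" "\<tau> k" "\<sigma>' k" "\<tau>' k"] in'[THEN inM, of k]
      by (simp only: abs_minus_commute)
    then have "(\<lambda>k. d (\<sigma>' k) (\<tau>' k) - d (\<sigma> k) (\<tau> k)) \<longlonglongrightarrow> 0"
      by (intro tendsto_0_le[OF tendsto_add_zero[OF l], of _ 1]) auto
    from tendsto_add[OF this r] show ?thesis by simp
  qed
  have refl: "(\<sigma>, \<sigma>) \<in> E" if "\<sigma> \<in> C" for \<sigma>
    using that inM by (simp add: E)
  have symE: "(\<tau>, \<sigma>) \<in> E" if "(\<sigma>, \<tau>) \<in> E" for \<sigma> \<tau>
  proof -
    have "(\<lambda>k. d (\<tau> k) (\<sigma> k)) = (\<lambda>k. d (\<sigma> k) (\<tau> k))" by (intro ext commute)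
    then show ?thesis using that by (simp add: E)
  qed
  have transE: "(\<sigma>, \<rho>) \<in> E" if "(\<sigma>, \<tau>) \<in> E" "(\<tau>, \<rho>) \<in> E" for \<sigma> \<tau> \<rho>
    using swap[of \<sigma> \<sigma> \<tau> \<rho> 0] that refl unfolding E by blast
  have "E \<subseteq> C \<times> C" by (auto simp: E)
  moreover have "refl_on C E" by (rule refl_onI, rule refl)
  moreover have "sym E" by (rule symI, rule symE)
  moreover have "trans E" by (rule transI, rule transE)
  ultimately have equiv: "equiv C E" by (intro equivI)
  have comp: "cauchy_completion M d = C // E"
    by (simp add: cauchy_completion_def C_def E_def)
  have lim: "(\<lambda>k. d (\<sigma> k) (\<tau> k)) \<longlonglongrightarrow> completion_dist M d P Q"
    if PQ: "P \<in> C // E" "Q \<in> C // E" and \<sigma>\<tau>: "\<sigma> \<in> P" "\<tau> \<in> Q" for P Q \<sigma> \<tau>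
  proof -
    have "\<sigma> \<in> C" "\<tau> \<in> C" using in_quotient_imp_subset[OF equiv] PQ \<sigma>\<tau> by auto
    then obtain r where r: "(\<lambda>k. d (\<sigma> k) (\<tau> k)) \<longlonglongrightarrow> r"
      using conv by (auto simp: convergent_def)
    have all: "\<forall>\<sigma>'\<in>P. \<forall>\<tau>'\<in>Q. (\<lambda>k. d (\<sigma>' k) (\<tau>' k)) \<longlonglongrightarrow> r"
    proof (intro ballI)
      fix \<sigma>' \<tau>' assume "\<sigma>' \<in> P" "\<tau>' \<in> Q"
      then have "(\<sigma>, \<sigma>') \<in> E" "(\<tau>, \<tau>') \<in> E"
        using in_quotient_imp_in_rel[OF equiv] PQ \<sigma>\<tau> by auto
      from swap[OF this r] show "(\<lambda>k. d (\<sigma>' k) (\<tau>' k)) \<longlonglongrightarrow> r" .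
    qed
    have uniq: "r' = r" if "\<forall>\<sigma>\<in>P. \<forall>\<tau>\<in>Q. (\<lambda>k. d (\<sigma> k) (\<tau> k)) \<longlonglongrightarrow> r'" for r'
      by (rule LIMSEQ_unique[OF that[rule_format, OF \<sigma>\<tau>] r])
    have "(THE r. \<forall>\<sigma>\<in>P. \<forall>\<tau>\<in>Q. (\<lambda>k. d (\<sigma> k) (\<tau> k)) \<longlonglongrightarrow> r) = r"
      using all uniq by (rule the_equality)
    then have "completion_dist M d P Q = r"
      using PQ by (simp add: completion_dist_def comp)
    then show ?thesis using r by simp
  qed
  have ex: "\<exists>\<sigma>. \<sigma> \<in> P \<and> \<sigma> \<in> C" if "P \<in> C // E" for P
  proof -
    obtain \<sigma> where "\<sigma> \<in> C" "P = E `` {\<sigma>}" using \<open>P \<in> C // E\<close> by (rule quotientE)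
    then show ?thesis using refl by blast
  qed
  show ?thesis
    unfolding comp
  proof
    fix P Q :: "(nat \<Rightarrow> 'x) set"
    show "0 \<le> completion_dist M d P Q"
    proof (cases "P \<in> C // E \<and> Q \<in> C // E")
      case True
      then obtain \<sigma> \<tau> where "\<sigma> \<in> P" "\<sigma> \<in> C" "\<tau> \<in> Q" "\<tau> \<in> C" using ex by meson
      then show ?thesis using lim[of P Q \<sigma> \<tau>] True by (intro LIMSEQ_le_const) auto
    qed (auto simp: completion_dist_def comp)
    show "completion_dist M d P Q = completion_dist M d Q P"
    proof (cases "P \<in> C // E \<and> Q \<in> C // E")
      case True
      then obtain \<sigma> \<tau> where st: "\<sigma> \<in> P" "\<sigma> \<in> C" "\<tau> \<in> Q" "\<tau> \<in> C" using ex by meson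
      have "(\<lambda>k. d (\<sigma> k) (\<tau> k)) = (\<lambda>k. d (\<tau> k) (\<sigma> k))" by (intro ext commute)
      moreover have "(\<lambda>k. d (\<sigma> k) (\<tau> k)) \<longlonglongrightarrow> completion_dist M d P Q"
        "(\<lambda>k. d (\<tau> k) (\<sigma> k)) \<longlonglongrightarrow> completion_dist M d Q P"
        using True st by (auto intro: lim)
      ultimately show ?thesis by (simp add: LIMSEQ_unique)
    qed (auto simp: completion_dist_def comp)
  next
    fix P Q assume PQ: "P \<in> C // E" "Q \<in> C // E"
    then obtain \<sigma> \<tau> where st: "\<sigma> \<in> P" "\<sigma> \<in> C" "\<tau> \<in> Q" "\<tau> \<in> C" using ex by meson
    have "P = Q \<longleftrightarrow> (\<sigma>, \<tau>) \<in> E" by (rule quotient_eq_iff[OF equiv PQ st(1,3)])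
    also have "\<dots> \<longleftrightarrow> completion_dist M d P Q = 0"
      using lim[OF PQ st(1,3)] st by (auto simp: E intro: LIMSEQ_unique)
    finally show "completion_dist M d P Q = 0 \<longleftrightarrow> P = Q" by simp
  next
    fix P Q R assume PQR: "P \<in> C // E" "Q \<in> C // E" "R \<in> C // E"
    then obtain \<sigma> \<tau> \<rho> where st: "\<sigma> \<in> P" "\<sigma> \<in> C" "\<tau> \<in> Q" "\<tau> \<in> C" "\<rho> \<in> R" "\<rho> \<in> C" using ex by meson
    have "d (\<sigma> k) (\<rho> k) \<le> d (\<sigma> k) (\<tau> k) + d (\<tau> k) (\<rho> k)" for k using st inM by (blast intro: triangle)
    then show "completion_dist M d P R \<le> completion_dist M d P Q + completion_dist M d Q R"
      using LIMSEQ_le[OF lim[OF PQR(1,3) st(1,5)] tendsto_add[OF lim[OF PQR(1,2) st(1,3)] lim[OF PQR(2,3) st(3,5)]]]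
      by blast
  qed
qed

end

theory Submission
  imports Defs "HOL-Algebra.Multiplicative_Group"
begin

text \<open>
  Why the Floyd boundary of \<open>G = A\<^sub>1 * \<dots> * A\<^sub>n\<close> is a Cantor set. By Brouwer's theorem
  (\<open>homeomorphic_cantor_set\<close>), the Cantor set is the only nonempty compact space without isolated
  points in which some countable family of clopen sets separates the points. So there are four
  things to show.

  Compactness. A Floyd function is summable, hence every vertex is close to a large finite ball, along a
  geodesic from \<open>\<one>\<close>. Thus the vertices form a totally bounded set, and vertices leaving
  every ball accumulate at the boundary (\<open>escaping_vertices_accumulate\<close>). Conversely, every boundary
  point is a limit of such vertices (\<open>boundary_approx\<close>).

  Clopen sets. A set \<open>D\<close> of group elements is almost invariant if only finitely many edges of the Cayley graph
  join it to its complement. Those edges have positive Floyd lengths, so \<open>D\<close> has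
  positive Floyd distance from its complement (\<open>vdist_separated\<close>), and the boundary points that are limits of
  elements of \<open>D\<close> form a clopen set, the shadow of \<open>D\<close>.

  Separation. This is where the group has to resemble a tree, since the boundary of an arbitrary group may have
  different points in the same end. The condition \<open>quasi_tree\<close> asks for finitely many almost
  invariant sets and for a chain of bounded steps between any two elements such that each point \<open>m\<close> of the chain is a
  bottleneck: the translate by \<open>m\<close> of one of the sets separates the two elements. Then two
  elements are close in the Floyd metric unless a translate by a short \<open>m\<close> separates them
  (\<open>close_unless_separated\<close>), and the shadows of the translates, which are countably many, separate the boundary points. An
  elementary group satisfies the condition, with half-lines as almost invariant sets
  (\<open>elementary_quasi_tree\<close>), and the condition passes to free products, where an almost invariant
  set of a factor is lifted to the set of words whose first syllable belongs to it
  (\<open>quasi_tree_free_product\<close>). It does not refer to a generating set, which is why \<open>S\<close> can be arbitrary.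

  No isolated points. Close to a boundary point there is a word \<open>x\<close> far from \<open>\<one>\<close>, and all words with prefix \<open>x\<close>
  are then close to it, too, as only finitely many of these cones are cut by a given almost
  invariant set (\<open>finite_cut_cones\<close>). Since some factor is infinite and another one is nontrivial, each
  cone contains two infinite sets separated by an almost invariant set (\<open>cone_branches\<close>), which
  accumulate at different boundary points.
\<close>

section \<open>A characterization of the Cantor set\<close>

definition ternary :: "(nat \<Rightarrow> bool) \<Rightarrow> real" where
  "ternary b = (\<Sum>k. 2 * of_bool (b k) / 3 ^ Suc k)"

lemma summable_ternary: "summable (\<lambda>k. 2 * of_bool (b k) / 3 ^ Suc k :: real)"
proof (rule summable_comparison_test')
  show "summable (\<lambda>k. 2 / 3 * (1 / 3) ^ k :: real)"
    by (intro summable_mult summable_geometric) auto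
  show "norm (2 * of_bool (b k) / 3 ^ Suc k :: real) \<le> 2 / 3 * (1 / 3) ^ k" for k
    by (auto simp: power_divide)
qed

text \<open>Splitting off the first digit allows induction on the position in an expansion.\<close>

lemma ternary_unfold: "ternary b = (2 * of_bool (b 0) + ternary (\<lambda>k. b (Suc k))) / 3"
proof -
  have "ternary b = (\<Sum>k. 2 * of_bool (b (Suc k)) / 3 ^ Suc (Suc k)) + 2 * of_bool (b 0) / 3 ^ Suc 0"
    unfolding ternary_def using suminf_split_head[OF summable_ternary[of b]] by simp
  also have "(\<Sum>k. 2 * of_bool (b (Suc k)) / 3 ^ Suc (Suc k) :: real) =
      (\<Sum>k. (2 * of_bool (b (Suc k)) / 3 ^ Suc k) / 3)"
    by (simp add: field_simps)
  also have "\<dots> = ternary (\<lambda>k. b (Suc k)) / 3"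
    unfolding ternary_def by (rule suminf_divide[OF summable_ternary])
  finally show ?thesis by simp
qed

lemma ternary_bounds: "0 \<le> ternary b" "ternary b \<le> 1"
proof -
  show "0 \<le> ternary b"
    unfolding ternary_def by (intro suminf_nonneg summable_ternary) auto
  have "ternary b \<le> (\<Sum>k. 2 / 3 * (1 / 3) ^ k)"
    unfolding ternary_def
  proof (rule suminf_le[OF _ summable_ternary])
    show "2 * of_bool (b k) / 3 ^ Suc k \<le> (2 / 3 * (1 / 3) ^ k :: real)" for k
      by (auto simp: power_divide)
    show "summable (\<lambda>k. 2 / 3 * (1 / 3) ^ k :: real)"
      by (intro summable_mult summable_geometric) auto
  qed
  also have "\<dots> = 1"
    by (subst suminf_mult) (auto simp: suminf_geometric intro: summable_geometric)
  finally show "ternary b \<le> 1" .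
qed

lemma ternary_inject:
  assumes "ternary b = ternary c"
  shows "b k = c k"
  using assms
proof (induction k arbitrary: b c)
  case 0
  show ?case
    using 0 ternary_bounds[of "\<lambda>k. b (Suc k)"] ternary_bounds[of "\<lambda>k. c (Suc k)"]
    by (cases "b 0"; cases "c 0") (auto simp: ternary_unfold[of b] ternary_unfold[of c])
next
  case (Suc k)
  have "b 0 = c 0"
    using Suc.prems ternary_bounds[of "\<lambda>k. b (Suc k)"] ternary_bounds[of "\<lambda>k. c (Suc k)"]
    by (cases "b 0"; cases "c 0") (auto simp: ternary_unfold[of b] ternary_unfold[of c])
  then have "ternary (\<lambda>k. b (Suc k)) = ternary (\<lambda>k. c (Suc k))"
    using Suc.prems by (auto simp: ternary_unfold[of b] ternary_unfold[of c])
  then show ?case by (rule Suc.IH)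
qed

lemma ternary_close:
  assumes "\<And>j. j < k \<Longrightarrow> b j = c j"
  shows "\<bar>ternary b - ternary c\<bar> \<le> 1 / 3 ^ k"
  using assms
proof (induction k arbitrary: b c)
  case 0
  then show ?case
    using ternary_bounds[of b] ternary_bounds[of c] by (simp add: abs_le_iff)
next
  case (Suc k)
  have "\<bar>ternary (\<lambda>k. b (Suc k)) - ternary (\<lambda>k. c (Suc k))\<bar> \<le> 1 / 3 ^ k"
    by (rule Suc.IH) (use Suc.prems in auto)
  moreover have "b 0 = c 0" using Suc.prems by auto
  moreover have "ternary b - ternary c = (ternary (\<lambda>k. b (Suc k)) - ternary (\<lambda>k. c (Suc k))) / 3"
    if "b 0 = c 0"
    using that by (simp add: ternary_unfold[of b] ternary_unfold[of c] field_simps)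
  ultimately show ?case by simp
qed

lemma cantor_stage_subset: "cantor_stage k \<subseteq> {0..1}"
  by (induction k) auto

lemma cantor_set_eq_range_ternary: "cantor_set = range ternary"
proof
  have "ternary b \<in> cantor_stage k" for b k
  proof (induction k arbitrary: b)
    case 0
    then show ?case using ternary_bounds by simp
  next
    case (Suc k)
    show ?case
      using Suc[of "\<lambda>k. b (Suc k)"] by (cases "b 0") (auto simp: ternary_unfold[of b] add.commute)
  qed
  then show "range ternary \<subseteq> cantor_set" by (auto simp: cantor_set_def)
next
  \<comment> \<open>The expanding map of which the Cantor set is the invariant set reads off the digits.\<close>
  define \<theta> where "\<theta> x = (if x \<le> 1/3 then 3 * x else 3 * x - 2)" for x :: real
  have \<theta>: "\<theta> x \<in> cantor_set" if "x \<in> cantor_set" for x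
  proof -
    have "\<theta> x \<in> cantor_stage k" for k
    proof -
      have "x \<in> cantor_stage (Suc k)" using that unfolding cantor_set_def by blast
      then consider y where "y \<in> cantor_stage k" "x = y / 3" | y where "y \<in> cantor_stage k" "x = (y + 2) / 3"
        by auto
      then show ?thesis
        using cantor_stage_subset[of k] by cases (auto simp: \<theta>_def field_simps)
    qed
    then show ?thesis by (simp add: cantor_set_def)
  qed
  show "cantor_set \<subseteq> range ternary"
  proof
    fix x assume x: "x \<in> cantor_set"
    define b where "b k \<longleftrightarrow> (\<theta> ^^ k) x > 1/3" for k
    have it: "(\<theta> ^^ k) x \<in> cantor_set" for k
      by (induction k) (auto simp: x \<theta>)
    have close: "\<bar>(\<theta> ^^ j) x - ternary (\<lambda>i. b (j + i))\<bar> \<le> 1 / 3 ^ k" for j k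
    proof (induction k arbitrary: j)
      case 0
      have "(\<theta> ^^ j) x \<in> {0..1}"
        using it[of j] unfolding cantor_set_def by (metis INT_iff UNIV_I cantor_stage.simps(1))
      then show ?case
        using ternary_bounds[of "\<lambda>i. b (j + i)"] by (auto simp: abs_le_iff)
    next
      case (Suc k)
      have "(\<theta> ^^ j) x = (2 * of_bool (b j) + (\<theta> ^^ Suc j) x) / 3"
        by (auto simp: b_def \<theta>_def)
      then have "(\<theta> ^^ j) x - ternary (\<lambda>i. b (j + i)) = ((\<theta> ^^ Suc j) x - ternary (\<lambda>i. b (Suc j + i))) / 3"
        using ternary_unfold[of "\<lambda>i. b (j + i)"] by (simp del: funpow.simps)
      then show ?case
        using Suc[of "Suc j"] by (simp del: funpow.simps)
    qed
    have "\<bar>x - ternary b\<bar> \<le> 0"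
    proof (rule tendsto_lowerbound[where f = "\<lambda>k. 1 / 3 ^ k" and F = sequentially])
      have "(\<lambda>k. (1 / 3) ^ k :: real) \<longlonglongrightarrow> 0" by (intro LIMSEQ_power_zero) auto
      then show "(\<lambda>k. 1 / 3 ^ k :: real) \<longlonglongrightarrow> 0" by (simp add: power_divide)
    qed (use close[of 0] in auto)
    then show "x \<in> range ternary" by simp
  qed
qed

text \<open>
  Brouwer's theorem. A sequence of clopen sets that separates points is turned into
  a binary tree of nonempty clopen pieces: the \<open>k\<close>-th step splits every piece of level \<open>k\<close>,
  by the \<open>k\<close>-th clopen set if that set cuts the piece, and otherwise in any way, which is
  possible because no piece is a single point. Each point then has a sequence of binary digits
  telling in which half it lies at each step; points with the same digits are not separated by any
  of the given sets and thus equal, and all digit sequences occur by compactness.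
\<close>

theorem homeomorphic_cantor_set:
  fixes X :: "'x topology" and \<U> :: "'x set set"
  assumes compact: "compact_space X" and nonempty: "topspace X \<noteq> {}"
    and perfect: "\<And>x. x \<in> topspace X \<Longrightarrow> \<not> openin X {x}"
    and "countable \<U>"
    and clopen\<U>: "\<And>U. U \<in> \<U> \<Longrightarrow> openin X U \<and> closedin X U"
    and separate: "\<And>x y. x \<in> topspace X \<Longrightarrow> y \<in> topspace X \<Longrightarrow> x \<noteq> y \<Longrightarrow> \<exists>U\<in>\<U>. x \<in> U \<and> y \<notin> U \<or> x \<notin> U \<and> y \<in> U"
  shows "X homeomorphic_space top_of_set cantor_set"
proof -
  define clopen where "clopen U \<longleftrightarrow> openin X U \<and> closedin X U" for U
  define u where "u = from_nat_into (insert {} \<U>)"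
  have u: "range u = insert {} \<U>"
    unfolding u_def using \<open>countable \<U>\<close> by (intro range_from_nat_into) auto
  have clopen_u: "clopen (u k)" for k
  proof -
    have "u k \<in> insert {} \<U>" using u by blast
    then show ?thesis using clopen\<U> by (auto simp: clopen_def)
  qed
  have clopen_Int: "clopen (C \<inter> D)" and clopen_Diff: "clopen (C - D)" if "clopen C" "clopen D" for C D
    using that by (auto simp: clopen_def openin_diff closedin_diff)
  have proper: "\<exists>W. clopen W \<and> W \<subseteq> C \<and> W \<noteq> {} \<and> W \<noteq> C" if C: "clopen C" "C \<noteq> {}" for C
  proof -
    obtain x where x: "x \<in> C" using C by blast
    have sub: "C \<subseteq> topspace X" using C by (auto simp: clopen_def openin_subset)
    have "C \<noteq> {x}" using perfect[of x] C x sub by (auto simp: clopen_def)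
    then obtain y where y: "y \<in> C" "y \<noteq> x" using x by blast
    then obtain U where "U \<in> \<U>" "x \<in> U \<and> y \<notin> U \<or> x \<notin> U \<and> y \<in> U"
      using separate[of x y] sub x by blast
    then have "clopen (C \<inter> U)" "C \<inter> U \<noteq> {}" "C \<inter> U \<noteq> C"
      using clopen_Int C clopen\<U> x y by (auto simp: clopen_def)
    then show ?thesis by blast
  qed
  define s where "s C k = (if C \<inter> u k \<noteq> {} \<and> C - u k \<noteq> {} then C \<inter> u k
      else SOME W. clopen W \<and> W \<subseteq> C \<and> W \<noteq> {} \<and> W \<noteq> C)" for C k
  have s: "clopen (s C k) \<and> s C k \<subseteq> C \<and> s C k \<noteq> {} \<and> s C k \<noteq> C" if C: "clopen C" "C \<noteq> {}" for C k
  proof (cases "C \<inter> u k \<noteq> {} \<and> C - u k \<noteq> {}")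
    case True
    then show ?thesis using clopen_Int[OF C(1) clopen_u] by (auto simp: s_def)
  next
    case False
    then have "s C k = (SOME W. clopen W \<and> W \<subseteq> C \<and> W \<noteq> {} \<and> W \<noteq> C)" unfolding s_def by (rule if_not_P)
    then show ?thesis using someI_ex[OF proper[OF C]] by metis
  qed
  \<comment> \<open>the piece of level \<open>k\<close> belonging to the first \<open>k\<close> entries of \<open>b\<close>\<close>
  define T where "T b = rec_nat (topspace X) (\<lambda>k C. if b k then s C k else C - s C k)" for b :: "nat \<Rightarrow> bool"
  have T0: "T b 0 = topspace X" and
    TSuc: "T b (Suc k) = (if b k then s (T b k) k else T b k - s (T b k) k)" for b k
    by (simp_all add: T_def)
  have T: "clopen (T b k)" "T b k \<noteq> {}" for b k
  proof (induction k)
    case 0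
    case 1 show ?case by (simp add: T0 clopen_def)
    case 2 show ?case using nonempty by (simp only: T0 simp_thms)
  next
    case (Suc k)
    case 1 show ?case using s[OF Suc, of k] Suc clopen_Diff by (auto simp: TSuc)
    case 2 show ?case using s[OF Suc, of k] by (auto simp: TSuc)
  qed
  have T_dec: "T b (Suc k) \<subseteq> T b k" for b k
    using s[OF T, of b k k] by (auto simp: TSuc)
  have T_cong: "T b k = T c k" if "\<And>j. j < k \<Longrightarrow> b j = c j" for b c k
    using that by (induction k) (auto simp: T0 TSuc)
  define Q where "Q x = rec_nat (topspace X) (\<lambda>k C. if x \<in> s C k then s C k else C - s C k)" for x
  define bit where "bit x k \<longleftrightarrow> x \<in> s (Q x k) k" for x k
  have Q: "Q x k = T (bit x) k" for x k
    by (induction k) (auto simp: T0 TSuc Q_def bit_def)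
  have bit: "bit x k \<longleftrightarrow> x \<in> s (T (bit x) k) k" for x k
    using bit_def[of x k] by (simp add: Q)
  have in_T: "x \<in> T (bit x) k" if "x \<in> topspace X" for x k
  proof (induction k)
    case (Suc k)
    then show ?case using bit[of x k] TSuc[of "bit x" k] by (metis Diff_iff)
  qed (simp add: T0 that)
  have bit_unique: "bit x k = b k" if x: "\<And>k. x \<in> T b k" for x b k
  proof (induction k rule: less_induct)
    case (less k)
    then have "T (bit x) k = T b k" by (rule T_cong)
    then show ?case using x[of "Suc k"] by (auto simp: bit TSuc split: if_splits)
  qed
  have bit_T: "bit y j = bit x j" if "y \<in> T (bit x) k" "j < k" for x y j k
    using that
  proof (induction j rule: less_induct)
    case (less j)
    have "T (bit x) k \<subseteq> T (bit x) (Suc j)"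
      using less.prems(2) lift_Suc_antimono_le[of "T (bit x)", OF T_dec] by auto
    then have y: "y \<in> T (bit x) (Suc j)" using less by blast
    have "T (bit y) j = T (bit x) j" using less by (intro T_cong) auto
    then show ?case using y by (auto simp: bit[of y] TSuc split: if_splits)
  qed
  define h where "h x = ternary (bit x)" for x
  have "homeomorphic_map X (top_of_set cantor_set) h"
  proof (rule continuous_imp_homeomorphic_map[OF _ compact])
    show "Hausdorff_space (top_of_set cantor_set)" by (intro Hausdorff_space_subtopology Hausdorff_space_euclidean)
    have surj: "\<exists>x\<in>topspace X. h x = ternary b" for b
    proof -
      have "(\<Inter>k. T b k) \<noteq> {}"
        by (rule compact_space_imp_nest[OF compact])
          (use T T_dec in \<open>auto simp: clopen_def decseq_Suc_iff\<close>)
      then obtain x where x: "\<And>k. x \<in> T b k" by blast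
      then have "bit x = b" using bit_unique by blast
      then show ?thesis using x[of 0] by (auto simp: T0 h_def)
    qed
    show img: "h ` topspace X = topspace (top_of_set cantor_set)"
      using surj by (auto simp: cantor_set_eq_range_ternary h_def image_iff) metis
    show "inj_on h (topspace X)"
    proof (rule inj_onI, rule ccontr)
      fix x y assume xy: "x \<in> topspace X" "y \<in> topspace X" "h x = h y" "x \<noteq> y"
      then have eq: "bit x = bit y" using ternary_inject by (auto simp: h_def)
      obtain U where U: "U \<in> \<U>" "x \<in> U \<and> y \<notin> U \<or> x \<notin> U \<and> y \<in> U"
        using separate xy by blast
      then obtain k where k: "u k = U" using u by (metis insertCI rangeE)
      let ?C = "T (bit x) k"
      have "x \<in> ?C" "y \<in> ?C" using in_T[of x k] in_T[of y k] xy eq by auto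
      then have "s ?C k = ?C \<inter> u k" using U k by (auto simp: s_def)
      then show False using bit[of x k] bit[of y k] eq U k \<open>x \<in> ?C\<close> \<open>y \<in> ?C\<close> by auto
    qed
    have "continuous_map X Met_TC.mtopology h"
      unfolding Met_TC.continuous_map_to_metric
    proof (intro ballI allI impI)
      fix x and \<epsilon> :: real assume x: "x \<in> topspace X" and "\<epsilon> > 0"
      obtain k where "(1/3) ^ k < \<epsilon>" using \<open>\<epsilon> > 0\<close> real_arch_pow_inv[of \<epsilon> "1/3"] by auto
      then have k: "1 / 3 ^ k < \<epsilon>" by (simp add: power_divide)
      have "h y \<in> Met_TC.mball (h x) \<epsilon>" if "y \<in> T (bit x) k" for y
        using ternary_close[of k "bit x" "bit y"] bit_T[OF that] k
        by (auto simp: h_def dist_real_def)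
      then show "\<exists>U. openin X U \<and> x \<in> U \<and> (\<forall>y\<in>U. h y \<in> Met_TC.mball (h x) \<epsilon>)"
        using T(1)[of "bit x" k] in_T[OF x, of k] by (auto simp: clopen_def)
    qed
    then show "continuous_map X (top_of_set cantor_set) h"
      using img by (auto simp: continuous_map_in_subtopology)
  qed
  then show ?thesis by (rule homeomorphic_map_imp_homeomorphic_space)
qed

section \<open>The Cauchy completion\<close>

context Metric_space
begin

text \<open>The distance function of a metric space is Lipschitz in both arguments, which makes
  distances along Cauchy sequences converge and makes their limits independent of the
  chosen representatives.\<close>

lemma quadrilateral:
  assumes "x \<in> M" "y \<in> M" "x' \<in> M" "y' \<in> M"
  shows "\<bar>d x y - d x' y'\<bar> \<le> d x x' + d y y'"
  using triangle[of x x' y] triangle[of x' y' y] triangle[of x' x y'] triangle[of x y y']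
    assms commute[of x x'] commute[of y y'] by linarith

lemma MCauchy_in: "MCauchy \<sigma> \<Longrightarrow> \<sigma> k \<in> M"
  by (auto simp: MCauchy_def)

lemma MCauchy_dist_convergent:
  assumes "MCauchy \<sigma>" "MCauchy \<tau>"
  shows "convergent (\<lambda>k. d (\<sigma> k) (\<tau> k))"
proof -
  have "Cauchy (\<lambda>k. d (\<sigma> k) (\<tau> k))"
  proof (rule metric_CauchyI)
    fix e :: real assume "e > 0"
    then obtain N1 N2 where N: "\<And>m n. N1 \<le> m \<Longrightarrow> N1 \<le> n \<Longrightarrow> d (\<sigma> m) (\<sigma> n) < e / 2"
      "\<And>m n. N2 \<le> m \<Longrightarrow> N2 \<le> n \<Longrightarrow> d (\<tau> m) (\<tau> n) < e / 2"
      using assms unfolding MCauchy_def by (meson half_gt_zero)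
    have "dist (d (\<sigma> m) (\<tau> m)) (d (\<sigma> n) (\<tau> n)) < e" if "m \<ge> max N1 N2" "n \<ge> max N1 N2" for m n
    proof -
      have "d (\<sigma> m) (\<sigma> n) < e / 2" "d (\<tau> m) (\<tau> n) < e / 2" using N that by auto
      moreover have "\<bar>d (\<sigma> m) (\<tau> m) - d (\<sigma> n) (\<tau> n)\<bar> \<le> d (\<sigma> m) (\<sigma> n) + d (\<tau> m) (\<tau> n)"
        by (intro quadrilateral MCauchy_in assms)
      ultimately show ?thesis by (simp add: dist_real_def)
    qed
    then show "\<exists>N. \<forall>m\<ge>N. \<forall>n\<ge>N. dist (d (\<sigma> m) (\<tau> m)) (d (\<sigma> n) (\<tau> n)) < e" by blast
  qed
  then show ?thesis by (simp add: Cauchy_convergent_iff)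
qed

lemma cauchy_equiv_iff:
  "(\<sigma>, \<tau>) \<in> cauchy_equiv M d \<longleftrightarrow> MCauchy \<sigma> \<and> MCauchy \<tau> \<and> (\<lambda>k. d (\<sigma> k) (\<tau> k)) \<longlonglongrightarrow> 0"
  by (simp add: cauchy_equiv_def)

lemma cauchy_equiv_dist_tendsto:
  assumes "(\<sigma>, \<sigma>') \<in> cauchy_equiv M d" "(\<tau>, \<tau>') \<in> cauchy_equiv M d"
    and r: "(\<lambda>k. d (\<sigma> k) (\<tau> k)) \<longlonglongrightarrow> r"
  shows "(\<lambda>k. d (\<sigma>' k) (\<tau>' k)) \<longlonglongrightarrow> r"
proof -
  have c: "MCauchy \<sigma>" "MCauchy \<sigma>'" "MCauchy \<tau>" "MCauchy \<tau>'" and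
    l: "(\<lambda>k. d (\<sigma> k) (\<sigma>' k)) \<longlonglongrightarrow> 0" "(\<lambda>k. d (\<tau> k) (\<tau>' k)) \<longlonglongrightarrow> 0"
    using assms by (auto simp: cauchy_equiv_iff)
  have "\<bar>d (\<sigma>' k) (\<tau>' k) - d (\<sigma> k) (\<tau> k)\<bar> \<le> d (\<sigma> k) (\<sigma>' k) + d (\<tau> k) (\<tau>' k)" for k
    using quadrilateral[of "\<sigma> k" "\<tau> k" "\<sigma>' k" "\<tau>' k"] c[THEN MCauchy_in, of k]
    by (simp add: abs_minus_commute)
  then have "(\<lambda>k. d (\<sigma>' k) (\<tau>' k) - d (\<sigma> k) (\<tau> k)) \<longlonglongrightarrow> 0"
    by (intro tendsto_0_le[OF tendsto_add_zero[OF l], of _ 1]) auto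
  from tendsto_add[OF this r] show ?thesis by simp
qed

lemma equiv_cauchy_equiv: "equiv {\<sigma>. MCauchy \<sigma>} (cauchy_equiv M d)"
proof (rule equivI)
  have refl: "(\<sigma>, \<sigma>) \<in> cauchy_equiv M d" if "MCauchy \<sigma>" for \<sigma>
    using that MCauchy_in[OF that] by (simp add: cauchy_equiv_iff)
  show "cauchy_equiv M d \<subseteq> {\<sigma>. MCauchy \<sigma>} \<times> {\<sigma>. MCauchy \<sigma>}"
    by (auto simp: cauchy_equiv_iff)
  show "refl_on {\<sigma>. MCauchy \<sigma>} (cauchy_equiv M d)"
    by (rule refl_onI) (use refl in auto)
  show "sym (cauchy_equiv M d)"
    by (rule symI) (auto simp: cauchy_equiv_iff commute)
  show "trans (cauchy_equiv M d)"
  proof (rule transI)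
    fix \<sigma> \<tau> \<rho> assume st: "(\<sigma>, \<tau>) \<in> cauchy_equiv M d" "(\<tau>, \<rho>) \<in> cauchy_equiv M d"
    then have "(\<lambda>k. d (\<sigma> k) (\<rho> k)) \<longlonglongrightarrow> 0"
      using cauchy_equiv_dist_tendsto[OF refl st(2)] by (auto simp: cauchy_equiv_iff)
    then show "(\<sigma>, \<rho>) \<in> cauchy_equiv M d" using st by (simp add: cauchy_equiv_iff)
  qed
qed

lemma completion_class:
  assumes "MCauchy \<sigma>"
  shows "cauchy_equiv M d `` {\<sigma>} \<in> cauchy_completion M d" "\<sigma> \<in> cauchy_equiv M d `` {\<sigma>}"
  using assms equiv_class_self[OF equiv_cauchy_equiv, of \<sigma>]
  by (auto simp: cauchy_completion_def intro: quotientI)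

lemma completion_obtain_rep:
  assumes "P \<in> cauchy_completion M d"
  obtains \<sigma> where "MCauchy \<sigma>" "P = cauchy_equiv M d `` {\<sigma>}"
  using assms by (auto simp: cauchy_completion_def elim!: quotientE)

text \<open>As the limit is the same for all representatives, the description in the definition of
  the distance denotes it.\<close>

lemma completion_dist_tendsto:
  assumes \<sigma>: "MCauchy \<sigma>" and \<tau>: "MCauchy \<tau>"
  shows "(\<lambda>k. d (\<sigma> k) (\<tau> k)) \<longlonglongrightarrow>
    completion_dist M d (cauchy_equiv M d `` {\<sigma>}) (cauchy_equiv M d `` {\<tau>})"
proof -
  let ?P = "cauchy_equiv M d `` {\<sigma>}" and ?Q = "cauchy_equiv M d `` {\<tau>}"
  obtain r where r: "(\<lambda>k. d (\<sigma> k) (\<tau> k)) \<longlonglongrightarrow> r"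
    using MCauchy_dist_convergent[OF assms] by (auto simp: convergent_def)
  have "(THE r. \<forall>\<sigma>\<in>?P. \<forall>\<tau>\<in>?Q. (\<lambda>k. d (\<sigma> k) (\<tau> k)) \<longlonglongrightarrow> r) = r"
  proof (rule the_equality)
    show "\<forall>\<sigma>\<in>?P. \<forall>\<tau>\<in>?Q. (\<lambda>k. d (\<sigma> k) (\<tau> k)) \<longlonglongrightarrow> r"
      using cauchy_equiv_dist_tendsto[OF _ _ r] by auto
    show "r' = r" if "\<forall>\<sigma>\<in>?P. \<forall>\<tau>\<in>?Q. (\<lambda>k. d (\<sigma> k) (\<tau> k)) \<longlonglongrightarrow> r'" for r'
      using that completion_class(2)[OF \<sigma>] completion_class(2)[OF \<tau>] r LIMSEQ_unique by blast
  qed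
  then show ?thesis
    using r completion_class(1)[OF \<sigma>] completion_class(1)[OF \<tau>] by (simp add: completion_dist_def)
qed

lemma MCauchy_const: "x \<in> M \<Longrightarrow> MCauchy (\<lambda>_. x)"
  by (auto simp: MCauchy_def)

lemma completion_embed_in: "x \<in> M \<Longrightarrow> completion_embed M d x \<in> cauchy_completion M d"
  unfolding completion_embed_def by (intro completion_class MCauchy_const)

lemma completion_embed_isometric:
  assumes "x \<in> M" "y \<in> M"
  shows "completion_dist M d (completion_embed M d x) (completion_embed M d y) = d x y"
  using LIMSEQ_unique[OF completion_dist_tendsto[OF MCauchy_const MCauchy_const] tendsto_const] assms
  by (simp add: completion_embed_def)

lemma completion_embed_tendsto:
  assumes \<sigma>: "MCauchy \<sigma>"
  shows "(\<lambda>n. completion_dist M d (cauchy_equiv M d `` {\<sigma>}) (completion_embed M d (\<sigma> n))) \<longlonglongrightarrow> 0"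
proof (rule LIMSEQ_I)
  fix e :: real assume "e > 0"
  then obtain N where N: "\<And>m n. N \<le> m \<Longrightarrow> N \<le> n \<Longrightarrow> d (\<sigma> m) (\<sigma> n) < e / 2"
    using \<sigma> unfolding MCauchy_def by (meson half_gt_zero)
  have "norm (completion_dist M d (cauchy_equiv M d `` {\<sigma>}) (completion_embed M d (\<sigma> n)) - 0) < e"
    if "n \<ge> N" for n
  proof -
    have *: "(\<lambda>k. d (\<sigma> k) (\<sigma> n)) \<longlonglongrightarrow> completion_dist M d (cauchy_equiv M d `` {\<sigma>}) (completion_embed M d (\<sigma> n))"
      unfolding completion_embed_def
      by (intro completion_dist_tendsto \<sigma> MCauchy_const MCauchy_in)
    have "completion_dist M d (cauchy_equiv M d `` {\<sigma>}) (completion_embed M d (\<sigma> n)) \<le> e / 2"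
      by (rule LIMSEQ_le_const2[OF *]) (use N that less_imp_le in blast)
    moreover have "completion_dist M d (cauchy_equiv M d `` {\<sigma>}) (completion_embed M d (\<sigma> n)) \<ge> 0"
      by (rule LIMSEQ_le_const[OF *]) auto
    ultimately show ?thesis using \<open>e > 0\<close> by simp
  qed
  then show "\<exists>N. \<forall>n\<ge>N. norm (completion_dist M d (cauchy_equiv M d `` {\<sigma>}) (completion_embed M d (\<sigma> n)) - 0) < e"
    by blast
qed

end

section \<open>Word metrics and almost invariant sets\<close>

lemma relpow_crossing:
  assumes "(a, b) \<in> r ^^ n" "P a \<noteq> P b"
  shows "\<exists>i c e. i < n \<and> (a, c) \<in> r ^^ i \<and> (c, e) \<in> r \<and> (e, b) \<in> r ^^ (n - Suc i) \<and> P c \<noteq> P e"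
  using assms
proof (induction n arbitrary: b)
  case (Suc n)
  then obtain y where y: "(a, y) \<in> r ^^ n" "(y, b) \<in> r" by auto
  show ?case
  proof (cases "P a = P y")
    case True
    then show ?thesis using y Suc.prems by (intro exI[of _ n]) auto
  next
    case False
    then obtain i c e where *: "i < n" "(a, c) \<in> r ^^ i" "(c, e) \<in> r" "(e, y) \<in> r ^^ (n - Suc i)" "P c \<noteq> P e"
      using Suc.IH y by blast
    then have "(e, b) \<in> r ^^ Suc (n - Suc i)" using y by auto
    moreover have "Suc (n - Suc i) = Suc n - Suc i" using * by simp
    ultimately show ?thesis using * by (metis less_SucI)
  qed
qed auto

text \<open>For a finitely generated group, these are the sets with finite coboundary in the Cayley graph, for one and
  hence for every finite generating set. Quantifying over all \<open>s\<close> avoids the choice of generators.\<close>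

definition almost_invariant :: "('g, 'm) monoid_scheme \<Rightarrow> 'g set \<Rightarrow> bool" where
  "almost_invariant G D \<longleftrightarrow> D \<subseteq> carrier G \<and>
     (\<forall>s\<in>carrier G. finite {g \<in> carrier G. (g \<in> D) \<noteq> (g \<otimes>\<^bsub>G\<^esub> s \<in> D)})"

context group
begin

lemma finite_mult_preimage:
  assumes "finite B" "s \<in> carrier G"
  shows "finite {g \<in> carrier G. g \<otimes> s \<in> B}"
proof (rule finite_imageD)
  show "finite ((\<lambda>g. g \<otimes> s) ` {g \<in> carrier G. g \<otimes> s \<in> B})"
    by (rule finite_subset[OF _ assms(1)]) auto
  show "inj_on (\<lambda>g. g \<otimes> s) {g \<in> carrier G. g \<otimes> s \<in> B}"
    using assms by (auto intro!: inj_onI)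
qed

lemma almost_invariant_finite:
  assumes "finite D" "D \<subseteq> carrier G"
  shows "almost_invariant G D"
  unfolding almost_invariant_def
proof (intro conjI ballI assms)
  fix s assume s: "s \<in> carrier G"
  show "finite {g \<in> carrier G. (g \<in> D) \<noteq> (g \<otimes> s \<in> D)}"
    by (rule finite_subset[of _ "D \<union> {g \<in> carrier G. g \<otimes> s \<in> D}"])
      (use assms finite_mult_preimage[OF assms(1) s] in auto)
qed

text \<open>The condition passes from \<open>s\<close> and \<open>t\<close> to \<open>s \<otimes> t\<close>: if right multiplication by the product
  crosses the border of \<open>D\<close>, one of the two steps does.\<close>

lemma finite_coboundary_mult:
  assumes st: "s \<in> carrier G" "t \<in> carrier G"
    and "finite {g \<in> carrier G. (g \<in> D) \<noteq> (g \<otimes> s \<in> D)}" (is "finite ?A")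
    and "finite {g \<in> carrier G. (g \<in> D) \<noteq> (g \<otimes> t \<in> D)}" (is "finite ?B")
  shows "finite {g \<in> carrier G. (g \<in> D) \<noteq> (g \<otimes> (s \<otimes> t) \<in> D)}"
  by (rule finite_subset[of _ "?A \<union> {g \<in> carrier G. g \<otimes> s \<in> ?B}"])
    (use assms finite_mult_preimage[OF assms(4) st(1)] in \<open>auto simp: m_assoc\<close>)

lemma l_coset_iff:
  assumes "m \<in> carrier G" "D \<subseteq> carrier G" "g \<in> carrier G"
  shows "g \<in> m <# D \<longleftrightarrow> inv m \<otimes> g \<in> D"
proof
  assume "inv m \<otimes> g \<in> D"
  then show "g \<in> m <# D"
    using assms by (auto simp: l_coset_def m_assoc[symmetric] intro!: bexI[of _ "inv m \<otimes> g"])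
qed (use assms in \<open>auto simp: l_coset_def m_assoc[symmetric] subset_iff\<close>)

lemma almost_invariant_l_coset:
  assumes D: "almost_invariant G D" and m: "m \<in> carrier G"
  shows "almost_invariant G (m <# D)"
  unfolding almost_invariant_def
proof (intro conjI ballI)
  have sub: "D \<subseteq> carrier G" using D by (simp add: almost_invariant_def)
  show "m <# D \<subseteq> carrier G" using l_coset_subset_G[OF sub m] .
  fix s assume s: "s \<in> carrier G"
  let ?B = "{g \<in> carrier G. (g \<in> D) \<noteq> (g \<otimes> s \<in> D)}"
  show "finite {g \<in> carrier G. (g \<in> m <# D) \<noteq> (g \<otimes> s \<in> m <# D)}"
  proof (rule finite_subset)
    show "finite ((\<lambda>g. m \<otimes> g) ` ?B)" using D s by (auto simp: almost_invariant_def)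
    show "{g \<in> carrier G. (g \<in> m <# D) \<noteq> (g \<otimes> s \<in> m <# D)} \<subseteq> (\<lambda>g. m \<otimes> g) ` ?B"
    proof
      fix g assume "g \<in> {g \<in> carrier G. (g \<in> m <# D) \<noteq> (g \<otimes> s \<in> m <# D)}"
      then have "g \<in> carrier G" "inv m \<otimes> g \<in> ?B"
        using s m l_coset_iff[OF m sub] by (auto simp: m_assoc)
      then show "g \<in> (\<lambda>g. m \<otimes> g) ` ?B"
        using m by (intro image_eqI[of _ _ "inv m \<otimes> g"]) (auto simp: m_assoc[symmetric])
    qed
  qed
qed

end

locale cayley_graph = group G for G :: "('g, 'm) monoid_scheme" (structure) +
  fixes S :: "'g set"
  assumes finite_gens: "finite S" and gens_carrier: "S \<subseteq> carrier G"
    and generate_gens: "generate G S = carrier G"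
begin

abbreviation edges :: "('g \<times> 'g) set" where "edges \<equiv> cayley_edges G S"
abbreviation wdist :: "'g \<Rightarrow> 'g \<Rightarrow> nat" where "wdist \<equiv> word_dist G S"
abbreviation len :: "'g \<Rightarrow> nat" where "len \<equiv> word_dist G S \<one>"

lemma edges_carrier: "(g, h) \<in> edges \<Longrightarrow> g \<in> carrier G \<and> h \<in> carrier G \<and> g \<noteq> h"
  by (auto simp: cayley_edges_def)

lemma edges_sym: "(g, h) \<in> edges \<Longrightarrow> (h, g) \<in> edges"
  by (auto simp: cayley_edges_def)

lemma path_carrier: "(g, h) \<in> edges ^^ k \<Longrightarrow> g \<in> carrier G \<Longrightarrow> h \<in> carrier G"
  by (induction k arbitrary: h) (use edges_carrier in auto)

lemma path_sym: "(g, h) \<in> edges ^^ k \<Longrightarrow> (h, g) \<in> edges ^^ k"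
proof (induction k arbitrary: h)
  case (Suc k)
  then obtain y where "(g, y) \<in> edges ^^ k" "(y, h) \<in> edges" by auto
  then show ?case using Suc.IH edges_sym relpow_Suc_I2 by metis
qed auto

lemma path_left_mult:
  assumes "(g, h) \<in> edges ^^ k" "x \<in> carrier G"
  shows "(x \<otimes> g, x \<otimes> h) \<in> edges ^^ k"
  using assms(1)
proof (induction k arbitrary: h)
  case (Suc k)
  then obtain y where y: "(g, y) \<in> edges ^^ k" "(y, h) \<in> edges" by auto
  have "(x \<otimes> y, x \<otimes> h) \<in> edges"
    using y(2) assms(2) gens_carrier unfolding cayley_edges_def
    by (auto simp: m_assoc subset_iff)
  then show ?case using Suc.IH[OF y(1)] by auto
qed auto

lemma path_exists:
  assumes "g \<in> carrier G" "h \<in> carrier G"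
  shows "\<exists>k. (g, h) \<in> edges ^^ k"
proof -
  have step: "(g, g \<otimes> s) \<in> edges\<^sup>*" if "s \<in> S" "g \<in> carrier G" for g s
    using that gens_carrier by (cases "g = g \<otimes> s") (auto simp: cayley_edges_def intro!: r_into_rtrancl)
  have sym: "(h, g) \<in> edges\<^sup>*" if "(g, h) \<in> edges\<^sup>*" for g h
    using that path_sym unfolding rtrancl_power by blast
  have "(g, g \<otimes> x) \<in> edges\<^sup>*" if "x \<in> generate G S" "g \<in> carrier G" for g x
    using that
  proof (induction arbitrary: g)
    case (incl s)
    then show ?case by (rule step)
  next
    case (inv s)
    then have "s \<in> carrier G" using gens_carrier by blast
    then show ?case
      using inv sym[OF step[of s "g \<otimes> inv s"]] by (simp add: m_assoc)
  next
    case (eng x y)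
    have "x \<in> carrier G" "y \<in> carrier G" using eng generate_gens by auto
    then show ?case
      using eng.IH(1)[of g] eng.IH(2)[of "g \<otimes> x"] eng.prems
      by (simp add: m_assoc[symmetric] rtrancl_trans[of g "g \<otimes> x"])
  qed simp
  from this[of "inv g \<otimes> h" g] show ?thesis
    using assms by (simp add: generate_gens m_assoc[symmetric] rtrancl_power)
qed

lemma path_wdist: "g \<in> carrier G \<Longrightarrow> h \<in> carrier G \<Longrightarrow> (g, h) \<in> edges ^^ wdist g h"
  unfolding word_dist_def using path_exists LeastI_ex by metis

lemma wdist_le: "(g, h) \<in> edges ^^ k \<Longrightarrow> wdist g h \<le> k"
  unfolding word_dist_def by (rule Least_le)

lemma len_one [simp]: "len \<one> = 0"
  using wdist_le[of \<one> \<one> 0] by simp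

lemma len_path:
  assumes "(z, x) \<in> edges ^^ k" "z \<in> carrier G"
  shows "len x \<le> len z + k" "len z \<le> len x + k"
proof -
  have x: "x \<in> carrier G" using path_carrier assms by blast
  have *: "len b \<le> len a + k" if "a \<in> carrier G" "(a, b) \<in> edges ^^ k" for a b
    using path_wdist[OF one_closed that(1)] that(2) by (intro wdist_le) (auto simp: relpow_add)
  show "len x \<le> len z + k" "len z \<le> len x + k"
    using * assms x path_sym by blast+
qed

lemma finite_ball: "finite {g \<in> carrier G. len g \<le> n}"
proof (induction n)
  case 0
  have "g = \<one>" if "g \<in> carrier G" "len g \<le> 0" for g
    using path_wdist[OF one_closed that(1)] that(2) by simp
  then show ?case by (rule_tac finite_subset[of _ "{\<one>}"]) auto
next
  case (Suc n)
  let ?B = "{g \<in> carrier G. len g \<le> n}"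
  have "g \<in> ?B \<union> (\<Union>s\<in>S. (\<lambda>y. y \<otimes> s) ` ?B \<union> (\<lambda>y. y \<otimes> inv s) ` ?B)"
    if g: "g \<in> carrier G" "len g \<le> Suc n" for g
  proof (cases "len g \<le> n")
    case False
    then have "(\<one>, g) \<in> edges ^^ Suc n" using path_wdist[OF one_closed g(1)] g(2) by (simp add: le_Suc_eq)
    then obtain y where y: "(\<one>, y) \<in> edges ^^ n" "(y, g) \<in> edges" by auto
    then have yB: "y \<in> ?B" using wdist_le edges_carrier by blast
    obtain s where s: "s \<in> S" "g = y \<otimes> s \<or> y = g \<otimes> s" using y(2) by (auto simp: cayley_edges_def)
    then have "g = y \<otimes> s \<or> g = y \<otimes> inv s" using g gens_carrier by (auto simp: m_assoc subset_iff)
    then show ?thesis using s yB by blast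
  qed (use g in simp)
  then have "{g \<in> carrier G. len g \<le> Suc n} \<subseteq> ?B \<union> (\<Union>s\<in>S. (\<lambda>y. y \<otimes> s) ` ?B \<union> (\<lambda>y. y \<otimes> inv s) ` ?B)"
    by blast
  moreover have "finite (?B \<union> (\<Union>s\<in>S. (\<lambda>y. y \<otimes> s) ` ?B \<union> (\<lambda>y. y \<otimes> inv s) ` ?B))"
    using Suc finite_gens by simp
  ultimately show ?case by (rule finite_subset)
qed

lemma countable_carrier: "countable (carrier G)"
proof -
  have "carrier G = (\<Union>n. {g \<in> carrier G. len g \<le> n})" by auto
  moreover have "countable (\<Union>n. {g \<in> carrier G. len g \<le> n})"
    using countable_finite[OF finite_ball] by (intro countable_UN) auto
  ultimately show ?thesis by simp
qed

definition frontier_verts :: "'g set \<Rightarrow> 'g set" where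
  "frontier_verts D = {g. \<exists>h. (g, h) \<in> edges \<and> (g \<in> D) \<noteq> (h \<in> D)}"

lemma finite_frontier_verts:
  assumes "almost_invariant G D"
  shows "finite (frontier_verts D)"
proof -
  let ?B = "\<lambda>s. {g \<in> carrier G. (g \<in> D) \<noteq> (g \<otimes> s \<in> D)}"
  have "frontier_verts D \<subseteq> (\<Union>s\<in>S. ?B s \<union> (\<lambda>g. g \<otimes> s) ` ?B s)"
  proof
    fix g assume "g \<in> frontier_verts D"
    then obtain h s where gh: "g \<in> carrier G" "h \<in> carrier G" "s \<in> S" "h = g \<otimes> s \<or> g = h \<otimes> s"
      "(g \<in> D) \<noteq> (h \<in> D)"
      by (auto simp: frontier_verts_def cayley_edges_def)
    then have "g \<in> ?B s \<union> (\<lambda>g. g \<otimes> s) ` ?B s" by blast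
    then show "g \<in> (\<Union>s\<in>S. ?B s \<union> (\<lambda>g. g \<otimes> s) ` ?B s)" using gh(3) by blast
  qed
  moreover have "finite (\<Union>s\<in>S. ?B s \<union> (\<lambda>g. g \<otimes> s) ` ?B s)"
    using finite_gens gens_carrier assms unfolding almost_invariant_def by blast
  ultimately show ?thesis by (rule finite_subset)
qed

lemma frontier_verts_l_coset:
  assumes m: "m \<in> carrier G" and D: "D \<subseteq> carrier G" and z: "z \<in> frontier_verts (m <# D)"
  shows "inv m \<otimes> z \<in> frontier_verts D"
proof -
  obtain h where h: "(z, h) \<in> edges" "(z \<in> m <# D) \<noteq> (h \<in> m <# D)"
    using z by (auto simp: frontier_verts_def)
  have "(inv m \<otimes> z, inv m \<otimes> h) \<in> edges"
    using path_left_mult[of z h 1 "inv m"] h m by auto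
  then show ?thesis
    using h(2) l_coset_iff[OF m D] edges_carrier[OF h(1)] by (auto simp: frontier_verts_def)
qed

text \<open>An edge path that enters or leaves \<open>m <# D\<close> passes the frontier of this set, which is the translate by \<open>m\<close>
  of the frontier of \<open>D\<close> and thus near \<open>m\<close>. The equation for the lengths records that the vertex
  found this way is on a geodesic from \<open>\<one>\<close> to \<open>x\<close>.\<close>

lemma geodesic_crosses_near:
  assumes D: "almost_invariant G D" and K: "\<And>z. z \<in> frontier_verts D \<Longrightarrow> len z \<le> K"
    and m: "m \<in> carrier G" and x: "x \<in> carrier G" and sep: "(\<one> \<in> m <# D) \<noteq> (x \<in> m <# D)"
  shows "\<exists>z\<in>carrier G. (\<exists>k. (z, x) \<in> edges ^^ k \<and> len x = len z + k) \<and> (\<exists>k\<le>K. (m, z) \<in> edges ^^ k)"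
proof -
  have sub: "D \<subseteq> carrier G" using D by (simp add: almost_invariant_def)
  obtain i c e where i: "i < len x" "(\<one>, c) \<in> edges ^^ i" "(c, e) \<in> edges"
    "(e, x) \<in> edges ^^ (len x - Suc i)" "(c \<in> m <# D) \<noteq> (e \<in> m <# D)"
    using relpow_crossing[OF path_wdist[OF one_closed x], of "\<lambda>g. g \<in> m <# D"] sep by blast
  have c: "c \<in> carrier G" using edges_carrier i by blast
  have cx: "(c, x) \<in> edges ^^ (len x - i)"
    using relpow_Suc_I2[OF i(3,4)] i(1) by (simp add: Suc_diff_Suc)
  have "len c \<le> i" using wdist_le i by blast
  moreover have "len x \<le> len c + (len x - i)" using len_path[OF cx c] by blast
  ultimately have lenc: "len x = len c + (len x - i)" using i(1) by linarith
  have "c \<in> frontier_verts (m <# D)" using i by (auto simp: frontier_verts_def)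
  then have "inv m \<otimes> c \<in> frontier_verts D" by (rule frontier_verts_l_coset[OF m sub])
  then have "len (inv m \<otimes> c) \<le> K" by (rule K)
  moreover have "(m, c) \<in> edges ^^ len (inv m \<otimes> c)"
    using path_left_mult[OF path_wdist[OF one_closed, of "inv m \<otimes> c"] m] m c
    by (simp add: m_assoc[symmetric])
  ultimately show ?thesis using c cx lenc by blast
qed

lemma geodesic_point:
  assumes "x \<in> carrier G" "n \<le> len x"
  shows "\<exists>z\<in>carrier G. len z = n \<and> (z, x) \<in> edges ^^ (len x - n)"
proof -
  have "(\<one>, x) \<in> edges ^^ (n + (len x - n))" using path_wdist[OF one_closed assms(1)] assms(2) by simp
  then obtain z where z: "(\<one>, z) \<in> edges ^^ n" "(z, x) \<in> edges ^^ (len x - n)"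
    unfolding relpow_add by auto
  have zc: "z \<in> carrier G" using path_carrier[OF z(1)] by simp
  then have "len z = n" using wdist_le[OF z(1)] len_path[OF z(2)] assms(2) by simp
  then show ?thesis using z zc by blast
qed

end

section \<open>The Floyd metric and the Floyd boundary\<close>

locale floyd_graph = cayley_graph G S for G :: "('g, 'm) monoid_scheme" (structure) and S +
  fixes f :: "nat \<Rightarrow> real"
  assumes floyd_f: "floyd_function f"
begin

abbreviation X :: "('g \<Rightarrow> real) set" where "X \<equiv> cayley_space G S"
abbreviation fdist :: "('g \<Rightarrow> real) \<Rightarrow> ('g \<Rightarrow> real) \<Rightarrow> real" where "fdist \<equiv> floyd_dist f G S"
abbreviation cdist where "cdist \<equiv> completion_dist X fdist"
abbreviation bd where "bd \<equiv> floyd_boundary f G S"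

sublocale fl: Metric_space X fdist
  using Metric_space_floyd_dist[OF floyd_f _ gens_carrier generate_gens] group_axioms by blast

sublocale co: Metric_space "cauchy_completion X fdist" cdist
  by (rule Metric_space_cauchy_completion[OF fl.Metric_space_axioms])

definition vert :: "'g \<Rightarrow> 'g \<Rightarrow> real" where "vert g = edge_point g g 0"

definition emb :: "'g \<Rightarrow> (nat \<Rightarrow> 'g \<Rightarrow> real) set" where "emb g = completion_embed X fdist (vert g)"

abbreviation vdist :: "'g \<Rightarrow> 'g \<Rightarrow> real" where "vdist g h \<equiv> fdist (vert g) (vert h)"

lemma f_pos: "0 < f n"
  using floyd_f by (simp add: floyd_function_def)

lemma f_antimono: "m \<le> n \<Longrightarrow> f n \<le> f m"
  using floyd_f decseqD[of f m n] by (auto simp: floyd_function_def decseq_Suc_iff)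

lemma f_summable: "summable f"
  using floyd_f by (simp add: floyd_function_def)

lemma f_tendsto_0: "f \<longlonglongrightarrow> 0"
  by (rule summable_LIMSEQ_zero[OF f_summable])

lemma vert_apply: "vert g x = of_bool (x = g)"
  by (simp add: vert_def edge_point_def)

lemma vert_closed_edge: "vert g \<in> closed_edge g h" "vert h \<in> closed_edge g h"
proof -
  have "vert g = edge_point g h 0" "vert h = edge_point g h 1"
    by (auto simp: vert_def edge_point_def)
  then show "vert g \<in> closed_edge g h" "vert h \<in> closed_edge g h"
    by (auto simp: closed_edge_def)
qed

lemma vert_in: "g \<in> carrier G \<Longrightarrow> vert g \<in> X"
  using vert_closed_edge(1)[of g g] by (auto simp: cayley_space_def)

lemma closed_edge_same: "closed_edge g g = {vert g}"
proof -
  have "edge_point g g t = vert g" for t by (auto simp: edge_point_def vert_def)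
  then show ?thesis by (simp add: closed_edge_def image_constant_conv)
qed

lemma closed_edge_in: "(g, h) \<in> edges \<Longrightarrow> closed_edge g h \<subseteq> X"
  by (auto simp: cayley_space_def)

lemma fdist_le:
  assumes "floyd_path f G S p q L"
  shows "fdist p q \<le> L"
proof -
  have "bdd_below {L. floyd_path f G S p q L}"
    using floyd_path_nonneg[OF _ floyd_f] by (intro bdd_belowI[of _ 0]) auto
  then show ?thesis
    using assms floyd_path_in_space[OF assms] by (auto simp: floyd_dist_def intro: cInf_lower)
qed

lemma fdist_ge:
  assumes "p \<in> X" "q \<in> X" "\<And>L. floyd_path f G S p q L \<Longrightarrow> c \<le> L"
  shows "c \<le> fdist p q"
proof -
  have "{L. floyd_path f G S p q L} \<noteq> {}"
    using floyd_path_exists[OF _ gens_carrier generate_gens assms(1,2)] group_axioms by blast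
  then show ?thesis using assms by (auto simp: floyd_dist_def intro!: cInf_greatest)
qed

lemma fdist_coordinate:
  assumes "p \<in> X" "q \<in> X"
  shows "f (len x) * \<bar>p x - q x\<bar> \<le> fdist p q"
  by (intro fdist_ge assms floyd_path_lower_bound[OF _ floyd_f])

lemma fdist_closed_edge:
  assumes "(g, h) \<in> edges" "p \<in> closed_edge g h" "q \<in> closed_edge g h"
  shows "fdist p q \<le> f (min (len g) (len h)) * \<bar>p h - q h\<bar>"
  using fdist_le[OF floyd_path_single[OF assms]] by (simp add: floyd_edge_length_def)

lemma vdist_edge:
  assumes "(g, h) \<in> edges"
  shows "vdist g h \<le> f (min (len g) (len h))"
proof -
  have "g \<noteq> h" using edges_carrier[OF assms] by blast
  then show ?thesis using fdist_closed_edge[OF assms vert_closed_edge] by (simp add: vert_apply)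
qed

subsection \<open>Lower bounds: almost invariant sets\<close>

text \<open>
  The function \<open>\<phi>\<close> below is affine on edges, \<open>1\<close> on the vertices in \<open>D\<close> and \<open>0\<close> on the others.
  It varies only along the finitely many edges that join \<open>D\<close> to its complement, and these have
  Floyd lengths bounded from below, so that \<open>\<phi>\<close> is Lipschitz for the Floyd metric.
\<close>

lemma vdist_separated:
  assumes D: "almost_invariant G D"
  shows "\<exists>c>0. \<forall>u\<in>D. \<forall>v\<in>carrier G - D. c \<le> vdist u v"
proof -
  obtain N where N: "\<And>z. z \<in> frontier_verts D \<Longrightarrow> len z \<le> N"
    using finite_nat_set_iff_bounded_le[of "len ` frontier_verts D"] finite_frontier_verts[OF D] by auto
  define \<phi> where "\<phi> p = (\<Sum>x\<in>{x. p x \<noteq> 0}. p x * of_bool (x \<in> D))" for p :: "'g \<Rightarrow> real"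
  have \<phi>_edge: "\<phi> (edge_point g h t) = (1 - t) * of_bool (g \<in> D) + t * of_bool (h \<in> D)" for g h t
  proof -
    have "\<phi> (edge_point g h t) = (\<Sum>x\<in>{g, h}. edge_point g h t x * of_bool (x \<in> D))"
      unfolding \<phi>_def by (rule sum.mono_neutral_left) (auto simp: edge_point_def)
    then show ?thesis by (cases "g = h") (auto simp: edge_point_def)
  qed
  have path: "f N * \<bar>\<phi> p - \<phi> q\<bar> \<le> L" if "floyd_path f G S p q L" for p q L
    using that
  proof induction
    case (step g h p q r L)
    obtain t u where tu: "p = edge_point g h t" "q = edge_point g h u"
      using step by (auto simp: closed_edge_def)
    have gh: "g \<noteq> h" using step edges_carrier by blast
    have "f N * \<bar>\<phi> p - \<phi> q\<bar> \<le> floyd_edge_length f G S g h * \<bar>p h - q h\<bar>"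
    proof (cases "g \<in> D \<longleftrightarrow> h \<in> D")
      case True
      then have "\<phi> p = \<phi> q" by (auto simp: tu \<phi>_edge)
      then show ?thesis using f_pos by (simp add: floyd_edge_length_def less_imp_le)
    next
      case False
      then have "g \<in> frontier_verts D" using step by (auto simp: frontier_verts_def)
      then have "min (len g) (len h) \<le> N" using N by (simp add: min.coboundedI1)
      then have "f N \<le> floyd_edge_length f G S g h"
        by (simp add: floyd_edge_length_def f_antimono)
      moreover have "\<bar>\<phi> p - \<phi> q\<bar> = \<bar>p h - q h\<bar>"
      proof -
        have "\<bar>\<phi> p - \<phi> q\<bar> = \<bar>t - u\<bar>" using False unfolding tu \<phi>_edge by auto
        also have "\<dots> = \<bar>p h - q h\<bar>" using gh by (simp add: tu edge_point_def)
        finally show ?thesis .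
      qed
      ultimately show ?thesis by (simp add: mult_right_mono)
    qed
    moreover have "f N * \<bar>\<phi> p - \<phi> r\<bar> \<le> f N * \<bar>\<phi> p - \<phi> q\<bar> + f N * \<bar>\<phi> q - \<phi> r\<bar>"
    proof -
      have "\<bar>\<phi> p - \<phi> r\<bar> \<le> \<bar>\<phi> p - \<phi> q\<bar> + \<bar>\<phi> q - \<phi> r\<bar>" by simp
      then show ?thesis using f_pos[of N] by (metis distrib_left less_imp_le mult_left_mono)
    qed
    ultimately show ?case using step.IH by simp
  qed simp
  have "f N \<le> vdist u v" if "u \<in> D" "v \<in> carrier G - D" for u v
  proof (rule fdist_ge)
    show "vert u \<in> X" "vert v \<in> X" using that D by (auto intro: vert_in simp: almost_invariant_def)
    show "f N \<le> L" if "floyd_path f G S (vert u) (vert v) L" for L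
      using path[OF that] \<open>u \<in> D\<close> \<open>v \<in> carrier G - D\<close> unfolding vert_def \<phi>_edge by simp
  qed
  then show ?thesis using f_pos[of N] by blast
qed

subsection \<open>Upper bounds: paths far from the identity\<close>

definition tail :: "nat \<Rightarrow> real" where "tail n = (\<Sum>k. f (k + n))"

lemma tail_tendsto_0: "tail \<longlonglongrightarrow> 0"
proof -
  have "tail = (\<lambda>n. suminf f - (\<Sum>k<n. f k))"
    unfolding tail_def using suminf_minus_initial_segment[OF f_summable] by simp
  moreover have "(\<lambda>n. suminf f - (\<Sum>k<n. f k)) \<longlonglongrightarrow> 0"
    using tendsto_diff[OF tendsto_const[of "suminf f"] summable_LIMSEQ[OF f_summable]] by simp
  ultimately show ?thesis by simp
qed

lemma tail_antimono: "m \<le> n \<Longrightarrow> tail n \<le> tail m"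
  unfolding tail_def
  by (rule suminf_le) (use f_antimono summable_ignore_initial_segment[OF f_summable] in auto)

lemma vdist_triangle:
  "a \<in> carrier G \<Longrightarrow> b \<in> carrier G \<Longrightarrow> c \<in> carrier G \<Longrightarrow> vdist a c \<le> vdist a b + vdist b c"
  by (intro fl.triangle vert_in)

text \<open>The Floyd length of a geodesic pointing away from the identity is a partial sum of \<open>f\<close>, whatever
  the length of the geodesic.\<close>

lemma vdist_geodesic:
  assumes "(z, x) \<in> edges ^^ k" "z \<in> carrier G" "len x = len z + k"
  shows "vdist z x \<le> tail (len z)"
proof -
  have "vdist z x \<le> (\<Sum>i<k. f (i + len z))"
    using assms
  proof (induction k arbitrary: x)
    case 0
    then show ?case using fl.mdist_zero vert_in by simp
  next
    case (Suc k)
    then obtain y where y: "(z, y) \<in> edges ^^ k" "(y, x) \<in> edges" by auto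
    have c: "y \<in> carrier G" "x \<in> carrier G" using edges_carrier y by blast+
    have "len y \<le> len z + k" using len_path[OF y(1) Suc.prems(2)] by simp
    moreover have "len x \<le> len y + 1" using len_path[of y x 1] y c by simp
    ultimately have ly: "len y = len z + k" using Suc.prems by simp
    have "vdist z x \<le> vdist z y + vdist y x" using vdist_triangle c Suc.prems by blast
    moreover have "vdist z y \<le> (\<Sum>i<k. f (i + len z))" using Suc ly y by blast
    moreover have "vdist y x \<le> f (k + len z)"
      using vdist_edge[OF y(2)] ly Suc.prems by (simp add: add.commute)
    ultimately show ?case by simp
  qed
  also have "\<dots> \<le> tail (len z)"
    unfolding tail_def
    by (rule sum_le_suminf) (use f_pos less_imp_le summable_ignore_initial_segment[OF f_summable] in auto)
  finally show ?thesis .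
qed

lemma vdist_near:
  assumes "(z, x) \<in> edges ^^ k" "z \<in> carrier G" "k \<le> K" "R \<le> len z"
  shows "vdist z x \<le> K * f (R - K)"
proof -
  have "vdist z x \<le> k * f (R - K)"
    using assms(1,3)
  proof (induction k arbitrary: x)
    case 0
    then show ?case using fl.mdist_zero vert_in assms by simp
  next
    case (Suc k)
    then obtain y where y: "(z, y) \<in> edges ^^ k" "(y, x) \<in> edges" by auto
    have c: "y \<in> carrier G" "x \<in> carrier G" using edges_carrier y by blast+
    have "len z \<le> len y + k" "len z \<le> len x + Suc k"
      using len_path[OF y(1) assms(2)] len_path[OF Suc.prems(1) assms(2)] by simp_all
    then have "R - K \<le> min (len y) (len x)" using Suc.prems(2) assms(4) by linarith
    then have "vdist y x \<le> f (R - K)" using vdist_edge[OF y(2)] f_antimono order_trans by blast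
    moreover have "vdist z x \<le> vdist z y + vdist y x" using vdist_triangle c assms by blast
    moreover have "vdist z y \<le> k * f (R - K)" using Suc y by simp
    ultimately show ?case by (simp add: algebra_simps)
  qed
  also have "\<dots> \<le> K * f (R - K)"
    using assms(3) f_pos[of "R - K"] by (simp add: mult_right_mono)
  finally show ?thesis .
qed

text \<open>Every vertex is close to a ball, along a geodesic from the identity; balls are finite.\<close>

lemma vertices_totally_bounded: "fl.mtotally_bounded (vert ` carrier G)"
  unfolding fl.mtotally_bounded_def
proof (intro allI impI)
  fix \<epsilon> :: real assume "\<epsilon> > 0"
  then obtain n where n: "tail n < \<epsilon>"
    using LIMSEQ_D[OF tail_tendsto_0 \<open>\<epsilon> > 0\<close>] by (metis abs_ge_self diff_zero le_less_trans order_refl real_norm_def)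
  let ?K = "vert ` {g \<in> carrier G. len g \<le> n}"
  have "vert x \<in> (\<Union>p\<in>?K. fl.mball p \<epsilon>)" if x: "x \<in> carrier G" for x
  proof (cases "len x \<le> n")
    case True
    then show ?thesis using x \<open>\<epsilon> > 0\<close> vert_in by auto
  next
    case False
    then obtain z where z: "z \<in> carrier G" "len z = n" "(z, x) \<in> edges ^^ (len x - n)"
      using geodesic_point[OF x, of n] by auto
    then have "vdist z x \<le> tail n" using vdist_geodesic[OF z(3,1)] False by simp
    then show ?thesis using n x z vert_in by fastforce
  qed
  then show "\<exists>K. finite K \<and> K \<subseteq> vert ` carrier G \<and> vert ` carrier G \<subseteq> (\<Union>p\<in>K. fl.mball p \<epsilon>)"
    using finite_ball[of n] by (intro exI[of _ ?K]) auto
qed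

subsection \<open>Boundary points as limits of vertices\<close>

abbreviation boundary :: "(nat \<Rightarrow> 'g \<Rightarrow> real) set set" where
  "boundary \<equiv> cauchy_completion X fdist - completion_embed X fdist ` X"

definition vconv :: "(nat \<Rightarrow> 'g) \<Rightarrow> (nat \<Rightarrow> 'g \<Rightarrow> real) set \<Rightarrow> bool" where
  "vconv \<sigma> \<xi> \<longleftrightarrow> (\<forall>n. \<sigma> n \<in> carrier G) \<and> (\<lambda>n. cdist \<xi> (emb (\<sigma> n))) \<longlonglongrightarrow> 0"

sublocale bdm: Submetric "cauchy_completion X fdist" cdist boundary
  by unfold_locales auto

lemma floyd_boundary_eq: "bd = bdm.sub.mtopology"
  by (simp add: floyd_boundary_def Let_def completion_topology_def bdm.mtopology_submetric)

lemma topspace_bd: "topspace bd = boundary"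
  by (simp add: floyd_boundary_eq)

lemma emb_in: "g \<in> carrier G \<Longrightarrow> emb g \<in> cauchy_completion X fdist"
  unfolding emb_def by (intro fl.completion_embed_in vert_in)

lemma cdist_emb: "g \<in> carrier G \<Longrightarrow> h \<in> carrier G \<Longrightarrow> cdist (emb g) (emb h) = vdist g h"
  unfolding emb_def by (intro fl.completion_embed_isometric vert_in)

lemma vdist_le_cdist:
  assumes "g \<in> carrier G" "h \<in> carrier G" "\<xi> \<in> cauchy_completion X fdist"
  shows "vdist g h \<le> cdist \<xi> (emb g) + cdist \<xi> (emb h)"
  using co.triangle'[of "emb g" \<xi> "emb h"] assms emb_in cdist_emb by (simp add: co.commute)

text \<open>Vertices that leave every ball have a Cauchy subsequence by total boundedness. Its limit is not in the Cayley
  graph, since all barycentric coordinates tend to \<open>0\<close> along the sequence.\<close>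

lemma escaping_vertices_accumulate:
  assumes \<sigma>: "\<And>n. \<sigma> n \<in> carrier G" and esc: "filterlim (\<lambda>n. len (\<sigma> n)) at_top sequentially"
  shows "\<exists>r \<eta>. strict_mono r \<and> \<eta> \<in> boundary \<and> vconv (\<sigma> \<circ> r) \<eta>"
proof -
  have "range (\<lambda>n. vert (\<sigma> n)) \<subseteq> vert ` carrier G" using \<sigma> by auto
  then obtain r :: "nat \<Rightarrow> nat" where r: "strict_mono r" "fl.MCauchy ((\<lambda>n. vert (\<sigma> n)) \<circ> r)"
    using vertices_totally_bounded unfolding fl.mtotally_bounded_sequentially by metis
  let ?\<tau> = "(\<lambda>n. vert (\<sigma> n)) \<circ> r"
  define \<eta> where "\<eta> = cauchy_equiv X fdist `` {?\<tau>}"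
  have \<eta>: "\<eta> \<in> cauchy_completion X fdist"
    unfolding \<eta>_def by (rule fl.completion_class[OF r(2)])
  have conv: "vconv (\<sigma> \<circ> r) \<eta>"
    using fl.completion_embed_tendsto[OF r(2)] \<sigma> by (simp add: vconv_def \<eta>_def emb_def)
  have "\<eta> \<notin> completion_embed X fdist ` X"
  proof
    assume "\<eta> \<in> completion_embed X fdist ` X"
    then obtain p where p: "p \<in> X" "\<eta> = completion_embed X fdist p" by blast
    have "fl.MCauchy (\<lambda>_. p)" using p by (rule_tac fl.MCauchy_const)
    from fl.completion_dist_tendsto[OF this r(2)]
    have lim: "(\<lambda>n. fdist p (vert (\<sigma> (r n)))) \<longlonglongrightarrow> 0"
      using \<eta> p by (simp add: \<eta>_def[symmetric] completion_embed_def)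
    obtain x where x: "x \<in> carrier G" "p x \<noteq> 0"
    proof -
      obtain g h t where gh: "g \<in> carrier G" "h \<in> carrier G" "p = edge_point g h t"
        using p(1) edges_carrier unfolding cayley_space_def closed_edge_def by blast
      have "p g \<noteq> 0 \<or> p h \<noteq> 0" by (cases "g = h") (auto simp: gh edge_point_def)
      then show ?thesis using gh that by blast
    qed
    have "0 < f (len x) * \<bar>p x\<bar>" using x f_pos by simp
    then have "\<forall>\<^sub>F n in sequentially. fdist p (vert (\<sigma> (r n))) < f (len x) * \<bar>p x\<bar>"
      using lim by (simp add: order_tendstoD)
    moreover have "\<forall>\<^sub>F n in sequentially. len x < len (\<sigma> (r n))"
      by (rule eventually_compose_filterlim[OF eventually_gt_at_top filterlim_compose[OF esc filterlim_subseq[OF r(1)]]])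
    ultimately have "\<forall>\<^sub>F n in sequentially. False"
    proof eventually_elim
      case (elim n)
      have "f (len x) * \<bar>p x - vert (\<sigma> (r n)) x\<bar> \<le> fdist p (vert (\<sigma> (r n)))"
        by (intro fdist_coordinate p vert_in \<sigma>)
      moreover have "vert (\<sigma> (r n)) x = 0" using elim by (auto simp: vert_apply)
      ultimately show ?case using elim by simp
    qed
    then show False by simp
  qed
  then show ?thesis using r(1) \<eta> conv by blast
qed

lemma infinite_set_accumulates:
  assumes "infinite Y" "Y \<subseteq> carrier G"
  shows "\<exists>\<sigma> \<eta>. \<eta> \<in> boundary \<and> vconv \<sigma> \<eta> \<and> range \<sigma> \<subseteq> Y"
proof -
  have "\<exists>y\<in>Y. n < len y" for n
  proof (rule ccontr)
    assume "\<not> (\<exists>y\<in>Y. n < len y)"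
    then have "Y \<subseteq> {g \<in> carrier G. len g \<le> n}" using assms by (auto simp: not_less)
    then show False using finite_ball assms(1) finite_subset by blast
  qed
  then obtain \<sigma> where \<sigma>: "\<And>n. \<sigma> n \<in> Y" "\<And>n. n < len (\<sigma> n)" by metis
  have "filterlim (\<lambda>n. len (\<sigma> n)) at_top sequentially"
    by (rule filterlim_at_top_mono[OF filterlim_ident]) (use less_imp_le[OF \<sigma>(2)] in auto)
  then obtain r \<eta> where "\<eta> \<in> boundary" "vconv (\<sigma> \<circ> r) \<eta>"
    using escaping_vertices_accumulate[of \<sigma>] \<sigma> assms by blast
  then show ?thesis using \<sigma> by (intro exI[of _ "\<sigma> \<circ> r"]) auto
qed

text \<open>The coordinate along the edge is a Lipschitz parametrization.\<close>

lemma compact_closed_edge: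
  assumes gh: "(g, h) \<in> edges"
  shows "compactin fl.mtopology (closed_edge g h)"
proof -
  let ?l = "f (min (len g) (len h))"
  have ne: "g \<noteq> h" using edges_carrier gh by blast
  have dist: "fdist (edge_point g h t) (edge_point g h u) \<le> ?l * \<bar>t - u\<bar>"
    if "t \<in> {0..1}" "u \<in> {0..1}" for t u
    using fdist_closed_edge[OF gh, of "edge_point g h t" "edge_point g h u"] that ne
    by (auto simp: closed_edge_def edge_point_def)
  have "continuous_map (top_of_set {0..1}) fl.mtopology (edge_point g h)"
    unfolding fl.continuous_map_to_metric
  proof (intro ballI allI impI)
    fix t \<epsilon> :: real assume t: "t \<in> topspace (top_of_set {0..1})" and "\<epsilon> > 0"
    let ?U = "{0..1} \<inter> ball t (\<epsilon> / ?l)"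
    have "edge_point g h u \<in> fl.mball (edge_point g h t) \<epsilon>" if u: "u \<in> ?U" for u
    proof -
      have "?l * \<bar>t - u\<bar> < \<epsilon>"
        using u f_pos[of "min (len g) (len h)"] by (simp add: dist_real_def field_simps)
      moreover have "edge_point g h t \<in> X" "edge_point g h u \<in> X"
        using closed_edge_in[OF gh] t u by (auto simp: closed_edge_def)
      ultimately show ?thesis using dist[of t u] t u by auto
    qed
    moreover have "openin (top_of_set {0..1}) ?U" "t \<in> ?U"
      using t \<open>\<epsilon> > 0\<close> f_pos by auto
    ultimately show "\<exists>U. openin (top_of_set {0..1}) U \<and> t \<in> U \<and>
        (\<forall>u\<in>U. edge_point g h u \<in> fl.mball (edge_point g h t) \<epsilon>)" by blast
  qed
  moreover have "compactin (top_of_set {0..1}) {0..1::real}"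
    by (simp add: compactin_subtopology)
  ultimately show ?thesis unfolding closed_edge_def by (rule image_compactin[rotated])
qed

text \<open>A Cauchy sequence defining a boundary point cannot keep visiting the finitely many edges near
  a ball, as their union is compact. Points on the other edges are close to far vertices.\<close>

lemma boundary_approx:
  assumes \<xi>: "\<xi> \<in> boundary" and "\<epsilon> > 0"
  shows "\<exists>g\<in>carrier G. N < len g \<and> cdist \<xi> (emb g) < \<epsilon>"
proof -
  obtain N' where N': "f N' < \<epsilon> / 2" "N \<le> N'"
  proof -
    have "\<forall>\<^sub>F n in sequentially. f n < \<epsilon> / 2" by (rule order_tendstoD(2)[OF f_tendsto_0]) (use \<open>\<epsilon> > 0\<close> in simp)
    then show ?thesis using that eventually_happens[OF eventually_conj[OF _ eventually_ge_at_top[of N]]]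
      by (metis trivial_limit_sequentially)
  qed
  obtain \<sigma> where \<sigma>: "fl.MCauchy \<sigma>" "\<xi> = cauchy_equiv X fdist `` {\<sigma>}"
    using fl.completion_obtain_rep \<xi> by blast
  let ?B = "{g \<in> carrier G. len g \<le> N'}"
  define E where "E = {(g, h). (g, h) \<in> edges \<and> min (len g) (len h) \<le> N'}"
  define K where "K = vert ` ?B \<union> (\<Union>(g, h)\<in>E. closed_edge g h)"
  have "finite E"
  proof (rule finite_subset)
    show "E \<subseteq> {g \<in> carrier G. len g \<le> Suc N'} \<times> {g \<in> carrier G. len g \<le> Suc N'}"
    proof
      fix e assume "e \<in> E"
      then obtain g h where e: "e = (g, h)" "(g, h) \<in> edges" "min (len g) (len h) \<le> N'"
        by (auto simp: E_def)
      then have "len h \<le> len g + 1" "len g \<le> len h + 1" "g \<in> carrier G" "h \<in> carrier G"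
        using len_path[of g h 1] edges_carrier by auto
      then show "e \<in> {g \<in> carrier G. len g \<le> Suc N'} \<times> {g \<in> carrier G. len g \<le> Suc N'}"
        using e by auto
    qed
  qed (use finite_ball in simp)
  have "compactin fl.mtopology (\<Union>(g, h)\<in>E. closed_edge g h)"
    using \<open>finite E\<close> compact_closed_edge by (intro compactin_Union) (auto simp: E_def)
  moreover have "compactin fl.mtopology (vert ` ?B)"
    using finite_ball vert_in by (intro finite_imp_compactin) auto
  ultimately have K: "compactin fl.mtopology K" unfolding K_def by (intro compactin_Un)
  have "\<forall>\<^sub>F n in sequentially. \<sigma> n \<notin> K"
  proof (rule ccontr)
    assume "\<not> (\<forall>\<^sub>F n in sequentially. \<sigma> n \<notin> K)"
    then have "\<exists>\<^sub>F n in sequentially. \<sigma> n \<in> K" by (simp add: not_eventually)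
    then have "infinite {n. \<sigma> n \<in> K}" by (simp add: frequently_cofinite[symmetric] cofinite_eq_sequentially)
    then obtain r :: "nat \<Rightarrow> nat" where r: "strict_mono r" "\<And>n. \<sigma> (r n) \<in> K"
      using infinite_enumerate by blast
    then have "range (\<sigma> \<circ> r) \<subseteq> K" by auto
    then obtain p s where p: "p \<in> K" "strict_mono s" "limitin fl.mtopology (\<sigma> \<circ> r \<circ> s) p sequentially"
      using K unfolding fl.compactin_sequentially by metis
    then have "limitin fl.mtopology \<sigma> p sequentially"
      using fl.MCauchy_convergent_subsequence[OF \<sigma>(1), of "r \<circ> s" p] r strict_mono_o
      by (metis comp_assoc)
    then have "p \<in> X" "(\<lambda>n. fdist (\<sigma> n) p) \<longlonglongrightarrow> 0"
      by (simp_all add: fl.limitin_metric_dist_null)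
    then have "(\<sigma>, \<lambda>_. p) \<in> cauchy_equiv X fdist"
      using \<sigma>(1) fl.MCauchy_const by (simp add: cauchy_equiv_def)
    then have "\<xi> = completion_embed X fdist p"
      unfolding \<sigma>(2) completion_embed_def by (rule equiv_class_eq[OF fl.equiv_cauchy_equiv])
    then show False using \<xi> \<open>p \<in> X\<close> by blast
  qed
  moreover have "\<forall>\<^sub>F n in sequentially. cdist \<xi> (completion_embed X fdist (\<sigma> n)) < \<epsilon> / 2"
    unfolding \<sigma>(2) by (rule order_tendstoD(2)[OF fl.completion_embed_tendsto[OF \<sigma>(1)]])
      (use \<open>\<epsilon> > 0\<close> in simp)
  ultimately have "\<forall>\<^sub>F n in sequentially. \<sigma> n \<notin> K \<and> cdist \<xi> (completion_embed X fdist (\<sigma> n)) < \<epsilon> / 2"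
    by (rule eventually_conj)
  from eventually_happens'[OF sequentially_bot this]
  obtain n where n: "\<sigma> n \<notin> K" "cdist \<xi> (completion_embed X fdist (\<sigma> n)) < \<epsilon> / 2"
    by blast
  have \<sigma>X: "\<sigma> n \<in> X" by (rule fl.MCauchy_in[OF \<sigma>(1)])
  have "\<exists>g\<in>carrier G. N' < len g \<and> fdist (\<sigma> n) (vert g) \<le> f N'"
  proof -
    consider g where "g \<in> carrier G" "\<sigma> n = vert g"
      | g h where "(g, h) \<in> edges" "\<sigma> n \<in> closed_edge g h"
      using \<sigma>X closed_edge_same unfolding cayley_space_def by blast
    then show ?thesis
    proof cases
      case 1
      then have "N' < len g" using n(1) by (force simp: K_def)
      then show ?thesis using 1 fl.mdist_zero vert_in f_pos less_imp_le by metis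
    next
      case 2
      then have "(g, h) \<notin> E" using n(1) by (auto simp: K_def)
      then have m: "N' < min (len g) (len h)" using 2(1) by (simp only: E_def mem_Collect_eq prod.case not_le simp_thms)
      obtain t where t: "t \<in> {0..1}" "\<sigma> n = edge_point g h t" using 2 by (auto simp: closed_edge_def)
      have "fdist (\<sigma> n) (vert g) \<le> f (min (len g) (len h)) * \<bar>\<sigma> n h - vert g h\<bar>"
        by (rule fdist_closed_edge[OF 2 vert_closed_edge(1)])
      also have "\<dots> \<le> f N' * 1"
        using m t f_antimono[of N' "min (len g) (len h)"] f_pos edges_carrier[OF 2(1)]
        by (intro mult_mono) (auto simp: edge_point_def vert_apply less_imp_le)
      finally show ?thesis using m edges_carrier[OF 2(1)] by auto
    qed
  qed
  then obtain g where g: "g \<in> carrier G" "N' < len g" "fdist (\<sigma> n) (vert g) \<le> f N'" by blast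
  have "cdist \<xi> (emb g) \<le> cdist \<xi> (completion_embed X fdist (\<sigma> n)) + cdist (completion_embed X fdist (\<sigma> n)) (emb g)"
    using \<xi> g \<sigma>X by (intro co.triangle emb_in fl.completion_embed_in) auto
  also have "cdist (completion_embed X fdist (\<sigma> n)) (emb g) = fdist (\<sigma> n) (vert g)"
    unfolding emb_def by (intro fl.completion_embed_isometric vert_in g \<sigma>X)
  finally show ?thesis using g N' n by (intro bexI[of _ g]) auto
qed

lemma boundary_vconv:
  assumes "\<xi> \<in> boundary"
  shows "\<exists>\<sigma>. vconv \<sigma> \<xi>"
proof -
  have "\<exists>g\<in>carrier G. cdist \<xi> (emb g) < inverse (real (Suc n))" for n
    using boundary_approx[OF assms, of "inverse (real (Suc n))"] by auto
  then obtain \<sigma> where \<sigma>: "\<And>n. \<sigma> n \<in> carrier G"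
    "\<And>n. cdist \<xi> (emb (\<sigma> n)) < inverse (real (Suc n))" by metis
  have "(\<lambda>n. cdist \<xi> (emb (\<sigma> n))) \<longlonglongrightarrow> 0"
    by (rule tendsto_sandwich[OF _ _ tendsto_const LIMSEQ_inverse_real_of_nat])
      (use less_imp_le[OF \<sigma>(2)] in auto)
  then show ?thesis using \<sigma>(1) by (auto simp: vconv_def)
qed

lemma compact_boundary: "compact_space bd"
proof -
  have "compactin co.mtopology boundary"
    unfolding co.compactin_sequentially
  proof (intro conjI allI impI)
    fix \<xi> :: "nat \<Rightarrow> (nat \<Rightarrow> 'g \<Rightarrow> real) set" assume \<xi>: "range \<xi> \<subseteq> boundary"
    have "\<exists>g\<in>carrier G. n < len g \<and> cdist (\<xi> n) (emb g) < inverse (real (Suc n))" for n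
      using \<xi> by (intro boundary_approx) auto
    then obtain \<sigma> where \<sigma>: "\<And>n. \<sigma> n \<in> carrier G" "\<And>n. n < len (\<sigma> n)"
      "\<And>n. cdist (\<xi> n) (emb (\<sigma> n)) < inverse (real (Suc n))" by metis
    have "filterlim (\<lambda>n. len (\<sigma> n)) at_top sequentially"
      by (rule filterlim_at_top_mono[OF filterlim_ident]) (use less_imp_le[OF \<sigma>(2)] in auto)
    then obtain r \<eta> where r: "strict_mono r" "\<eta> \<in> boundary" "vconv (\<sigma> \<circ> r) \<eta>"
      using escaping_vertices_accumulate[of \<sigma>] \<sigma> by blast
    have "(\<lambda>n. inverse (real (Suc (r n))) + cdist \<eta> (emb (\<sigma> (r n)))) \<longlonglongrightarrow> 0"
      using tendsto_add[OF LIMSEQ_subseq_LIMSEQ[OF LIMSEQ_inverse_real_of_nat r(1)], of _ 0] r(3)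
      by (simp add: vconv_def o_def)
    moreover have "cdist (\<xi> (r n)) \<eta> \<le> inverse (real (Suc (r n))) + cdist \<eta> (emb (\<sigma> (r n)))" for n
    proof -
      have "\<xi> (r n) \<in> boundary" using \<xi> by blast
      then have "cdist (\<xi> (r n)) \<eta> \<le> cdist (\<xi> (r n)) (emb (\<sigma> (r n))) + cdist (emb (\<sigma> (r n))) \<eta>"
        using r(2) \<sigma>(1) by (intro co.triangle emb_in) auto
      then show ?thesis using \<sigma>(3)[of "r n"] by (simp add: co.commute)
    qed
    ultimately have "(\<lambda>n. cdist (\<xi> (r n)) \<eta>) \<longlonglongrightarrow> 0"
      by (rule_tac tendsto_sandwich[OF _ _ tendsto_const]) auto
    then have "limitin co.mtopology (\<xi> \<circ> r) \<eta> sequentially"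
      using range_subsetD[OF \<xi>] r(2) by (simp add: co.limitin_metric_dist_null o_def)
    then show "\<exists>\<eta> r. \<eta> \<in> boundary \<and> strict_mono r \<and> limitin co.mtopology (\<xi> \<circ> r) \<eta> sequentially"
      using r by blast
  qed auto
  then show ?thesis
    by (simp add: floyd_boundary_def Let_def completion_topology_def compact_space_subtopology)
qed

lemma openin_bd: "openin bd U \<longleftrightarrow> U \<subseteq> boundary \<and> (\<forall>\<xi>\<in>U. \<exists>e>0. \<forall>\<eta>\<in>boundary. cdist \<xi> \<eta> < e \<longrightarrow> \<eta> \<in> U)"
proof -
  have "bdm.sub.mball \<xi> e \<subseteq> U \<longleftrightarrow> (\<forall>\<eta>\<in>boundary. cdist \<xi> \<eta> < e \<longrightarrow> \<eta> \<in> U)" if "\<xi> \<in> boundary" for \<xi> e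
    using that unfolding subset_iff bdm.sub.in_mball by blast
  then show ?thesis
    unfolding floyd_boundary_eq bdm.sub.openin_mtopology by (meson subsetD)
qed

subsection \<open>The clopen sets cut out by almost invariant sets\<close>

definition shadow :: "'g set \<Rightarrow> (nat \<Rightarrow> 'g \<Rightarrow> real) set set" where
  "shadow D = {\<xi> \<in> boundary. \<forall>e>0. \<exists>g\<in>D. cdist \<xi> (emb g) < e}"

text \<open>All vertices close enough to a boundary point are on the same side of \<open>D\<close>, and how close is enough depends
  on the distance between \<open>D\<close> and its complement only.\<close>

lemma shadow_uniform:
  assumes D: "almost_invariant G D"
  shows "\<exists>c>0. \<forall>\<xi>\<in>boundary. \<forall>g\<in>carrier G. cdist \<xi> (emb g) < c \<longrightarrow> (g \<in> D \<longleftrightarrow> \<xi> \<in> shadow D)"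
proof -
  have sub: "D \<subseteq> carrier G" using D by (simp add: almost_invariant_def)
  obtain c where c: "c > 0" "\<And>u v. u \<in> D \<Longrightarrow> v \<in> carrier G - D \<Longrightarrow> c \<le> vdist u v"
    using vdist_separated[OF D] by blast
  have "g \<in> D \<longleftrightarrow> \<xi> \<in> shadow D" if \<xi>: "\<xi> \<in> boundary" and g: "g \<in> carrier G" "cdist \<xi> (emb g) < c / 2" for \<xi> g
  proof -
    have same: "h \<in> D \<longleftrightarrow> g \<in> D" if "h \<in> carrier G" "cdist \<xi> (emb h) < c / 2" for h
      using vdist_le_cdist[of h g \<xi>] vdist_le_cdist[of g h \<xi>] c(2)[of g h] c(2)[of h g] that \<xi> g by force
    show ?thesis
    proof
      assume "g \<in> D"
      have "\<exists>h\<in>D. cdist \<xi> (emb h) < e" if "e > 0" for e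
        using boundary_approx[OF \<xi>, of "min e (c / 2)"] same \<open>g \<in> D\<close> c(1) that by auto
      then show "\<xi> \<in> shadow D" using \<xi> by (simp add: shadow_def)
    next
      assume "\<xi> \<in> shadow D"
      then obtain h where "h \<in> D" "cdist \<xi> (emb h) < c / 2"
        using c(1) by (auto simp: shadow_def dest: spec[of _ "c / 2"])
      then show "g \<in> D" using same sub by blast
    qed
  qed
  then show ?thesis using c(1) by (intro exI[of _ "c / 2"]) auto
qed

lemma shadow_vconv:
  assumes "almost_invariant G D" "\<xi> \<in> boundary" "vconv \<sigma> \<xi>"
  shows "\<forall>\<^sub>F n in sequentially. \<sigma> n \<in> D \<longleftrightarrow> \<xi> \<in> shadow D"
proof -
  obtain c where c: "c > 0"
    "\<And>\<xi> g. \<xi> \<in> boundary \<Longrightarrow> g \<in> carrier G \<Longrightarrow> cdist \<xi> (emb g) < c \<Longrightarrow> (g \<in> D \<longleftrightarrow> \<xi> \<in> shadow D)"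
    using shadow_uniform[OF assms(1)] by blast
  have "\<forall>\<^sub>F n in sequentially. cdist \<xi> (emb (\<sigma> n)) < c"
    using assms(3) c(1) order_tendstoD(2) by (auto simp: vconv_def)
  then show ?thesis
    by (rule eventually_mono) (use assms c(2) in \<open>auto simp: vconv_def\<close>)
qed

lemma shadow_clopen:
  assumes D: "almost_invariant G D"
  shows "openin bd (shadow D)" "closedin bd (shadow D)"
proof -
  obtain c where c: "c > 0"
    "\<And>\<xi> g. \<xi> \<in> boundary \<Longrightarrow> g \<in> carrier G \<Longrightarrow> cdist \<xi> (emb g) < c \<Longrightarrow> (g \<in> D \<longleftrightarrow> \<xi> \<in> shadow D)"
    using shadow_uniform[OF D] by blast
  have loc: "\<xi> \<in> shadow D \<longleftrightarrow> \<eta> \<in> shadow D"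
    if \<xi>\<eta>: "\<xi> \<in> boundary" "\<eta> \<in> boundary" "cdist \<xi> \<eta> < c / 2" for \<xi> \<eta>
  proof -
    obtain g where g: "g \<in> carrier G" "cdist \<xi> (emb g) < c / 2"
      using boundary_approx[OF \<xi>\<eta>(1), of "c / 2"] c(1) by auto
    have "cdist \<eta> (emb g) \<le> cdist \<eta> \<xi> + cdist \<xi> (emb g)"
      using \<xi>\<eta> g by (intro co.triangle emb_in) auto
    then have "cdist \<eta> (emb g) < c" "cdist \<xi> (emb g) < c"
      using g \<xi>\<eta> c(1) by (auto simp: co.commute)
    then show ?thesis using c(2) g \<xi>\<eta> by blast
  qed
  have sub: "shadow D \<subseteq> boundary" by (auto simp: shadow_def)
  have half: "0 < c / 2" using c(1) by simp
  have "\<forall>\<eta>\<in>boundary. cdist \<xi> \<eta> < c / 2 \<longrightarrow> \<eta> \<in> shadow D" if "\<xi> \<in> shadow D" for \<xi>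
    using loc sub that by blast
  then show "openin bd (shadow D)" using sub half unfolding openin_bd by blast
  have "\<forall>\<eta>\<in>boundary. cdist \<xi> \<eta> < c / 2 \<longrightarrow> \<eta> \<in> boundary - shadow D" if "\<xi> \<in> boundary - shadow D" for \<xi>
    using loc that by blast
  then have "openin bd (boundary - shadow D)" using half unfolding openin_bd by blast
  then show "closedin bd (shadow D)" using sub by (simp add: closedin_def topspace_bd)
qed

end

section \<open>Quasi-trees of almost invariant sets\<close>

text \<open>
  A finiteness condition expressing that the group looks like a tree: every element \<open>g \<noteq> \<one>\<close> is joined to
  \<open>\<one>\<close> by a chain with steps in a finite set \<open>F\<close>, and each point \<open>m\<close> of the chain is a bottleneck
  between \<open>\<one>\<close> and \<open>g\<close>, since a translate by \<open>m\<close> of one of finitely many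
  almost invariant sets separates the two. The points of the chain from \<open>x\<close> to \<open>y\<close>,
  obtained by left translation, are bottlenecks between \<open>x\<close> and \<open>y\<close>.
\<close>

definition bottlenecks :: "('g, 'm) monoid_scheme \<Rightarrow> 'g set set \<Rightarrow> 'g \<Rightarrow> 'g set" where
  "bottlenecks G \<E> g =
     {m \<in> carrier G. \<exists>E\<in>\<E>. (inv\<^bsub>G\<^esub> m \<in> E) \<noteq> (inv\<^bsub>G\<^esub> m \<otimes>\<^bsub>G\<^esub> g \<in> E)}"

definition chain_steps :: "('g, 'm) monoid_scheme \<Rightarrow> 'g set \<Rightarrow> 'g set set \<Rightarrow> 'g \<Rightarrow> ('g \<times> 'g) set" where
  "chain_steps G F \<E> g =
     {(m, m'). m \<in> bottlenecks G \<E> g \<and> m' \<in> bottlenecks G \<E> g \<and> inv\<^bsub>G\<^esub> m \<otimes>\<^bsub>G\<^esub> m' \<in> F}"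

definition quasi_tree :: "('g, 'm) monoid_scheme \<Rightarrow> 'g set \<Rightarrow> 'g set set \<Rightarrow> bool" where
  "quasi_tree G F \<E> \<longleftrightarrow> finite F \<and> F \<subseteq> carrier G \<and> finite \<E> \<and> (\<forall>E\<in>\<E>. almost_invariant G E) \<and>
     (\<forall>g\<in>carrier G. (\<one>\<^bsub>G\<^esub>, g) \<in> (chain_steps G F \<E> g)\<^sup>*)"

context floyd_graph
begin

text \<open>The point \<open>q\<close> is within distance \<open>K\<close> of a geodesic from \<open>\<one>\<close> to \<open>x\<close>. The equation for the lengths says that
  \<open>z\<close> lies on such a geodesic.\<close>

definition descends_near :: "nat \<Rightarrow> 'g \<Rightarrow> 'g \<Rightarrow> bool" where
  "descends_near K x q \<longleftrightarrow>
     (\<exists>z\<in>carrier G. (\<exists>k. (z, x) \<in> edges ^^ k \<and> len x = len z + k) \<and> (\<exists>k\<le>K. (q, z) \<in> edges ^^ k))"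

lemma vdist_descends_near:
  assumes "descends_near K x q" "x \<in> carrier G" "q \<in> carrier G" "R \<le> len q"
  shows "vdist q x \<le> K * f (R - K) + tail (R - K)"
proof -
  obtain z k j where z: "z \<in> carrier G" "(z, x) \<in> edges ^^ k" "len x = len z + k" "j \<le> K" "(q, z) \<in> edges ^^ j"
    using assms by (auto simp: descends_near_def)
  have "len q \<le> len z + j" using len_path z assms by blast
  then have "tail (len z) \<le> tail (R - K)" using z assms by (intro tail_antimono) linarith
  moreover have "vdist z x \<le> tail (len z)" using vdist_geodesic z by blast
  moreover have "vdist q z \<le> K * f (R - K)" using vdist_near z assms by blast
  moreover have "vdist q x \<le> vdist q z + vdist z x" using vdist_triangle z assms by blast
  ultimately show ?thesis by linarith
qed

lemma bottleneck_separates: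
  assumes m: "m \<in> bottlenecks G \<E> (inv x \<otimes> y)" and xy: "x \<in> carrier G" "y \<in> carrier G"
    and \<E>: "\<And>E. E \<in> \<E> \<Longrightarrow> E \<subseteq> carrier G"
  shows "\<exists>E\<in>\<E>. (x \<in> (x \<otimes> m) <# E) \<noteq> (y \<in> (x \<otimes> m) <# E)"
proof -
  obtain E where E: "E \<in> \<E>" "(inv m \<in> E) \<noteq> (inv m \<otimes> (inv x \<otimes> y) \<in> E)" and mc: "m \<in> carrier G"
    using m by (auto simp: bottlenecks_def)
  have "inv (x \<otimes> m) \<otimes> x = inv m" "inv (x \<otimes> m) \<otimes> y = inv m \<otimes> (inv x \<otimes> y)"
    using xy mc by (simp_all add: inv_mult_group m_assoc)
  then show ?thesis
    using E l_coset_iff[OF _ \<E>[OF E(1)]] xy mc by (intro bexI[of _ E]) auto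
qed

text \<open>
  Suppose that no separating translate is centred near \<open>\<one>\<close>, so that the whole chain from \<open>x\<close> to \<open>y\<close>
  is far away. A translate that separates \<open>x\<close> from \<open>y\<close> also separates one of them from \<open>\<one>\<close>, so
  each point of the chain is near a geodesic from \<open>\<one>\<close> to \<open>x\<close> or to \<open>y\<close>. Where the chain
  changes from the one to the other, there is a short path from \<open>x\<close> to \<open>y\<close>: down the
  first geodesic, across, and up the second one, all of it far from \<open>\<one>\<close>.
\<close>

lemma close_unless_separated:
  assumes qt: "quasi_tree G F \<E>" and "\<epsilon> > 0"
  shows "\<exists>B. finite B \<and> B \<subseteq> carrier G \<and> (\<forall>x\<in>carrier G. \<forall>y\<in>carrier G.
           (\<forall>m\<in>B. \<forall>E\<in>\<E>. x \<in> m <# E \<longleftrightarrow> y \<in> m <# E) \<longrightarrow> vdist x y < \<epsilon>)"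
proof -
  have fin: "finite F" "F \<subseteq> carrier G" "finite \<E>" and ai: "\<And>E. E \<in> \<E> \<Longrightarrow> almost_invariant G E"
    and chain: "\<And>g. g \<in> carrier G \<Longrightarrow> (\<one>, g) \<in> (chain_steps G F \<E> g)\<^sup>*"
    using qt by (auto simp: quasi_tree_def)
  have sub: "E \<subseteq> carrier G" if "E \<in> \<E>" for E using ai[OF that] by (simp add: almost_invariant_def)
  have "finite (len ` (\<Union>E\<in>\<E>. frontier_verts E))" using fin ai finite_frontier_verts by blast
  then obtain K where K: "\<And>E z. E \<in> \<E> \<Longrightarrow> z \<in> frontier_verts E \<Longrightarrow> len z \<le> K"
    unfolding finite_nat_set_iff_bounded_le by blast
  have "finite (len ` F)" using fin by blast
  then obtain c where c: "\<And>s. s \<in> F \<Longrightarrow> len s \<le> c"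
    unfolding finite_nat_set_iff_bounded_le by blast
  define b where "b R = c * f (R - c) + 2 * (K * f (R - K) + tail (R - K))" for R
  have sh: "filterlim (\<lambda>R. R - k) sequentially sequentially" for k :: nat
    by (rule filterlim_minus_const_nat_at_top)
  have "(\<lambda>R. c * f (R - c) + 2 * (K * f (R - K) + tail (R - K))) \<longlonglongrightarrow> real c * 0 + 2 * (real K * 0 + 0)"
    by (intro tendsto_intros filterlim_compose[OF f_tendsto_0 sh] filterlim_compose[OF tail_tendsto_0 sh])
  then have "b \<longlonglongrightarrow> 0" by (simp add: b_def[abs_def])
  then have "\<forall>\<^sub>F R in sequentially. b R < \<epsilon>" using \<open>\<epsilon> > 0\<close> by (rule order_tendstoD(2))
  from eventually_happens'[OF sequentially_bot this] obtain R where R: "b R < \<epsilon>" by blast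
  let ?B = "{g \<in> carrier G. len g \<le> R}"
  have "vdist x y < \<epsilon>"
    if xy: "x \<in> carrier G" "y \<in> carrier G" and ns: "\<forall>m\<in>?B. \<forall>E\<in>\<E>. x \<in> m <# E \<longleftrightarrow> y \<in> m <# E" for x y
  proof (cases "x = y")
    case True
    then show ?thesis using \<open>\<epsilon> > 0\<close> fl.mdist_zero vert_in xy by simp
  next
    case False
    define w where "w = inv x \<otimes> y"
    have w: "w \<in> carrier G" "x \<otimes> w = y" using xy by (simp_all add: w_def m_assoc[symmetric])
    have "w \<noteq> \<one>" using False w xy by auto
    let ?r = "chain_steps G F \<E> w"
    have bn: "m \<in> carrier G" "R \<le> len (x \<otimes> m)" "descends_near K x (x \<otimes> m) \<or> descends_near K y (x \<otimes> m)"
      if m: "m \<in> bottlenecks G \<E> w" for m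
    proof -
      show mc: "m \<in> carrier G" using m by (simp add: bottlenecks_def)
      obtain E where E: "E \<in> \<E>" "(x \<in> (x \<otimes> m) <# E) \<noteq> (y \<in> (x \<otimes> m) <# E)"
        using bottleneck_separates[OF m[unfolded w_def] xy sub] by blast
      have xm: "x \<otimes> m \<in> carrier G" using xy mc by simp
      show "R \<le> len (x \<otimes> m)"
      proof (rule ccontr)
        assume "\<not> R \<le> len (x \<otimes> m)"
        then have "x \<otimes> m \<in> ?B" using xm by simp
        then show False using ns E by blast
      qed
      show "descends_near K x (x \<otimes> m) \<or> descends_near K y (x \<otimes> m)"
      proof (cases "(\<one> \<in> (x \<otimes> m) <# E) \<noteq> (x \<in> (x \<otimes> m) <# E)")
        case True
        then show ?thesis
          using geodesic_crosses_near[OF ai[OF E(1)] K[OF E(1)] xm xy(1)] by (simp only: descends_near_def simp_thms)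
      next
        case False
        then have "(\<one> \<in> (x \<otimes> m) <# E) \<noteq> (y \<in> (x \<otimes> m) <# E)" using E(2) by simp
        then show ?thesis
          using geodesic_crosses_near[OF ai[OF E(1)] K[OF E(1)] xm xy(2)] by (simp only: descends_near_def simp_thms)
      qed
    qed
    have refl: "descends_near K z z" if "z \<in> carrier G" for z
      unfolding descends_near_def using that by (intro bexI[of _ z] conjI exI[of _ 0]) auto
    have last: "w \<in> bottlenecks G \<E> w"
      using chain[OF w(1)] \<open>w \<noteq> \<one>\<close> by (auto elim!: rtranclE simp: chain_steps_def)
    have "\<exists>m m'. m \<in> bottlenecks G \<E> w \<and> m' \<in> bottlenecks G \<E> w \<and> descends_near K x (x \<otimes> m) \<and>
        descends_near K y (x \<otimes> m') \<and> (\<exists>k\<le>c. (x \<otimes> m, x \<otimes> m') \<in> edges ^^ k)"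
    proof (cases "descends_near K x (x \<otimes> w)")
      case True
      then have "w \<in> bottlenecks G \<E> w \<and> w \<in> bottlenecks G \<E> w \<and> descends_near K x (x \<otimes> w) \<and>
        descends_near K y (x \<otimes> w) \<and> (\<exists>k\<le>c. (x \<otimes> w, x \<otimes> w) \<in> edges ^^ k)"
        using last refl xy w by (auto intro!: exI[of _ "0::nat"])
      then show ?thesis by blast
    next
      case False
      obtain n where "(\<one>, w) \<in> ?r ^^ n" using chain[OF w(1)] by (auto simp: rtrancl_power)
      moreover have "descends_near K x (x \<otimes> \<one>)" using refl xy by simp
      ultimately obtain m m' where m: "(m, m') \<in> ?r" "descends_near K x (x \<otimes> m) \<noteq> descends_near K x (x \<otimes> m')"
        using relpow_crossing[where a = \<one> and b = w and r = ?r and P = "\<lambda>m. descends_near K x (x \<otimes> m)"] False by blast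
      then have bm: "m \<in> bottlenecks G \<E> w" "m' \<in> bottlenecks G \<E> w" "inv m \<otimes> m' \<in> F"
        by (auto simp: chain_steps_def)
      have mc: "m \<in> carrier G" "m' \<in> carrier G" using bm bn(1) by blast+
      have "(x \<otimes> m, x \<otimes> m') \<in> edges ^^ len (inv m \<otimes> m')"
      proof -
        have "m \<otimes> (inv m \<otimes> m') = m'" using mc by (simp add: m_assoc[symmetric])
        then have "x \<otimes> m \<otimes> (inv m \<otimes> m') = x \<otimes> m'" using mc xy by (simp add: m_assoc)
        then show ?thesis
          using path_left_mult[OF path_wdist[OF one_closed, of "inv m \<otimes> m'"], of "x \<otimes> m"] mc xy by simp
      qed
      then have step: "\<exists>k\<le>c. (x \<otimes> m, x \<otimes> m') \<in> edges ^^ k" "\<exists>k\<le>c. (x \<otimes> m', x \<otimes> m) \<in> edges ^^ k"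
        using c[OF bm(3)] path_sym by blast+
      show ?thesis using m(2) bm(1,2) bn(3)[OF bm(1)] bn(3)[OF bm(2)] step by blast
    qed
    then obtain m m' k where m: "m \<in> bottlenecks G \<E> w" "m' \<in> bottlenecks G \<E> w" "descends_near K x (x \<otimes> m)"
        "descends_near K y (x \<otimes> m')" "k \<le> c" "(x \<otimes> m, x \<otimes> m') \<in> edges ^^ k" by blast
    have car: "x \<otimes> m \<in> carrier G" "x \<otimes> m' \<in> carrier G" using bn m xy by simp_all
    have "vdist x y \<le> vdist x (x \<otimes> m) + (vdist (x \<otimes> m) (x \<otimes> m') + vdist (x \<otimes> m') y)"
      using vdist_triangle[of x "x \<otimes> m" y] vdist_triangle[of "x \<otimes> m" "x \<otimes> m'" y] car xy by linarith
    also have "\<dots> \<le> b R"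
      using vdist_descends_near[OF m(3) xy(1) car(1) bn(2)[OF m(1)]]
        vdist_descends_near[OF m(4) xy(2) car(2) bn(2)[OF m(2)]]
        vdist_near[OF m(6) car(1) m(5) bn(2)[OF m(1)]]
      by (simp add: b_def fl.commute)
    finally show ?thesis using R by simp
  qed
  then show ?thesis using finite_ball by (intro exI[of _ ?B]) auto
qed

text \<open>Vertices that converge to different boundary points keep a positive distance, so that they are separated by one of
  finitely many translates; if no shadow of these separated the boundary points, the
  vertices would finally be on the same side of each of them.\<close>

lemma shadows_separate:
  assumes qt: "quasi_tree G F \<E>" and bd: "\<xi> \<in> boundary" "\<eta> \<in> boundary" "\<xi> \<noteq> \<eta>"
  shows "\<exists>m\<in>carrier G. \<exists>E\<in>\<E>. (\<xi> \<in> shadow (m <# E)) \<noteq> (\<eta> \<in> shadow (m <# E))"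
proof (rule ccontr)
  assume contra: "\<not> ?thesis"
  define \<epsilon> where "\<epsilon> = cdist \<xi> \<eta> / 2"
  have in_co: "\<xi> \<in> cauchy_completion X fdist" "\<eta> \<in> cauchy_completion X fdist" using bd by auto
  have "\<epsilon> > 0" using bd in_co by (simp add: \<epsilon>_def)
  then obtain B where B: "finite B" "B \<subseteq> carrier G"
    "\<And>x y. x \<in> carrier G \<Longrightarrow> y \<in> carrier G \<Longrightarrow> \<forall>m\<in>B. \<forall>E\<in>\<E>. x \<in> m <# E \<longleftrightarrow> y \<in> m <# E \<Longrightarrow> vdist x y < \<epsilon>"
    using close_unless_separated[OF qt] by metis
  obtain \<sigma> \<tau> where \<sigma>: "vconv \<sigma> \<xi>" and \<tau>: "vconv \<tau> \<eta>" using boundary_vconv bd by meson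
  have "\<forall>\<^sub>F n in sequentially. \<forall>m\<in>B. \<forall>E\<in>\<E>. \<sigma> n \<in> m <# E \<longleftrightarrow> \<tau> n \<in> m <# E"
  proof (intro eventually_ball_finite ballI)
    fix m E assume mE: "m \<in> B" "E \<in> \<E>"
    then have ai: "almost_invariant G (m <# E)"
      using qt B(2) almost_invariant_l_coset by (auto simp: quasi_tree_def)
    show "\<forall>\<^sub>F n in sequentially. \<sigma> n \<in> m <# E \<longleftrightarrow> \<tau> n \<in> m <# E"
      using shadow_vconv[OF ai bd(1) \<sigma>] shadow_vconv[OF ai bd(2) \<tau>]
      by eventually_elim (use contra mE B(2) in blast)
  qed (use B qt in \<open>auto simp: quasi_tree_def\<close>)
  moreover have "\<forall>\<^sub>F n in sequentially. cdist \<xi> (emb (\<sigma> n)) < \<epsilon> / 2" "\<forall>\<^sub>F n in sequentially. cdist \<eta> (emb (\<tau> n)) < \<epsilon> / 2"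
    using \<sigma> \<tau> \<open>\<epsilon> > 0\<close> unfolding vconv_def by (auto intro!: order_tendstoD(2)[of _ 0])
  ultimately have "\<forall>\<^sub>F n in sequentially. False"
  proof eventually_elim
    case (elim n)
    have car: "\<sigma> n \<in> carrier G" "\<tau> n \<in> carrier G" using \<sigma> \<tau> by (auto simp: vconv_def)
    have "vdist (\<sigma> n) (\<tau> n) < \<epsilon>" using B(3)[OF car] elim by blast
    moreover have "cdist \<xi> \<eta> \<le> cdist \<xi> (emb (\<sigma> n)) + cdist (emb (\<sigma> n)) \<eta>"
      "cdist (emb (\<sigma> n)) \<eta> \<le> cdist (emb (\<sigma> n)) (emb (\<tau> n)) + cdist (emb (\<tau> n)) \<eta>"
      using car in_co emb_in by (auto intro!: co.triangle)
    ultimately show ?case using elim cdist_emb[OF car] by (simp add: co.commute \<epsilon>_def)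
  qed
  then show False by simp
qed

text \<open>
  A boundary point is close to a far vertex \<open>x\<close>, and the whole cone at \<open>x\<close> is then close to \<open>x\<close>,
  as otherwise one of finitely many almost invariant sets would cut it, which happens for finitely
  many \<open>x\<close> only. The cone accumulates at two different boundary points.
\<close>

lemma boundary_perfect:
  assumes qt: "quasi_tree G F \<E>"
    and C: "\<And>x. x \<in> carrier G \<Longrightarrow> C x \<subseteq> carrier G"
    and uncut: "\<And>D. almost_invariant G D \<Longrightarrow> finite {x \<in> carrier G. \<exists>y\<in>C x. (x \<in> D) \<noteq> (y \<in> D)}"
    and branch: "\<And>x. x \<in> carrier G \<Longrightarrow>
      \<exists>D. almost_invariant G D \<and> infinite (C x \<inter> D) \<and> infinite (C x - D)"
    and \<xi>: "\<xi> \<in> boundary"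
  shows "\<not> openin bd {\<xi>}"
proof
  assume "openin bd {\<xi>}"
  then obtain e where e: "e > 0" "\<And>\<eta>. \<eta> \<in> boundary \<Longrightarrow> cdist \<xi> \<eta> < e \<Longrightarrow> \<eta> = \<xi>"
    by (auto simp: openin_bd)
  then obtain B where B: "finite B" "B \<subseteq> carrier G"
    "\<And>x y. x \<in> carrier G \<Longrightarrow> y \<in> carrier G \<Longrightarrow> \<forall>m\<in>B. \<forall>E\<in>\<E>. x \<in> m <# E \<longleftrightarrow> y \<in> m <# E \<Longrightarrow> vdist x y < e / 4"
    using close_unless_separated[OF qt, of "e / 4"] by (metis divide_pos_pos zero_less_numeral)
  define Bad where "Bad = (\<Union>m\<in>B. \<Union>E\<in>\<E>. {x \<in> carrier G. \<exists>y\<in>C x. (x \<in> m <# E) \<noteq> (y \<in> m <# E)})"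
  have "finite Bad"
    unfolding Bad_def
  proof (intro finite_UN_I uncut)
    show "almost_invariant G (m <# E)" if "m \<in> B" "E \<in> \<E>" for m E
      using that qt B(2) almost_invariant_l_coset by (auto simp: quasi_tree_def)
  qed (use B qt in \<open>auto simp: quasi_tree_def\<close>)
  then have "finite (len ` Bad)" by blast
  then obtain N where N: "\<And>x. x \<in> Bad \<Longrightarrow> len x \<le> N"
    unfolding finite_nat_set_iff_bounded_le by blast
  obtain x where x: "x \<in> carrier G" "N < len x" "cdist \<xi> (emb x) < e / 4"
    using boundary_approx[OF \<xi>, of "e / 4" N] e(1) by auto
  have "x \<notin> Bad" using N x(2) by force
  then have near: "vdist x y < e / 4" if "y \<in> C x" for y
    using B(3)[of x y] that x(1) C[OF x(1)] by (auto simp: Bad_def)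
  have eq: "\<eta> = \<xi>" if \<eta>: "\<eta> \<in> boundary" "vconv \<sigma> \<eta>" "range \<sigma> \<subseteq> C x" for \<eta> \<sigma>
  proof (rule e(2)[OF \<eta>(1)])
    have "\<forall>\<^sub>F n in sequentially. cdist \<eta> (emb (\<sigma> n)) < e / 4"
      using \<eta>(2) e(1) unfolding vconv_def by (auto intro!: order_tendstoD(2)[of _ 0])
    from eventually_happens'[OF sequentially_bot this]
    obtain n where n: "cdist \<eta> (emb (\<sigma> n)) < e / 4" by blast
    have car: "\<sigma> n \<in> carrier G" using \<eta>(2) by (simp add: vconv_def)
    have "cdist \<xi> \<eta> \<le> cdist \<xi> (emb x) + cdist (emb x) \<eta>"
      "cdist (emb x) \<eta> \<le> cdist (emb x) (emb (\<sigma> n)) + cdist (emb (\<sigma> n)) \<eta>"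
      using \<xi> \<eta>(1) x(1) car emb_in by (auto intro!: co.triangle)
    moreover have "vdist x (\<sigma> n) < e / 4" using near \<eta>(3) by blast
    ultimately show "cdist \<xi> \<eta> < e"
      using n x(3) e(1) cdist_emb[OF x(1) car] by (simp add: co.commute)
  qed
  obtain D where D: "almost_invariant G D" "infinite (C x \<inter> D)" "infinite (C x - D)"
    using branch[OF x(1)] by blast
  obtain \<sigma> \<eta> where \<sigma>: "\<eta> \<in> boundary" "vconv \<sigma> \<eta>" "range \<sigma> \<subseteq> C x \<inter> D"
    using infinite_set_accumulates[OF D(2)] C[OF x(1)] by blast
  obtain \<tau> \<theta> where \<tau>: "\<theta> \<in> boundary" "vconv \<tau> \<theta>" "range \<tau> \<subseteq> C x - D"
    using infinite_set_accumulates[OF D(3)] C[OF x(1)] by blast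
  have same: "\<eta> = \<theta>" using eq[of \<eta> \<sigma>] eq[of \<theta> \<tau>] \<sigma> \<tau> by blast
  have "\<forall>\<^sub>F n in sequentially. \<sigma> n \<in> D \<longleftrightarrow> \<tau> n \<in> D"
    using shadow_vconv[OF D(1) \<sigma>(1,2)] shadow_vconv[OF D(1) \<tau>(1,2)] by eventually_elim (simp add: same)
  moreover have "\<sigma> n \<in> D" "\<tau> n \<notin> D" for n using \<sigma>(3) \<tau>(3) by blast+
  ultimately show False by simp
qed

text \<open>The sets \<open>C x\<close> play the part of cones with apex \<open>x\<close>, pointing away from \<open>\<one>\<close>.\<close>

theorem floyd_boundary_cantor:
  assumes qt: "quasi_tree G F \<E>"
    and C: "\<And>x. x \<in> carrier G \<Longrightarrow> C x \<subseteq> carrier G"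
    and uncut: "\<And>D. almost_invariant G D \<Longrightarrow> finite {x \<in> carrier G. \<exists>y\<in>C x. (x \<in> D) \<noteq> (y \<in> D)}"
    and branch: "\<And>x. x \<in> carrier G \<Longrightarrow>
      \<exists>D. almost_invariant G D \<and> infinite (C x \<inter> D) \<and> infinite (C x - D)"
  shows "bd homeomorphic_space top_of_set cantor_set"
proof (rule homeomorphic_cantor_set[where \<U> = "(\<lambda>(m, E). shadow (m <# E)) ` (carrier G \<times> \<E>)"])
  show "compact_space bd" by (rule compact_boundary)
  have "infinite (carrier G)" using branch[of \<one>] C[of \<one>] by (meson Int_lower1 finite_subset one_closed)
  then show "topspace bd \<noteq> {}"
    using infinite_set_accumulates[of "carrier G"] unfolding topspace_bd by blast
  show "\<not> openin bd {\<xi>}" if "\<xi> \<in> topspace bd" for \<xi>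
    using boundary_perfect[OF qt C uncut branch] that unfolding topspace_bd by blast
  have "countable \<E>" using qt by (auto simp: quasi_tree_def intro: countable_finite)
  then show "countable ((\<lambda>(m, E). shadow (m <# E)) ` (carrier G \<times> \<E>))"
    using countable_carrier by blast
  show "openin bd U \<and> closedin bd U" if "U \<in> (\<lambda>(m, E). shadow (m <# E)) ` (carrier G \<times> \<E>)" for U
    using that qt almost_invariant_l_coset shadow_clopen by (auto simp: quasi_tree_def)
  show "\<exists>U\<in>(\<lambda>(m, E). shadow (m <# E)) ` (carrier G \<times> \<E>). \<xi> \<in> U \<and> \<eta> \<notin> U \<or> \<xi> \<notin> U \<and> \<eta> \<in> U"
    if "\<xi> \<in> topspace bd" "\<eta> \<in> topspace bd" "\<xi> \<noteq> \<eta>" for \<xi> \<eta>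
    using shadows_separate[OF qt, of \<xi> \<eta>] that unfolding topspace_bd by fast
qed

end

section \<open>Elementary groups are quasi-trees\<close>

lemma (in group) almost_invariant_Collect:
  assumes "\<And>s. s \<in> carrier G \<Longrightarrow> finite {g \<in> carrier G. P g \<noteq> P (g \<otimes> s)}"
  shows "almost_invariant G {g \<in> carrier G. P g}"
  unfolding almost_invariant_def
proof (intro conjI ballI)
  fix s assume s: "s \<in> carrier G"
  then have "{g \<in> carrier G. (g \<in> {g \<in> carrier G. P g}) \<noteq> (g \<otimes> s \<in> {g \<in> carrier G. P g})} =
      {g \<in> carrier G. P g \<noteq> P (g \<otimes> s)}" by auto
  then show "finite {g \<in> carrier G. (g \<in> {g \<in> carrier G. P g}) \<noteq> (g \<otimes> s \<in> {g \<in> carrier G. P g})}"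
    using assms[OF s] by simp
qed auto

text \<open>Writing the elements as \<open>t ^ k \<otimes> r\<close> with \<open>r\<close> in a finite transversal, the exponent \<open>k\<close> is an integer
  coordinate which right multiplications change by a bounded amount only.\<close>

lemma (in group) infinite_elementary_coordinate:
  assumes el: "elementary_group G" and inf: "infinite (carrier G)"
  obtains t and l :: "'a \<Rightarrow> int" where "t \<in> carrier G" "l \<one> = 0"
    "\<And>k g. g \<in> carrier G \<Longrightarrow> l (t [^] k \<otimes> g) = k + l g"
    "\<And>k. finite {g \<in> carrier G. l g = k}"
    "\<And>s. s \<in> carrier G \<Longrightarrow> finite ((\<lambda>g. l (g \<otimes> s) - l g) ` carrier G)"
proof -
  obtain H where H: "subgroup H G" "cyclic_group (G\<lparr>carrier := H\<rparr>)" "finite (rcosets H)"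
    using el by (auto simp: elementary_group_def)
  interpret H: group "G\<lparr>carrier := H\<rparr>" by (rule subgroup.subgroup_is_group[OF H(1) group_axioms])
  obtain t where tH: "t \<in> H" "H = range (\<lambda>n::int. t [^] n)"
  proof -
    obtain t where t: "t \<in> H" "H = range (\<lambda>n::int. t [^]\<^bsub>G\<lparr>carrier := H\<rparr>\<^esub> n)"
      using H(2) unfolding H.cyclic_group by auto
    then have "H = range (\<lambda>n::int. t [^] n)" using int_pow_consistent[OF H(1) t(1), symmetric] by simp
    then show ?thesis using that t(1) by blast
  qed
  have t: "t \<in> carrier G" using tH H(1) subgroup.subset by blast
  have Hsub: "H \<subseteq> carrier G" using H(1) subgroup.subset by blast
  have "infinite H"
  proof
    assume "finite H"
    have "finite C" if "C \<in> rcosets H" for C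
      using that \<open>finite H\<close> by (auto simp: RCOSETS_def r_coset_def)
    then have "finite (\<Union>(rcosets H))" using H(3) by blast
    then show False using inf rcosets_part_G[OF H(1)] by simp
  qed
  then have inj: "i = j" if "t [^] i = t [^] j" for i j :: int
    using infinite_cyclic_subgroup_int[OF t] carrier_subgroup_generated_by_singleton[OF t] tH that by simp
  define rep where "rep C = (if C = H then \<one> else SOME a. a \<in> C)" for C
  have rep: "rep (H #> g) \<in> H #> g" if "g \<in> carrier G" for g
    using rcos_self[OF that H(1)] subgroup.one_closed[OF H(1)] unfolding rep_def
    by (auto intro: someI)
  have rep_carrier: "rep (H #> g) \<in> carrier G" if "g \<in> carrier G" for g
    using rep[OF that] r_coset_subset_G[OF Hsub that] by blast
  have "\<exists>k::int. g = t [^] k \<otimes> rep (H #> g)" if "g \<in> carrier G" for g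
  proof -
    have "H #> rep (H #> g) = H #> g" using repr_independence[OF rep that H(1)] that by simp
    then have "g \<in> H #> rep (H #> g)" using rcos_self[OF that H(1)] by simp
    then show ?thesis using tH(2) by (auto simp: r_coset_def)
  qed
  then obtain l :: "'a \<Rightarrow> int" where l: "\<And>g. g \<in> carrier G \<Longrightarrow> g = t [^] l g \<otimes> rep (H #> g)" by metis
  have l_unique: "l g = k" if "g \<in> carrier G" "g = t [^] k \<otimes> rep (H #> g)" for g k
  proof (rule inj)
    have "t [^] l g \<otimes> rep (H #> g) = t [^] k \<otimes> rep (H #> g)" using l that by simp
    then show "t [^] l g = t [^] k" using t rep_carrier[OF that(1)] by simp
  qed
  have l_shift: "l (t [^] k \<otimes> g) = k + l g" if g: "g \<in> carrier G" for k g
  proof (rule l_unique)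
    have "t [^] k \<in> H" using tH by blast
    then have "H #> (t [^] k \<otimes> g) = H #> g"
      using coset_mult_assoc[OF Hsub _ g, of "t [^] k"] coset_join2[OF _ H(1), of "t [^] k"] t by simp
    then show "t [^] k \<otimes> g = t [^] (k + l g) \<otimes> rep (H #> (t [^] k \<otimes> g))"
      using l[OF g] rep_carrier[OF g] t by (simp add: int_pow_mult m_assoc)
  qed (use t g in simp)
  have l_one: "l \<one> = 0"
    by (rule l_unique) (use coset_join2[OF one_closed H(1)] subgroup.one_closed[OF H(1)] in \<open>simp_all add: rep_def\<close>)
  have finR: "finite (rep ` (rcosets H))" using H(3) by blast
  have inR: "rep (H #> g) \<in> rep ` (rcosets H)" if "g \<in> carrier G" for g
    using that by (auto simp: RCOSETS_def)
  have fib: "finite {g \<in> carrier G. l g = k}" for k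
  proof (rule finite_subset)
    show "{g \<in> carrier G. l g = k} \<subseteq> (\<lambda>r. t [^] k \<otimes> r) ` rep ` (rcosets H)"
    proof
      fix g assume g: "g \<in> {g \<in> carrier G. l g = k}"
      then have "g = t [^] k \<otimes> rep (H #> g)" using l by blast
      then show "g \<in> (\<lambda>r. t [^] k \<otimes> r) ` rep ` (rcosets H)" by (rule image_eqI) (use inR g in blast)
    qed
  qed (use finR in blast)
  have "finite ((\<lambda>g. l (g \<otimes> s) - l g) ` carrier G)" if s: "s \<in> carrier G" for s
  proof (rule finite_subset)
    show "finite ((\<lambda>r. l (r \<otimes> s)) ` rep ` (rcosets H))" using finR by blast
    have "l (g \<otimes> s) - l g = l (rep (H #> g) \<otimes> s)" if g: "g \<in> carrier G" for g
    proof -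
      have "g \<otimes> s = t [^] l g \<otimes> (rep (H #> g) \<otimes> s)"
        using arg_cong[OF l[OF g], of "\<lambda>x. x \<otimes> s"] rep_carrier[OF g] t s by (simp add: m_assoc)
      then show ?thesis using l_shift[of "rep (H #> g) \<otimes> s" "l g"] rep_carrier[OF g] s by simp
    qed
    then show "(\<lambda>g. l (g \<otimes> s) - l g) ` carrier G \<subseteq> (\<lambda>r. l (r \<otimes> s)) ` rep ` (rcosets H)"
      using inR by auto
  qed
  then show ?thesis using that[OF t l_one l_shift fib] by blast
qed

text \<open>
  A chain in a virtually infinite cyclic group follows the powers of \<open>t\<close>; the half-line
  \<open>l \<ge> 0\<close> translated by \<open>t ^ j\<close> separates the two sides of \<open>t ^ j\<close>, and the set \<open>{\<one>}\<close> makes the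
  end points of a chain bottlenecks, too. In a finite group, one step suffices.
\<close>

lemma (in group) elementary_quasi_tree:
  assumes el: "elementary_group G"
  shows "\<exists>F \<E>. quasi_tree G F \<E>"
proof (cases "finite (carrier G)")
  case True
  have "(\<one>, g) \<in> (chain_steps G (carrier G) {{\<one>}} g)\<^sup>*" if "g \<in> carrier G" for g
  proof (cases "g = \<one>")
    case False
    then have "(\<one>, g) \<in> chain_steps G (carrier G) {{\<one>}} g"
      using that by (auto simp: chain_steps_def bottlenecks_def)
    then show ?thesis by blast
  qed simp
  then have "quasi_tree G (carrier G) {{\<one>}}"
    using True almost_invariant_finite[of "{\<one>}"] by (simp add: quasi_tree_def)
  then show ?thesis by blast
next
  case False
  obtain t and l :: "'a \<Rightarrow> int" where t: "t \<in> carrier G" and l_one: "l \<one> = 0"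
    and l_shift: "\<And>k g. g \<in> carrier G \<Longrightarrow> l (t [^] k \<otimes> g) = k + l g"
    and fib: "\<And>k. finite {g \<in> carrier G. l g = k}"
    and qm: "\<And>s. s \<in> carrier G \<Longrightarrow> finite ((\<lambda>g. l (g \<otimes> s) - l g) ` carrier G)"
    using infinite_elementary_coordinate[OF el False] by blast
  have fib_int: "finite {g \<in> carrier G. \<bar>l g\<bar> \<le> N}" for N
  proof -
    have "{g \<in> carrier G. \<bar>l g\<bar> \<le> N} = (\<Union>k\<in>{-N..N}. {g \<in> carrier G. l g = k})" by auto
    then show ?thesis using fib by simp
  qed
  define F where "F = {g \<in> carrier G. \<bar>l g\<bar> \<le> 1}"
  define E where "E = {g \<in> carrier G. 0 \<le> l g}"
  have E: "almost_invariant G E"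
    unfolding E_def
  proof (rule almost_invariant_Collect)
    fix s assume s: "s \<in> carrier G"
    obtain N where N: "\<And>g. g \<in> carrier G \<Longrightarrow> \<bar>l (g \<otimes> s) - l g\<bar> \<le> N"
    proof -
      have "finite (abs ` (\<lambda>g. l (g \<otimes> s) - l g) ` carrier G)" using qm[OF s] by blast
      then show ?thesis using that[of "Max (abs ` (\<lambda>g. l (g \<otimes> s) - l g) ` carrier G)"]
        by (meson Max_ge imageI)
    qed
    show "finite {g \<in> carrier G. (0 \<le> l g) \<noteq> (0 \<le> l (g \<otimes> s))}"
    proof (rule finite_subset[OF _ fib_int[of N]])
      show "{g \<in> carrier G. (0 \<le> l g) \<noteq> (0 \<le> l (g \<otimes> s))} \<subseteq> {g \<in> carrier G. \<bar>l g\<bar> \<le> N}"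
        using N by fastforce
    qed
  qed
  have inv_pow: "inv (t [^] j) = t [^] (- j)" for j :: int using t by (simp add: int_pow_neg)
  have l_pow: "l (t [^] j) = j" for j using l_shift[OF one_closed, of j] t l_one by simp
  have "(\<one>, g) \<in> (chain_steps G F {{\<one>}, E} g)\<^sup>*" if g: "g \<in> carrier G" for g
  proof (cases "g = \<one>")
    case ne: False
    let ?r = "chain_steps G F {{\<one>}, E} g" and ?b = "bottlenecks G {{\<one>}, E} g"
    have ends: "\<one> \<in> ?b" "g \<in> ?b" using g ne by (auto simp: bottlenecks_def)
    have mid: "t [^] j \<in> ?b" if "j = 0 \<or> (0 \<le> - j) \<noteq> (0 \<le> l g - j)" for j
    proof (cases "j = 0")
      case False
      then have "(inv (t [^] j) \<in> E) \<noteq> (inv (t [^] j) \<otimes> g \<in> E)"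
        using that t g by (simp add: E_def inv_pow l_shift l_pow)
      then show ?thesis using t by (auto simp: bottlenecks_def)
    qed (use ends in simp)
    have step: "(t [^] i, t [^] j) \<in> ?r" if "t [^] i \<in> ?b" "t [^] j \<in> ?b" "\<bar>j - i\<bar> \<le> 1" for i j :: int
      using that t l_shift[of "t [^] j" "- i"] by (simp add: chain_steps_def F_def inv_pow l_pow)
    have last: "(t [^] i, g) \<in> ?r" if "t [^] i \<in> ?b" "\<bar>l g - i\<bar> \<le> 1" for i :: int
      using that ends t g by (simp add: chain_steps_def F_def inv_pow l_shift)
    show ?thesis
    proof (cases "0 \<le> l g")
      case True
      have "int n \<le> l g \<Longrightarrow> (\<one>, t [^] int n) \<in> ?r\<^sup>*" for n
      proof (induction n)
        case (Suc n)
        then have "(t [^] int n, t [^] int (Suc n)) \<in> ?r" by (intro step mid) auto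
        then show ?case using Suc by (auto intro: rtrancl_into_rtrancl)
      qed simp
      from this[of "nat (l g)"] have "(\<one>, t [^] l g) \<in> ?r\<^sup>*" using True by simp
      moreover have "(t [^] l g, g) \<in> ?r" using True by (intro last mid) auto
      ultimately show ?thesis by (rule rtrancl_into_rtrancl)
    next
      case False
      have "l g < - int n \<Longrightarrow> (\<one>, t [^] (- int n)) \<in> ?r\<^sup>*" for n
      proof (induction n)
        case (Suc n)
        then have "(t [^] (- int n), t [^] (- int (Suc n))) \<in> ?r" by (intro step mid) auto
        then show ?case using Suc by (auto intro: rtrancl_into_rtrancl)
      qed simp
      from this[of "nat (- l g - 1)"] have "(\<one>, t [^] (l g + 1)) \<in> ?r\<^sup>*" using False by (simp add: add.commute)
      moreover have "(t [^] (l g + 1), g) \<in> ?r" using False by (intro last mid) auto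
      ultimately show ?thesis by (rule rtrancl_into_rtrancl)
    qed
  qed simp
  then have "quasi_tree G F {{\<one>}, E}"
    using E fib_int[of 1] almost_invariant_finite[of "{\<one>}"] by (auto simp: quasi_tree_def F_def)
  then show ?thesis by blast
qed

section \<open>Free products\<close>

locale free_prod =
  fixes I :: "'i set" and A :: "'i \<Rightarrow> 'a monoid"
  assumes factor_group: "i \<in> I \<Longrightarrow> group (A i)"
begin

abbreviation P :: "('i \<times> 'a) list monoid" where "P \<equiv> free_product I A"

sublocale fp: group P by (rule group_free_product[OF factor_group])

lemma P_simps: "carrier P = reduced_words I A" "mult P = (\<lambda>u v. foldr (letter_mult A) u v)" "one P = []"
  by (simp_all add: free_product_def)

definition letter :: "'i \<Rightarrow> 'a \<Rightarrow> ('i \<times> 'a) list" where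
  "letter i a = (if a = \<one>\<^bsub>A i\<^esub> then [] else [(i, a)])"

text \<open>The component in \<open>A i\<close> of the first syllable, which is the identity if the word begins with a
  letter of another factor.\<close>

definition ipart :: "'i \<Rightarrow> ('i \<times> 'a) list \<Rightarrow> 'a" where
  "ipart i w = (case w of [] \<Rightarrow> \<one>\<^bsub>A i\<^esub> | (j, a) # _ \<Rightarrow> if j = i then a else \<one>\<^bsub>A i\<^esub>)"

lemma reduced_Nil [simp]: "[] \<in> carrier P"
  by (simp add: P_simps reduced_words_def)

lemma reduced_append:
  "u @ v \<in> carrier P \<longleftrightarrow> u \<in> carrier P \<and> v \<in> carrier P \<and> (u \<noteq> [] \<and> v \<noteq> [] \<longrightarrow> fst (last u) \<noteq> fst (hd v))"
  by (auto simp: P_simps reduced_words_def distinct_adj_append_iff last_map hd_map)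

lemma reduced_Cons:
  "(i, a) # v \<in> carrier P \<longleftrightarrow> i \<in> I \<and> a \<in> carrier (A i) \<and> a \<noteq> \<one>\<^bsub>A i\<^esub> \<and> v \<in> carrier P \<and>
     (v \<noteq> [] \<longrightarrow> i \<noteq> fst (hd v))"
  by (cases v) (auto simp: P_simps reduced_words_def)

lemma letter_carrier: "i \<in> I \<Longrightarrow> a \<in> carrier (A i) \<Longrightarrow> letter i a \<in> carrier P"
  by (simp add: letter_def reduced_Cons)

lemma letter_mult_eq: "letter i a \<otimes>\<^bsub>P\<^esub> v = letter_mult A (i, a) v"
  by (simp add: letter_def P_simps letter_mult_one)

lemma mult_append:
  assumes "u @ v \<in> carrier P"
  shows "u \<otimes>\<^bsub>P\<^esub> v = u @ v"
  using assms
proof (induction u)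
  case (Cons x u)
  obtain i a where x: "x = (i, a)" by force
  have "u \<otimes>\<^bsub>P\<^esub> v = u @ v" using Cons by (auto simp: x reduced_Cons)
  then have "(x # u) \<otimes>\<^bsub>P\<^esub> v = letter_mult A (i, a) (u @ v)" by (simp add: P_simps x)
  also have "\<dots> = (x # u) @ v"
    using Cons.prems unfolding x by (cases "u @ v") (auto simp: reduced_Cons)
  finally show ?case .
qed (simp add: P_simps)

lemma letter_mult_letter:
  assumes "i \<in> I" "a \<in> carrier (A i)" "b \<in> carrier (A i)"
  shows "letter i a \<otimes>\<^bsub>P\<^esub> letter i b = letter i (a \<otimes>\<^bsub>A i\<^esub> b)"
proof -
  interpret A: group "A i" by (rule factor_group[OF assms(1)])
  show ?thesis unfolding letter_mult_eq using assms by (auto simp: letter_def)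
qed

lemma inv_letter:
  assumes "i \<in> I" "a \<in> carrier (A i)"
  shows "inv\<^bsub>P\<^esub> letter i a = letter i (inv\<^bsub>A i\<^esub> a)"
proof -
  interpret A: group "A i" by (rule factor_group[OF assms(1)])
  have "letter i (inv\<^bsub>A i\<^esub> a) \<otimes>\<^bsub>P\<^esub> letter i a = \<one>\<^bsub>P\<^esub>"
    using letter_mult_letter[of i "inv\<^bsub>A i\<^esub> a" a] assms by (simp add: letter_def P_simps)
  then show ?thesis using assms by (intro fp.inv_equality letter_carrier) auto
qed

lemma ipart_carrier: "i \<in> I \<Longrightarrow> w \<in> carrier P \<Longrightarrow> ipart i w \<in> carrier (A i)"
  using factor_group[THEN group.is_monoid, THEN monoid.one_closed]
  by (cases w) (auto simp: ipart_def reduced_Cons)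

lemma ipart_letter_mult:
  assumes "i \<in> I" "a \<in> carrier (A i)" "v \<in> carrier P"
  shows "ipart i (letter i a \<otimes>\<^bsub>P\<^esub> v) = a \<otimes>\<^bsub>A i\<^esub> ipart i v"
proof -
  interpret A: group "A i" by (rule factor_group[OF assms(1)])
  show ?thesis
  proof (cases v)
    case Nil
    then show ?thesis using assms by (auto simp: letter_mult_eq ipart_def)
  next
    case (Cons x v')
    obtain j b where x: "x = (j, b)" by force
    show ?thesis
      using assms unfolding Cons x letter_mult_eq
      by (cases v') (auto simp: ipart_def reduced_Cons)
  qed
qed

text \<open>The inverse of a word begins with the inverse of its last letter.\<close>

lemma ipart_inv:
  assumes "u \<in> carrier P" "u = [] \<or> fst (last u) \<noteq> i"
  shows "ipart i (inv\<^bsub>P\<^esub> u) = \<one>\<^bsub>A i\<^esub>"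
  using assms
proof (induction u arbitrary: i rule: rev_induct)
  case Nil
  then show ?case using fp.inv_one by (simp add: P_simps ipart_def)
next
  case (snoc x u)
  obtain k c where x: "x = (k, c)" by force
  have u: "u \<in> carrier P" "u = [] \<or> fst (last u) \<noteq> k" and kc: "k \<in> I" "c \<in> carrier (A k)" "c \<noteq> \<one>\<^bsub>A k\<^esub>"
    using snoc.prems(1) by (auto simp: x reduced_append reduced_Cons)
  interpret A: group "A k" by (rule factor_group[OF kc(1)])
  have "u @ [x] = u \<otimes>\<^bsub>P\<^esub> letter k c"
    using mult_append[OF snoc.prems(1)] kc by (simp add: x letter_def)
  then have eq: "inv\<^bsub>P\<^esub> (u @ [x]) = letter k (inv\<^bsub>A k\<^esub> c) \<otimes>\<^bsub>P\<^esub> inv\<^bsub>P\<^esub> u"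
    using fp.inv_mult_group[OF u(1) letter_carrier[OF kc(1,2)]] inv_letter[OF kc(1,2)] by simp
  have "ipart k (inv\<^bsub>P\<^esub> (u @ [x])) = inv\<^bsub>A k\<^esub> c"
    unfolding eq using ipart_letter_mult[OF kc(1), of "inv\<^bsub>A k\<^esub> c"] kc u snoc.IH[OF u] by simp
  moreover have "inv\<^bsub>A k\<^esub> c \<noteq> \<one>\<^bsub>A k\<^esub>" using kc by (metis A.inv_inv A.inv_one)
  moreover have "k \<noteq> i" using snoc.prems(2) x by auto
  ultimately show ?case by (auto simp: ipart_def split: list.splits prod.splits if_splits)
qed

text \<open>Right multiplication by a letter acts on the end of a word and reaches the first syllable only if there is no other.\<close>

lemma ipart_mult_letter:
  assumes w: "w \<in> carrier P" "(\<forall>a. w \<noteq> letter i a) \<or> j \<noteq> i" and j: "j \<in> I" "b \<in> carrier (A j)"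
  shows "ipart i (w \<otimes>\<^bsub>P\<^esub> letter j b) = ipart i w"
proof (cases "w = []")
  case True
  then have "w = letter i \<one>\<^bsub>A i\<^esub>" "w = \<one>\<^bsub>P\<^esub>" by (simp_all add: letter_def P_simps(3))
  then have "j \<noteq> i" "w \<otimes>\<^bsub>P\<^esub> letter j b = letter j b" using w(2) fp.l_one letter_carrier[OF j] by auto
  then show ?thesis using True by (simp add: ipart_def letter_def)
next
  case False
  interpret A: group "A j" by (rule factor_group[OF j(1)])
  obtain u k c where wu: "w = u @ [(k, c)]" using False by (metis rev_exhaust surj_pair)
  then have u: "u \<in> carrier P" and kc: "k \<in> I" "c \<in> carrier (A k)" "c \<noteq> \<one>\<^bsub>A k\<^esub>"
    and uk: "u \<noteq> [] \<Longrightarrow> fst (last u) \<noteq> k"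
    using w(1) by (auto simp: reduced_append reduced_Cons)
  have no: "k \<noteq> i" if "u = []" "k = j"
  proof
    assume "k = i"
    then have "w = letter i c" using kc that by (simp add: wu letter_def)
    then show False using w(2) that \<open>k = i\<close> by blast
  qed
  have w_eq: "w = u \<otimes>\<^bsub>P\<^esub> letter k c" using mult_append[of u "[(k, c)]"] w(1) kc by (simp add: wu letter_def)
  have same: "ipart i (u @ v) = ipart i w" if "u \<noteq> []" for v
    using that by (cases u) (auto simp: wu ipart_def)
  show ?thesis
  proof (cases "k = j")
    case True
    have "w \<otimes>\<^bsub>P\<^esub> letter j b = u \<otimes>\<^bsub>P\<^esub> letter k (c \<otimes>\<^bsub>A k\<^esub> b)"
      unfolding w_eq using u kc j letter_mult_letter[of k c b] True letter_carrier
      by (simp add: fp.m_assoc)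
    also have "\<dots> = u @ letter k (c \<otimes>\<^bsub>A k\<^esub> b)"
      by (rule mult_append) (use u kc j True uk letter_carrier in \<open>auto simp: reduced_append letter_def\<close>)
    finally have eq: "w \<otimes>\<^bsub>P\<^esub> letter j b = u @ letter k (c \<otimes>\<^bsub>A k\<^esub> b)" .
    show ?thesis
    proof (cases "u = []")
      case True
      then show ?thesis using no \<open>k = j\<close> unfolding eq by (simp add: wu ipart_def letter_def)
    qed (use same in \<open>simp add: eq\<close>)
  next
    case neq: False
    have "w \<otimes>\<^bsub>P\<^esub> letter j b = w @ letter j b"
      by (rule mult_append) (use w(1) neq j in \<open>auto simp: reduced_append reduced_Cons letter_def wu\<close>)
    then show ?thesis by (cases u) (auto simp: wu ipart_def)
  qed
qed

definition lift :: "'i \<Rightarrow> 'a set \<Rightarrow> ('i \<times> 'a) list set" where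
  "lift i E = {w \<in> carrier P. ipart i w \<in> E}"

lemma reduced_induct [consumes 1, case_names one mult]:
  assumes "w \<in> carrier P" "Q \<one>\<^bsub>P\<^esub>"
    "\<And>i a v. i \<in> I \<Longrightarrow> a \<in> carrier (A i) \<Longrightarrow> v \<in> carrier P \<Longrightarrow> Q v \<Longrightarrow> Q (letter i a \<otimes>\<^bsub>P\<^esub> v)"
  shows "Q w"
  using assms(1)
proof (induction w)
  case Nil
  then show ?case using assms(2) by (simp add: P_simps)
next
  case (Cons x w)
  obtain i a where x: "x = (i, a)" by force
  have "letter i a \<otimes>\<^bsub>P\<^esub> w = x # w"
    using mult_append[of "[x]" w] Cons.prems by (simp add: x letter_def reduced_Cons)
  then show ?case using assms(3)[of i a w] Cons by (simp add: x reduced_Cons)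
qed

text \<open>Membership in the lift depends on the first syllable only, so right multiplication by a letter can change it only for
  words in the \<open>i\<close>-th factor, where it does so for finitely many. Letters generate the free product.\<close>

lemma almost_invariant_lift:
  assumes i: "i \<in> I" and E: "almost_invariant (A i) E"
  shows "almost_invariant P (lift i E)"
  unfolding almost_invariant_def
proof (intro conjI ballI)
  show "lift i E \<subseteq> carrier P" by (auto simp: lift_def)
  fix s assume "s \<in> carrier P"
  then show "finite {w \<in> carrier P. (w \<in> lift i E) \<noteq> (w \<otimes>\<^bsub>P\<^esub> s \<in> lift i E)}"
  proof (induction s rule: reduced_induct)
    case one
    have "{w \<in> carrier P. (w \<in> lift i E) \<noteq> (w \<otimes>\<^bsub>P\<^esub> \<one>\<^bsub>P\<^esub> \<in> lift i E)} = {}" by auto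
    then show ?case by (simp only: finite.emptyI)
  next
    case (mult j b v)
    let ?B = "{a \<in> carrier (A i). (a \<in> E) \<noteq> (a \<otimes>\<^bsub>A i\<^esub> b \<in> E)}"
    let ?C = "{w \<in> carrier P. (w \<in> lift i E) \<noteq> (w \<otimes>\<^bsub>P\<^esub> letter j b \<in> lift i E)}"
    interpret A: group "A i" by (rule factor_group[OF i])
    have ip: "ipart i (letter i a) = a" for a by (auto simp: ipart_def letter_def)
    have C: "j = i \<and> w \<in> letter i ` ?B" if w: "w \<in> ?C" for w
    proof -
      have "ipart i (w \<otimes>\<^bsub>P\<^esub> letter j b) \<noteq> ipart i w"
        using w mult(1,2) letter_carrier by (auto simp: lift_def)
      then obtain a where a: "w = letter i a" "j = i" using ipart_mult_letter[of w i j b] mult(1,2) w by blast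
      then have "a \<in> carrier (A i)" using ipart_carrier[of i w] i w ip by simp
      then have "a \<in> ?B"
        using w mult(1,2) letter_carrier a(2) letter_mult_letter[of i a b] by (auto simp: a(1) lift_def ip)
      then show ?thesis using a by blast
    qed
    have "finite ?C"
    proof (cases "j = i")
      case True
      then have "finite ?B" using E mult(2) by (auto simp: almost_invariant_def)
      then show ?thesis using C by (meson finite_imageI finite_subset subsetI)
    next
      case False
      then have "?C = {}" using C by blast
      then show ?thesis by (simp only: finite.emptyI)
    qed
    then show ?case by (rule fp.finite_coboundary_mult[OF letter_carrier[OF mult(1,2)] mult(3) _ mult(4)])
  qed
qed

text \<open>
  Looked at from the point \<open>u \<otimes> letter i m\<close>, the elements \<open>\<one>\<close> and \<open>w\<close> have the first syllables \<open>inv m\<close> and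
  \<open>inv m \<otimes> a\<close>, just as \<open>\<one>\<close> and \<open>a\<close> in the \<open>i\<close>-th factor looked at from \<open>m\<close>.
\<close>

lemma bottlenecks_lift:
  assumes w: "w = u @ (i, a) # v" "w \<in> carrier P" and E: "\<E> i \<subseteq> Pow (carrier (A i))"
    and m: "m \<in> bottlenecks (A i) (\<E> i) a"
  shows "u \<otimes>\<^bsub>P\<^esub> letter i m \<in> bottlenecks P (\<Union>i\<in>I. lift i ` \<E> i) w"
proof -
  have u: "u \<in> carrier P" "u = [] \<or> fst (last u) \<noteq> i" and i: "i \<in> I" "a \<in> carrier (A i)" "a \<noteq> \<one>\<^bsub>A i\<^esub>"
    and v: "(i, a) # v \<in> carrier P"
    using w by (auto simp: reduced_append reduced_Cons)
  interpret A: group "A i" by (rule factor_group[OF i(1)])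
  obtain E where E: "E \<in> \<E> i" "(inv\<^bsub>A i\<^esub> m \<in> E) \<noteq> (inv\<^bsub>A i\<^esub> m \<otimes>\<^bsub>A i\<^esub> a \<in> E)"
    and mc: "m \<in> carrier (A i)" using m by (auto simp: bottlenecks_def)
  let ?q = "u \<otimes>\<^bsub>P\<^esub> letter i m"
  have L: "letter i (inv\<^bsub>A i\<^esub> m) \<in> carrier P" "letter i m \<in> carrier P" using letter_carrier i mc by auto
  have invq: "inv\<^bsub>P\<^esub> ?q = letter i (inv\<^bsub>A i\<^esub> m) \<otimes>\<^bsub>P\<^esub> inv\<^bsub>P\<^esub> u"
    using fp.inv_mult_group u L inv_letter i mc by simp
  have 1: "ipart i (inv\<^bsub>P\<^esub> ?q) = inv\<^bsub>A i\<^esub> m"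
    using ipart_letter_mult[of i "inv\<^bsub>A i\<^esub> m" "inv\<^bsub>P\<^esub> u"] ipart_inv[OF u] i mc u by (simp add: invq)
  have "w = u \<otimes>\<^bsub>P\<^esub> ((i, a) # v)" using mult_append[of u "(i, a) # v"] w by simp
  then have "inv\<^bsub>P\<^esub> ?q \<otimes>\<^bsub>P\<^esub> w = letter i (inv\<^bsub>A i\<^esub> m) \<otimes>\<^bsub>P\<^esub> ((i, a) # v)"
    using u L v by (simp add: invq fp.m_assoc) (simp add: fp.m_assoc[symmetric])
  then have 2: "ipart i (inv\<^bsub>P\<^esub> ?q \<otimes>\<^bsub>P\<^esub> w) = inv\<^bsub>A i\<^esub> m \<otimes>\<^bsub>A i\<^esub> a"
    using ipart_letter_mult[of i "inv\<^bsub>A i\<^esub> m", OF i(1) _ v] mc by (simp add: ipart_def)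
  have "(inv\<^bsub>P\<^esub> ?q \<in> lift i E) \<noteq> (inv\<^bsub>P\<^esub> ?q \<otimes>\<^bsub>P\<^esub> w \<in> lift i E)"
    using E(2) u L w(2) by (simp add: lift_def 1 2)
  then show ?thesis using E(1) i(1) u L by (auto simp: bottlenecks_def)
qed

text \<open>The chain to a word runs through its prefixes, and from one prefix to the next it follows a
  translated chain of the factor concerned.\<close>

lemma quasi_tree_free_product:
  assumes fin: "finite I" and qt: "\<And>i. i \<in> I \<Longrightarrow> quasi_tree (A i) (F i) (\<E> i)"
  shows "quasi_tree P (\<Union>i\<in>I. letter i ` F i) (\<Union>i\<in>I. lift i ` \<E> i)"
proof -
  let ?F = "\<Union>i\<in>I. letter i ` F i" and ?E = "\<Union>i\<in>I. lift i ` \<E> i"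
  have F: "F i \<subseteq> carrier (A i)" and sub: "\<E> i \<subseteq> Pow (carrier (A i))" if "i \<in> I" for i
    using qt[OF that] by (auto simp: quasi_tree_def almost_invariant_def)
  have chain: "(u, w) \<in> (chain_steps P ?F ?E w)\<^sup>*" if "w = u @ v" "w \<in> carrier P" for u v w
    using that
  proof (induction v arbitrary: u)
    case (Cons x v)
    obtain i a where x: "x = (i, a)" by force
    have w: "w = u @ (i, a) # v" "w \<in> carrier P" using Cons.prems x by auto
    have u: "u \<in> carrier P" and i: "i \<in> I" "a \<in> carrier (A i)" "a \<noteq> \<one>\<^bsub>A i\<^esub>"
      and ua: "u @ [(i, a)] \<in> carrier P"
      using w by (auto simp: reduced_append reduced_Cons)
    interpret A: group "A i" by (rule factor_group[OF i(1)])
    have lift: "(u \<otimes>\<^bsub>P\<^esub> letter i m, u \<otimes>\<^bsub>P\<^esub> letter i m') \<in> chain_steps P ?F ?E w"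
      if mm: "(m, m') \<in> chain_steps (A i) (F i) (\<E> i) a" for m m'
    proof -
      have b: "m \<in> bottlenecks (A i) (\<E> i) a" "m' \<in> bottlenecks (A i) (\<E> i) a"
        and s: "inv\<^bsub>A i\<^esub> m \<otimes>\<^bsub>A i\<^esub> m' \<in> F i" using mm by (auto simp: chain_steps_def)
      have mc: "m \<in> carrier (A i)" "m' \<in> carrier (A i)" using b by (auto simp: bottlenecks_def)
      have L: "letter i m \<in> carrier P" "letter i m' \<in> carrier P" using letter_carrier i mc by auto
      have "inv\<^bsub>P\<^esub> (u \<otimes>\<^bsub>P\<^esub> letter i m) \<otimes>\<^bsub>P\<^esub> (u \<otimes>\<^bsub>P\<^esub> letter i m') = inv\<^bsub>P\<^esub> letter i m \<otimes>\<^bsub>P\<^esub> letter i m'"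
      proof -
        have "inv\<^bsub>P\<^esub> u \<otimes>\<^bsub>P\<^esub> (u \<otimes>\<^bsub>P\<^esub> letter i m') = letter i m'" using u L by (simp add: fp.m_assoc[symmetric])
        then show ?thesis using u L by (simp add: fp.inv_mult_group fp.m_assoc)
      qed
      also have "\<dots> = letter i (inv\<^bsub>A i\<^esub> m \<otimes>\<^bsub>A i\<^esub> m')"
        using inv_letter letter_mult_letter i mc by simp
      finally show ?thesis
        using bottlenecks_lift[where \<E> = \<E>, OF w sub[OF i(1)] b(1)] bottlenecks_lift[where \<E> = \<E>, OF w sub[OF i(1)] b(2)] s i(1)
        by (auto simp: chain_steps_def)
    qed
    have "(\<one>\<^bsub>A i\<^esub>, a) \<in> (chain_steps (A i) (F i) (\<E> i) a)\<^sup>*"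
      using qt[OF i(1)] i(2) by (simp add: quasi_tree_def)
    then have "(u \<otimes>\<^bsub>P\<^esub> letter i \<one>\<^bsub>A i\<^esub>, u \<otimes>\<^bsub>P\<^esub> letter i a) \<in> (chain_steps P ?F ?E w)\<^sup>*"
      by induction (auto intro: rtrancl_into_rtrancl lift)
    moreover have "u \<otimes>\<^bsub>P\<^esub> letter i \<one>\<^bsub>A i\<^esub> = u"
      using fp.r_one[OF u] by (simp add: letter_def P_simps(3))
    moreover have "u \<otimes>\<^bsub>P\<^esub> letter i a = u @ [x]"
      using mult_append[OF ua] i(3) by (simp add: letter_def x)
    ultimately have "(u, u @ [x]) \<in> (chain_steps P ?F ?E w)\<^sup>*" by simp
    also have "(u @ [x], w) \<in> (chain_steps P ?F ?E w)\<^sup>*" using Cons.IH[of "u @ [x]"] Cons.prems by simp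
    finally show ?case .
  qed simp
  show ?thesis
    unfolding quasi_tree_def
  proof (intro conjI ballI)
    show "finite ?F" "finite ?E" using fin qt by (auto simp: quasi_tree_def)
    show "?F \<subseteq> carrier P" using F letter_carrier by blast
    show "almost_invariant P E" if "E \<in> ?E" for E
      using that qt almost_invariant_lift by (auto simp: quasi_tree_def)
    show "(\<one>\<^bsub>P\<^esub>, w) \<in> (chain_steps P ?F ?E w)\<^sup>*" if "w \<in> carrier P" for w
      using chain[of w "[]" w] that by (simp add: P_simps(3))
  qed
qed

subsection \<open>Cones\<close>

definition word_cone :: "('i \<times> 'a) list \<Rightarrow> ('i \<times> 'a) list set" where
  "word_cone x = {y \<in> carrier P. \<exists>w. y = x @ w}"

text \<open>
  The part of an almost invariant set in a cone can be reached from its complement only by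
  crossing the finite coboundary with respect to the steps of the chains, and only finitely
  many cones meet a given finite set, namely those at prefixes of its elements.
\<close>

lemma finite_cut_cones:
  assumes fin: "finite I" and qt: "\<And>i. i \<in> I \<Longrightarrow> quasi_tree (A i) (F i) (\<E> i)"
    and D: "almost_invariant P D"
  shows "finite {x \<in> carrier P. \<exists>y\<in>word_cone x. (x \<in> D) \<noteq> (y \<in> D)}"
proof -
  have F: "finite (F i)" "F i \<subseteq> carrier (A i)"
    and chain: "\<And>a. a \<in> carrier (A i) \<Longrightarrow> (\<one>\<^bsub>A i\<^esub>, a) \<in> (chain_steps (A i) (F i) (\<E> i) a)\<^sup>*"
    if "i \<in> I" for i
    using qt[OF that] by (auto simp: quasi_tree_def)
  define Z where "Z = (\<Union>i\<in>I. \<Union>s\<in>F i. {g \<in> carrier P. (g \<in> D) \<noteq> (g \<otimes>\<^bsub>P\<^esub> letter i s \<in> D)})"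
  have "finite Z"
    unfolding Z_def
  proof (intro finite_UN_I fin)
    show "finite {g \<in> carrier P. (g \<in> D) \<noteq> (g \<otimes>\<^bsub>P\<^esub> letter i s \<in> D)}" if "i \<in> I" "s \<in> F i" for i s
      using D letter_carrier[OF that(1), of s] F[OF that(1)] that(2) by (auto simp: almost_invariant_def)
  qed (use F in blast)
  have same: "x \<in> D \<longleftrightarrow> x @ w \<in> D" if disj: "word_cone x \<inter> Z = {}" and xw: "x @ w \<in> carrier P" for x w
    using xw
  proof (induction w rule: rev_induct)
    case (snoc p w)
    obtain i a where p: "p = (i, a)" by force
    let ?u = "x @ w"
    have ua: "?u @ [(i, a)] \<in> carrier P" using snoc.prems by (simp add: p)
    have u: "?u \<in> carrier P" "?u = [] \<or> fst (last ?u) \<noteq> i" and i: "i \<in> I" "a \<in> carrier (A i)" "a \<noteq> \<one>\<^bsub>A i\<^esub>"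
      using ua unfolding reduced_append[of ?u] by (auto simp: reduced_Cons)
    interpret A: group "A i" by (rule factor_group[OF i(1)])
    have um: "?u \<otimes>\<^bsub>P\<^esub> letter i m = ?u @ letter i m" "?u @ letter i m \<in> carrier P" if m: "m \<in> carrier (A i)" for m
    proof -
      show "?u @ letter i m \<in> carrier P"
        unfolding reduced_append[of ?u] using u letter_carrier[OF i(1) m] by (auto simp: letter_def)
      then show "?u \<otimes>\<^bsub>P\<^esub> letter i m = ?u @ letter i m" by (rule mult_append)
    qed
    have "?u \<in> D \<longleftrightarrow> ?u \<otimes>\<^bsub>P\<^esub> letter i a \<in> D"
      using chain[OF i(1,2)]
    proof induction
      case base
      then show ?case using fp.r_one[OF u(1)] by (simp add: letter_def P_simps(3))
    next
      case (step m m')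
      then have mc: "m \<in> carrier (A i)" "m' \<in> carrier (A i)" and s: "inv\<^bsub>A i\<^esub> m \<otimes>\<^bsub>A i\<^esub> m' \<in> F i"
        by (auto simp: chain_steps_def bottlenecks_def)
      let ?g = "?u \<otimes>\<^bsub>P\<^esub> letter i m"
      have L: "letter i m \<in> carrier P" "letter i (inv\<^bsub>A i\<^esub> m \<otimes>\<^bsub>A i\<^esub> m') \<in> carrier P"
        using letter_carrier i mc by auto
      have "m \<otimes>\<^bsub>A i\<^esub> (inv\<^bsub>A i\<^esub> m \<otimes>\<^bsub>A i\<^esub> m') = m'" using mc by (simp add: A.m_assoc[symmetric])
      then have "letter i m \<otimes>\<^bsub>P\<^esub> letter i (inv\<^bsub>A i\<^esub> m \<otimes>\<^bsub>A i\<^esub> m') = letter i m'"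
        using letter_mult_letter[OF i(1) mc(1), of "inv\<^bsub>A i\<^esub> m \<otimes>\<^bsub>A i\<^esub> m'"] mc by simp
      then have next_eq: "?u \<otimes>\<^bsub>P\<^esub> letter i m' = ?g \<otimes>\<^bsub>P\<^esub> letter i (inv\<^bsub>A i\<^esub> m \<otimes>\<^bsub>A i\<^esub> m')"
        using fp.m_assoc[OF u(1) L] by simp
      have "?g \<in> word_cone x" using um[OF mc(1)] by (auto simp: word_cone_def)
      then have "?g \<notin> Z" using disj by blast
      then have "?g \<in> D \<longleftrightarrow> ?u \<otimes>\<^bsub>P\<^esub> letter i m' \<in> D"
        using i(1) s u(1) L(1) unfolding Z_def next_eq by blast
      then show ?case using step.IH by simp
    qed
    moreover have "?u \<otimes>\<^bsub>P\<^esub> letter i a = x @ w @ [p]" using um(1)[OF i(2)] i(3) by (simp add: letter_def p)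
    moreover have "x \<in> D \<longleftrightarrow> ?u \<in> D" using snoc.IH u(1) by blast
    ultimately show ?case by simp
  qed simp
  have "{x \<in> carrier P. \<exists>y\<in>word_cone x. (x \<in> D) \<noteq> (y \<in> D)} \<subseteq> (\<Union>z\<in>Z. (\<lambda>k. take k z) ` {..length z})"
  proof
    fix x assume "x \<in> {x \<in> carrier P. \<exists>y\<in>word_cone x. (x \<in> D) \<noteq> (y \<in> D)}"
    then obtain w where w: "x @ w \<in> carrier P" "(x \<in> D) \<noteq> (x @ w \<in> D)" by (auto simp: word_cone_def)
    then have "word_cone x \<inter> Z \<noteq> {}" using same by blast
    then obtain v where "x @ v \<in> Z" by (auto simp: word_cone_def)
    moreover have "x = take (length x) (x @ v)" by simp
    ultimately show "x \<in> (\<Union>z\<in>Z. (\<lambda>k. take k z) ` {..length z})"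
      by (metis (no_types, lifting) UN_I atMost_iff imageI le_add1 length_append)
  qed
  moreover have "finite (\<Union>z\<in>Z. (\<lambda>k. take k z) ` {..length z})" using \<open>finite Z\<close> by blast
  ultimately show ?thesis by (rule finite_subset)
qed

text \<open>
  Every word \<open>x\<close> can be extended to a word \<open>x'\<close> whose last letter is from the \<open>q\<close>-th factor. The words \<open>x' a b c\<close> and \<open>x' a' b c\<close>, with
  \<open>a \<noteq> a'\<close> fixed and \<open>c\<close> ranging over the infinite factor, are separated by the first
  syllable after \<open>x'\<close>.
\<close>

lemma cone_branches:
  assumes p: "p \<in> I" "infinite (carrier (A p))" and q: "q \<in> I" "q \<noteq> p" "b \<in> carrier (A q)" "b \<noteq> \<one>\<^bsub>A q\<^esub>"
    and x: "x \<in> carrier P"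
  shows "\<exists>D. almost_invariant P D \<and> infinite (word_cone x \<inter> D) \<and> infinite (word_cone x - D)"
proof -
  interpret A: group "A p" by (rule factor_group[OF p(1)])
  let ?N = "carrier (A p) - {\<one>\<^bsub>A p\<^esub>}"
  have inf: "infinite ?N" using p(2) by simp
  then obtain a where a: "a \<in> ?N" by (metis ex_in_conv finite.emptyI)
  have "infinite (?N - {a})" using inf by simp
  then obtain a' where a': "a' \<in> ?N" "a' \<noteq> a" by (metis DiffE ex_in_conv finite.emptyI insertI1)
  define x' where "x' = (if x \<noteq> [] \<and> fst (last x) = q then x else x @ [(q, b)])"
  have x': "x' \<in> carrier P" "x' \<noteq> []" "fst (last x') = q"
    using x q by (auto simp: x'_def reduced_append reduced_Cons)
  define y where "y d c = x' @ [(p, d), (q, b), (p, c)]" for d c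
  have tail: "[(p, d), (q, b), (p, c)] \<in> carrier P" if "d \<in> ?N" "c \<in> ?N" for d c
    using that p q by (auto simp: reduced_Cons)
  have y: "y d c \<in> word_cone x" if "d \<in> ?N" "c \<in> ?N" for d c
    using tail[OF that] x' q(2) unfolding word_cone_def y_def
    by (auto simp: reduced_append x'_def)
  define D where "D = x' <#\<^bsub>P\<^esub> lift p {a}"
  have ai: "almost_invariant P D"
    unfolding D_def
    by (intro fp.almost_invariant_l_coset almost_invariant_lift A.almost_invariant_finite p x') (use a in auto)
  have yD: "y d c \<in> D \<longleftrightarrow> d = a" if "d \<in> ?N" "c \<in> ?N" for d c
  proof -
    have yc: "y d c \<in> carrier P" using y[OF that] by (simp add: word_cone_def)
    have "y d c = x' \<otimes>\<^bsub>P\<^esub> [(p, d), (q, b), (p, c)]" using mult_append yc by (simp add: y_def)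
    then have "inv\<^bsub>P\<^esub> x' \<otimes>\<^bsub>P\<^esub> y d c = [(p, d), (q, b), (p, c)]"
      using x' tail[OF that] by (simp add: fp.m_assoc[symmetric])
    then show ?thesis
      unfolding D_def using fp.l_coset_iff[OF x'(1) _ yc, of "lift p {a}"] tail[OF that]
      by (auto simp: lift_def ipart_def)
  qed
  have inj: "inj_on (y d) ?N" for d by (auto simp: inj_on_def y_def)
  have inf_y: "infinite (y d ` ?N)" for d using inf inj[of d] finite_imageD by blast
  have "y a ` ?N \<subseteq> word_cone x \<inter> D" using y[OF a] yD[OF a] by blast
  then have "infinite (word_cone x \<inter> D)" using inf_y by (rule infinite_super)
  moreover have "y a' ` ?N \<subseteq> word_cone x - D" using y[OF a'(1)] yD[OF a'(1)] a'(2) by blast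
  then have "infinite (word_cone x - D)" using inf_y by (rule infinite_super)
  ultimately show ?thesis using ai by blast
qed

end

section \<open>The Floyd boundary of a free product of elementary groups\<close>

theorem corollary5p6:
  fixes f :: "nat \<Rightarrow> real" and n :: nat and A :: "nat \<Rightarrow> 'a monoid" and S :: "(nat \<times> 'a) list set"
  assumes "floyd_function f"
    and "n \<ge> 2"
    and "\<And>i. i \<in> {1..n} \<Longrightarrow> group (A i) \<and> finitely_generated (A i) \<and> elementary_group (A i)"
    and "\<exists>i\<in>{1..n}. \<exists>j\<in>{1..n}. i \<noteq> j \<and> carrier (A i) \<noteq> {\<one>\<^bsub>A i\<^esub>} \<and> carrier (A j) \<noteq> {\<one>\<^bsub>A j\<^esub>}"
    and "\<exists>i\<in>{1..n}. infinite (carrier (A i))"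
    and "finite S" "S \<subseteq> carrier (free_product {1..n} A)"
    and "generate (free_product {1..n} A) S = carrier (free_product {1..n} A)"
  shows "floyd_boundary f (free_product {1..n} A) S homeomorphic_space top_of_set cantor_set"
proof -
  have grp: "group (A i)" and el: "elementary_group (A i)" if "i \<in> {1..n}" for i
    using assms(3)[OF that] by blast+
  interpret free_prod "{1..n}" A
    by (rule free_prod.intro) (rule grp)
  interpret floyd_graph P S f
    by unfold_locales (use assms(1,6-8) in auto)
  obtain F \<E> where qt: "\<And>i. i \<in> {1..n} \<Longrightarrow> quasi_tree (A i) (F i) (\<E> i)"
    using group.elementary_quasi_tree[OF grp el] by metis
  obtain p where p: "p \<in> {1..n}" "infinite (carrier (A p))" using assms(5) by blast
  obtain q where q: "q \<in> {1..n}" "q \<noteq> p" "carrier (A q) \<noteq> {\<one>\<^bsub>A q\<^esub>}" using assms(4) by metis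
  have "\<one>\<^bsub>A q\<^esub> \<in> carrier (A q)" using grp[OF q(1)] by (simp add: group.is_monoid monoid.one_closed)
  then obtain b where b: "b \<in> carrier (A q)" "b \<noteq> \<one>\<^bsub>A q\<^esub>" using q(3) by blast
  show ?thesis
  proof (rule floyd_boundary_cantor[where C = word_cone])
    show "quasi_tree P (\<Union>i\<in>{1..n}. letter i ` F i) (\<Union>i\<in>{1..n}. lift i ` \<E> i)"
      by (rule quasi_tree_free_product[OF _ qt]) auto
    show "word_cone x \<subseteq> carrier P" for x unfolding word_cone_def by blast
    show "finite {x \<in> carrier P. \<exists>y\<in>word_cone x. (x \<in> D) \<noteq> (y \<in> D)}" if "almost_invariant P D" for D
      by (rule finite_cut_cones[OF _ qt that]) auto
    show "\<exists>D. almost_invariant P D \<and> infinite (word_cone x \<inter> D) \<and> infinite (word_cone x - D)"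
      if "x \<in> carrier P" for x
      by (rule cone_branches[OF p q(1,2) b that])
  qed
qed

end
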